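(* Let $\mu\in\mathcal M_a^*(\mathbb R)$ and let $u$ be the random field solution with initial data $\mu$. Then for every continuous compactly supported $\phi:\mathbb R\to\mathbb R$, $$\lim_{t\to0^+}\int_{\mathbb R}u(t,x)\phi(x)\,dx=\int_{\mathbb R}\phi(x)\,\mu(dx)\quad\text{in }L^2(\Omega).$$
   Context: Fix $a\in(1,2]$ and $\delta\in\mathbb R$ with $|\delta|\le 2-a$ (so $\delta=0$ when $a=2$). Let $G(t,x):=\frac{1}{2\pi}\int_{\mathbb R}\exp\{i\xi x - t|\xi|^a e^{-i\delta\pi\,\mathrm{sgn}(\xi)/2}\}\,d\xi$ for $t>0$, $x\in\mathbb R$; it is the density of an $a$-stable law and the fundamental solution of $\partial_t-{}_xD^a_\delta$, where ${}_xD^a_\delta$ is the Fourier multiplier with symbol $-|\xi|^a e^{-i\delta\pi\,\mathrm{sgn}(\xi)/2}$ (for $a=2$ it is $\partial_x^2$). Let $\dot W$ be a space-time white noise on $\mathbb R_+\times\mathbb R$ on a complete probability space $(\Omega,\mathcal F,P)$, with filtration $\mathcal F_t=\cap_{s>t}\mathcal F^0_s$, where $\mathcal F^0_s$ is generated by the noise up to time $s$ and the $P$-null sets. Let $\rho:\mathbb R\to\mathbb R$ be globally Lipschitz. Let $\mathcal M_a^*(\mathbb R)$ be: for $1<a<2$, the set of signed Borel measures $\mu$ on $\mathbb R$ with $\sup_{y\in\mathbb R}\int_{\mathbb R}|\mu|(dx)\,(1+|y-x|^{1+a})^{-1}<\infty$; for $a=2$, the set of signed Borel measures with $\int e^{-cx^2}|\mu|(dx)<\infty$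 for all $c>0$. For such $\mu$ set $J_0(t,x)=\int G(t,x-y)\mu(dy)$. A random field solution of $\partial_t u={}_xD^a_\delta u+\rho(u)\dot W$, $u(0,\cdot)=\mu$, is an adapted, jointly measurable process $\{u(t,x):t>0,x\in\mathbb R\}$ such that $\int_0^t\!\int G^2(t-s,x-y)E[\rho(u(s,y))^2]\,dy\,ds<\infty$, the map $(t,x)\mapsto I(t,x)$ into $L^2(\Omega)$ is continuous, and $u(t,x)=J_0(t,x)+I(t,x)$ a.s. for every $(t,x)$, where $I(t,x)=\int_0^t\!\int_{\mathbb R}G(t-s,x-y)\rho(u(s,y))\,W(ds,dy)$ (Walsh integral). For every $\mu\in\mathcal M_a^*(\mathbb R)$ such a solution exists and is unique up to versions. *)

theory Defs
  imports "HOL-Probability.Probability"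
begin

text \<open>Fundamental solution G(t,x) of the fractional heat operator (density of an a-stable law).
  The Fourier integral is real-valued; we take its real part.\<close>
definition stableG :: "real \<Rightarrow> real \<Rightarrow> real \<Rightarrow> real \<Rightarrow> real" where
  "stableG a \<delta> t x = Re (integral\<^sup>L lborel (\<lambda>\<xi>::real.
      exp (\<i> * complex_of_real (\<xi> * x)
           - complex_of_real (t * \<bar>\<xi>\<bar> powr a) * exp (- \<i> * complex_of_real (\<delta> * pi * sgn \<xi> / 2))))) / (2 * pi)"

text \<open>A signed Borel measure mu is represented by its Jordan decomposition (mp, mn):
  two Borel measures concentrated on complementary Borel sets; |mu| = mp + mn.\<close>
definition jordan_pair :: "real measure \<Rightarrow> real measure \<Rightarrow> bool" where
  "jordan_pair mp mn \<longleftrightarrow> sets mp = sets borel \<and> sets mn = sets borel \<and>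
     (\<exists>S\<in>sets borel. emeasure mp (UNIV - S) = 0 \<and> emeasure mn S = 0)"

definition M_star :: "real \<Rightarrow> real measure \<Rightarrow> real measure \<Rightarrow> bool" where
  "M_star a mp mn \<longleftrightarrow> jordan_pair mp mn \<and>
     (if a < 2 then
        (\<exists>C::real. \<forall>y::real.
           (\<integral>\<^sup>+ x. ennreal (1 / (1 + \<bar>y - x\<bar> powr (1 + a))) \<partial>mp)
         + (\<integral>\<^sup>+ x. ennreal (1 / (1 + \<bar>y - x\<bar> powr (1 + a))) \<partial>mn) \<le> ennreal C)
      else
        (\<forall>c>0. (\<integral>\<^sup>+ x. ennreal (exp (- c * x\<^sup>2)) \<partial>mp) < \<infinity>
             \<and> (\<integral>\<^sup>+ x. ennreal (exp (- c * x\<^sup>2)) \<partial>mn) < \<infinity>))"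

definition sint :: "real measure \<Rightarrow> real measure \<Rightarrow> (real \<Rightarrow> real) \<Rightarrow> real" where
  "sint mp mn f = (\<integral>x. f x \<partial>mp) - (\<integral>x. f x \<partial>mn)"

definition J0 :: "real \<Rightarrow> real \<Rightarrow> real measure \<Rightarrow> real measure \<Rightarrow> real \<Rightarrow> real \<Rightarrow> real" where
  "J0 a \<delta> mp mn t x = sint mp mn (\<lambda>y. stableG a \<delta> t (x - y))"

definition noise_set :: "(real \<times> real) set \<Rightarrow> bool" where
  "noise_set A \<longleftrightarrow> A \<in> sets (lborel :: (real \<times> real) measure) \<and> A \<subseteq> {0..} \<times> UNIV
     \<and> emeasure (lborel :: (real \<times> real) measure) A < \<infinity>"

text \<open>Space-time white noise: a centered Gaussian family indexed by noise sets with
  covariance E[W(A)W(B)] = Leb(A \<inter> B) (all finite linear combinations are Gaussian).\<close>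
definition white_noise :: "'w measure \<Rightarrow> ((real \<times> real) set \<Rightarrow> 'w \<Rightarrow> real) \<Rightarrow> bool" where
  "white_noise M W \<longleftrightarrow> prob_space M \<and>
     (\<forall>A. noise_set A \<longrightarrow> W A \<in> borel_measurable M) \<and>
     (\<forall>As cs. length cs = length As \<and> (\<forall>A\<in>set As. noise_set A) \<longrightarrow>
        (let Y = (\<lambda>\<omega>. \<Sum>i<length As. cs ! i * W (As ! i) \<omega>);
             v = (\<Sum>i<length As. \<Sum>j<length As.
                    cs ! i * cs ! j * measure (lborel :: (real \<times> real) measure) (As ! i \<inter> As ! j))
         in (v > 0 \<longrightarrow> distributed M lborel Y (normal_density 0 (sqrt v)))
          \<and> (v = 0 \<longrightarrow> (AE \<omega> in M. Y \<omega> = 0))))"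

definition complete_prob :: "'w measure \<Rightarrow> bool" where
  "complete_prob M \<longleftrightarrow> prob_space M \<and> (\<forall>N\<in>null_sets M. \<forall>A. A \<subseteq> N \<longrightarrow> A \<in> sets M)"

definition F0 :: "'w measure \<Rightarrow> ((real \<times> real) set \<Rightarrow> 'w \<Rightarrow> real) \<Rightarrow> real \<Rightarrow> 'w set set" where
  "F0 M W s = sigma_sets (space M)
     ({W A -` B \<inter> space M | A B. noise_set A \<and> A \<subseteq> {0..s} \<times> UNIV \<and> B \<in> sets (borel :: real measure)}
      \<union> null_sets M)"

definition filt :: "'w measure \<Rightarrow> ((real \<times> real) set \<Rightarrow> 'w \<Rightarrow> real) \<Rightarrow> real \<Rightarrow> 'w set set" where
  "filt M W t = (\<Inter>s\<in>{t<..}. F0 M W s)"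

definition meas_wrt :: "'w measure \<Rightarrow> 'w set set \<Rightarrow> ('w \<Rightarrow> real) \<Rightarrow> bool" where
  "meas_wrt M F X \<longleftrightarrow> (\<forall>B\<in>sets (borel :: real measure). X -` B \<inter> space M \<in> F)"

definition simple_proc :: "'w measure \<Rightarrow> ((real \<times> real) set \<Rightarrow> 'w \<Rightarrow> real)
    \<Rightarrow> (('w \<Rightarrow> real) \<times> real \<times> real \<times> real set) list \<Rightarrow> bool" where
  "simple_proc M W ps \<longleftrightarrow> (\<forall>(X, a, b, A)\<in>set ps. 0 \<le> a \<and> a < b \<and>
     A \<in> sets (lborel :: real measure) \<and> emeasure (lborel :: real measure) A < \<infinity> \<and>
     meas_wrt M (filt M W a) X \<and> (\<exists>C. \<forall>\<omega>\<in>space M. \<bar>X \<omega>\<bar> \<le> C))"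

definition sp_eval :: "(('w \<Rightarrow> real) \<times> real \<times> real \<times> real set) list \<Rightarrow> real \<Rightarrow> real \<Rightarrow> 'w \<Rightarrow> real" where
  "sp_eval ps s y \<omega> = (\<Sum>(X, a, b, A)\<leftarrow>ps. X \<omega> * indicator ({a<..b} \<times> A) (s, y))"

definition sp_int :: "((real \<times> real) set \<Rightarrow> 'w \<Rightarrow> real)
    \<Rightarrow> (('w \<Rightarrow> real) \<times> real \<times> real \<times> real set) list \<Rightarrow> 'w \<Rightarrow> real" where
  "sp_int W ps \<omega> = (\<Sum>(X, a, b, A)\<leftarrow>ps. X \<omega> * W ({a<..b} \<times> A) \<omega>)"

definition walsh_integral :: "'w measure \<Rightarrow> ((real \<times> real) set \<Rightarrow> 'w \<Rightarrow> real)
    \<Rightarrow> (real \<Rightarrow> real \<Rightarrow> 'w \<Rightarrow> real) \<Rightarrow> ('w \<Rightarrow> real) \<Rightarrow> bool" where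
  "walsh_integral M W f I \<longleftrightarrow> I \<in> borel_measurable M \<and>
     (\<exists>pss. (\<forall>n. simple_proc M W (pss n)) \<and>
        (\<lambda>n. \<integral>\<^sup>+ p. \<integral>\<^sup>+ \<omega>. ennreal ((sp_eval (pss n) (fst p) (snd p) \<omega> - f (fst p) (snd p) \<omega>)\<^sup>2) \<partial>M
              \<partial>(lborel :: (real \<times> real) measure)) \<longlonglongrightarrow> 0 \<and>
        (\<lambda>n. \<integral>\<^sup>+ \<omega>. ennreal ((sp_int W (pss n) \<omega> - I \<omega>)\<^sup>2) \<partial>M) \<longlonglongrightarrow> 0)"

text \<open>Random field solution of  du = D u dt + rho(u) dW,  u(0) = mp - mn.\<close>
definition is_solution :: "real \<Rightarrow> real \<Rightarrow> 'w measure \<Rightarrow> ((real \<times> real) set \<Rightarrow> 'w \<Rightarrow> real)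
    \<Rightarrow> (real \<Rightarrow> real) \<Rightarrow> real measure \<Rightarrow> real measure \<Rightarrow> (real \<Rightarrow> real \<Rightarrow> 'w \<Rightarrow> real) \<Rightarrow> bool" where
  "is_solution a \<delta> M W \<rho> mp mn u \<longleftrightarrow>
     (\<forall>t>0. \<forall>x. meas_wrt M (filt M W t) (u t x)) \<and>
     (\<lambda>(p, \<omega>). u (fst p) (snd p) \<omega>)
        \<in> borel_measurable (restrict_space (lborel :: (real \<times> real) measure) ({0<..} \<times> UNIV) \<Otimes>\<^sub>M M) \<and>
     (\<forall>t>0. \<forall>x. (\<integral>\<^sup>+ p. \<integral>\<^sup>+ \<omega>. ennreal (indicator ({0<..<t} \<times> UNIV) p
            * (stableG a \<delta> (t - fst p) (x - snd p))\<^sup>2 * (\<rho> (u (fst p) (snd p) \<omega>))\<^sup>2) \<partial>M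
          \<partial>(lborel :: (real \<times> real) measure)) < \<infinity>) \<and>
     (\<exists>I :: real \<Rightarrow> real \<Rightarrow> 'w \<Rightarrow> real.
        (\<forall>t>0. \<forall>x. walsh_integral M W
             (\<lambda>s y \<omega>. indicator {0<..<t} s * stableG a \<delta> (t - s) (x - y) * \<rho> (u s y \<omega>)) (I t x)) \<and>
        (\<forall>t>0. \<forall>x. ((\<lambda>p. \<integral>\<^sup>+ \<omega>. ennreal ((I (fst p) (snd p) \<omega> - I t x \<omega>)\<^sup>2) \<partial>M) \<longlongrightarrow> 0)
             (at (t, x) within {0<..} \<times> UNIV)) \<and>
        (\<forall>t>0. \<forall>x. AE \<omega> in M. u t x \<omega> = J0 a \<delta> mp mn t x + I t x \<omega>))"

end

theory Submission
  imports Defs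
begin

text \<open>
  The kernel \<open>G\<close> is nonnegative: its symbol is \<open>p (- i \<xi>)\<^sup>a + q (i \<xi>)\<^sup>a\<close> with \<open>p, q \<ge> 0\<close>, the limit of
  \<open>h\<^bsup>-a\<^esup> z\<^bsup>-1\<^esup> (1 - z)\<^sup>a\<close> for \<open>z = exp (i \<xi> h)\<close> and its mirror image, and as \<open>1 < a \<le> 2\<close> all Laurent
  coefficients of \<open>z\<^bsup>-1\<^esup> (1 - z)\<^sup>a\<close> except the constant one are nonnegative. Hence \<open>exp (- t |\<xi>|\<^sup>a \<dots>)\<close> is a
  limit of trigonometric sums with nonnegative coefficients, and its Fourier transform is nonnegative.

  By nonnegativity and the semigroup property, a single late kernel controls all early ones on a
  window: \<open>\<integral>\<^bsub>|z| \<le> K\<^esub> G(t - s, z - y) dz \<le> C G(T - s, x - y)\<close> for \<open>0 \<le> s < t \<le> t\<^sub>0\<close>. For \<open>s = 0\<close>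
  this dominates the integrals \<open>\<integral> \<phi>(x) J\<^sub>0(t, x) dx\<close>, which converge to \<open>\<integral> \<phi> d\<mu>\<close>. For the noise part,
  the Walsh isometry and Fubini's theorem give
  \<open>E (\<integral> \<phi>(x) I(t, x) dx)\<^sup>2 = \<integral>\<^bsub>0\<^esub>\<^bsup>t\<^esup> \<integral> (\<integral> \<phi>(x) G(t - s, x - y) dx)\<^sup>2 E \<rho>(u(s, y))\<^sup>2 dy ds\<close>,
  at most a constant times \<open>\<integral>\<^bsub>0\<^esub>\<^bsup>t\<^esup> \<integral> G(T - s, x - y)\<^sup>2 E \<rho>(u(s, y))\<^sup>2 dy ds\<close>, which tends to 0 with \<open>t\<close>
  because the integral up to time \<open>T\<close> is finite.
\<close>

section \<open>Positive trigonometric sums and nonnegative Fourier transforms\<close>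

text \<open>Of the kernel only a Fourier integral is given, so positivity, total mass and the
  semigroup law all have to be drawn from the symbol. For positivity the shift by
  \<open>1 / z\<close> is decisive: the weights of \<open>(1 - z)^a\<close> are \<open>1\<close>,
  \<open>- a\<close>, and then nonnegative. Unshifted, the negative weight would sit on a genuine
  frequency; shifted, it is a constant, and exponentiation turns it into a harmless positive factor.
  The noise part is shaped by what a solution offers: no moment bounds on \<open>u\<close>, but
  finiteness of the energy integral at each single point. Hence the late kernel: the energy at one
  fixed point \<open>(T, x0)\<close> dominates the variances of all early averages. Two gaps have to
  be bridged on the way. The filtration is right-continuous, so an integrand starting at time
  \<open>a\<close> is measurable for the noise up to every strictly later time, and independence of
  the noise after \<open>a\<close> is reached through a limit. And \<open>I t x\<close> is given
  separately for each \<open>x\<close>, so integrals over \<open>x\<close> are taken of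
  \<open>u - J0\<close>, which is jointly measurable.\<close>

lemma integrable_exp_neg_abs:
  fixes c :: real
  assumes "0 < c"
  shows "integrable lborel (\<lambda>x. exp (- c * \<bar>x\<bar>))"
proof -
  interpret prob_space "density lborel (exponential_density c)"
    using assms by (rule prob_space_exponential_density)
  have "integrable (density lborel (exponential_density c)) (\<lambda>x. 1::real)"
    by simp
  then have e: "integrable lborel (exponential_density c)"
    by (subst (asm) integrable_density) (auto simp: exponential_density_nonneg assms)
  have e': "integrable lborel (\<lambda>x. exponential_density c (0 + (-1) * x))"
    using e by (rule lborel_integrable_real_affine) simp
  show ?thesis
  proof (rule Bochner_Integration.integrable_bound)
    show "integrable lborel (\<lambda>x. (exponential_density c x + exponential_density c (0 + (-1) * x)) / c)"
      using e e' by auto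
    show "AE x in lborel. norm (exp (- c * \<bar>x\<bar>))
        \<le> norm ((exponential_density c x + exponential_density c (0 + (-1) * x)) / c)"
      using assms by (auto simp: exponential_density_def abs_if mult.commute intro!: AE_I2)
  qed simp
qed

lemma integrable_exp_neg_powr:
  fixes c a :: real
  assumes "0 < c" "1 \<le> a"
  shows "integrable lborel (\<lambda>x. exp (- c * \<bar>x\<bar> powr a))"
proof (rule Bochner_Integration.integrable_bound)
  show "integrable lborel (\<lambda>x. exp c * exp (- c * \<bar>x\<bar>))"
    using integrable_exp_neg_abs[OF assms(1)] by auto
  have "exp (- c * \<bar>x\<bar> powr a) \<le> exp c * exp (- c * \<bar>x\<bar>)" for x
  proof -
    have "\<bar>x\<bar> \<le> \<bar>x\<bar> powr a + 1"
    proof (cases "\<bar>x\<bar> \<le> 1")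
      case True
      then show ?thesis by (simp add: add_increasing)
    next
      case False
      then have "\<bar>x\<bar> powr 1 \<le> \<bar>x\<bar> powr a" using assms by (intro powr_mono) auto
      then show ?thesis using False by simp
    qed
    then have "c * \<bar>x\<bar> \<le> c * (\<bar>x\<bar> powr a + 1)" using assms by (intro mult_left_mono) auto
    then show ?thesis by (simp add: exp_add[symmetric] algebra_simps)
  qed
  then show "AE x in lborel. norm (exp (- c * \<bar>x\<bar> powr a)) \<le> norm (exp c * exp (- c * \<bar>x\<bar>))"
    by (auto intro!: AE_I2)
qed simp

lemma integrable_gauss:
  fixes \<epsilon> :: real
  assumes "0 < \<epsilon>"
  shows "integrable lborel (\<lambda>x. exp (- \<epsilon> * x\<^sup>2 / 2))"
  using integrable_exp_neg_powr[of "\<epsilon>/2" 2] assms by (simp add: powr_numeral)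

text \<open>The substitution \<open>\<xi> = v / sqrt \<epsilon>\<close> turns the integral into the
  characteristic function of the standard normal law.\<close>

lemma fourier_gauss:
  fixes \<epsilon> x :: real
  assumes "0 < \<epsilon>"
  shows "(\<integral>\<xi>. iexp (\<xi> * x) * exp (- \<epsilon> * \<xi>\<^sup>2 / 2) \<partial>lborel)
       = of_real (sqrt (2 * pi / \<epsilon>) * exp (- x\<^sup>2 / (2 * \<epsilon>)))"
proof -
  have "(\<integral>\<xi>. iexp (\<xi> * x) * exp (- \<epsilon> * \<xi>\<^sup>2 / 2) \<partial>lborel)
      = \<bar>1 / sqrt \<epsilon>\<bar> *\<^sub>R (\<integral>v. iexp ((0 + 1 / sqrt \<epsilon> * v) * x) * exp (- \<epsilon> * (0 + 1 / sqrt \<epsilon> * v)\<^sup>2 / 2) \<partial>lborel)"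
    by (rule lborel_integral_real_affine) (use assms in auto)
  also have "\<dots> = (1 / sqrt \<epsilon>) *\<^sub>R (\<integral>v. of_real (sqrt (2 * pi)) * (std_normal_density v *\<^sub>R iexp (x / sqrt \<epsilon> * v)) \<partial>lborel)"
  proof -
    have "iexp ((0 + 1 / sqrt \<epsilon> * v) * x) * exp (- \<epsilon> * (0 + 1 / sqrt \<epsilon> * v)\<^sup>2 / 2)
       = of_real (sqrt (2 * pi)) * (std_normal_density v *\<^sub>R iexp (x / sqrt \<epsilon> * v))" for v
      using assms by (simp add: std_normal_density_def scaleR_conv_of_real power_mult_distrib power_divide mult_ac)
    then show ?thesis using assms by simp
  qed
  also have "(\<integral>v. of_real (sqrt (2 * pi)) * (std_normal_density v *\<^sub>R iexp (x / sqrt \<epsilon> * v)) \<partial>lborel)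
     = of_real (sqrt (2 * pi)) * char std_normal_distribution (x / sqrt \<epsilon>)"
    unfolding char_def
    by (subst integral_density, simp, simp, simp) (simp only: integral_mult_right_zero)
  finally show ?thesis
    using assms by (simp add: char_std_normal_distribution scaleR_conv_of_real real_sqrt_divide power_divide)
qed

text \<open>Transforms of finitely supported positive measures on the line. The class is closed
  under sums and products, hence under powers.\<close>

inductive pos_trig :: "(real \<Rightarrow> complex) \<Rightarrow> bool" where
  pos_trig_iexp: "0 \<le> c \<Longrightarrow> pos_trig (\<lambda>\<xi>. of_real c * iexp (\<xi> * y))"
| pos_trig_add: "pos_trig f \<Longrightarrow> pos_trig g \<Longrightarrow> pos_trig (\<lambda>\<xi>. f \<xi> + g \<xi>)"

lemma pos_trig_const: "0 \<le> c \<Longrightarrow> pos_trig (\<lambda>\<xi>. of_real c)"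
  using pos_trig_iexp[of c 0] by simp

lemma pos_trig_mult:
  assumes f: "pos_trig f" and g: "pos_trig g"
  shows "pos_trig (\<lambda>\<xi>. f \<xi> * g \<xi>)"
  using f
proof induction
  case (pos_trig_iexp c y)
  show ?case using g
  proof induction
    case (pos_trig_iexp d z)
    show ?case
      using pos_trig.pos_trig_iexp[of "c * d" "y + z"] \<open>0 \<le> c\<close> \<open>0 \<le> d\<close>
      by (simp add: distrib_left exp_add mult_ac)
  next
    case (pos_trig_add f g)
    then show ?case by (auto simp: distrib_left intro: pos_trig.pos_trig_add)
  qed
next
  case (pos_trig_add f g)
  then show ?case by (auto simp: distrib_right intro: pos_trig.pos_trig_add)
qed

lemma pos_trig_sum: "(\<And>k. k \<in> A \<Longrightarrow> pos_trig (f k)) \<Longrightarrow> pos_trig (\<lambda>\<xi>. \<Sum>k\<in>A. f k \<xi>)"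
  by (induction A rule: infinite_finite_induct)
     (use pos_trig_const[of 0] in \<open>auto intro!: pos_trig_add\<close>)

lemma pos_trig_power: "pos_trig f \<Longrightarrow> pos_trig (\<lambda>\<xi>. f \<xi> ^ n)"
  by (induction n) (use pos_trig_const[of 1] in \<open>auto intro!: pos_trig_mult\<close>)

lemma pos_trig_reflect: "pos_trig f \<Longrightarrow> pos_trig (\<lambda>\<xi>. f (- \<xi>))"
proof (induction rule: pos_trig.induct)
  case (pos_trig_iexp c y)
  then show ?case using pos_trig.pos_trig_iexp[of c "-y"] by simp
qed (auto intro: pos_trig_add)

text \<open>At 0 every exponential equals 1 and no coefficient is negative, so nothing cancels
  there. This supplies the uniform bounds for the limits below.\<close>

lemma pos_trig_bound: "pos_trig f \<Longrightarrow> cmod (f \<xi>) \<le> Re (f 0)"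
proof (induction rule: pos_trig.induct)
  case (pos_trig_add f g)
  then show ?case using norm_triangle_ineq[of "f \<xi>" "g \<xi>"] by simp
qed (simp add: norm_mult)

lemma pos_trig_measurable: "pos_trig f \<Longrightarrow> f \<in> borel_measurable borel"
  by (induction rule: pos_trig.induct) (auto intro!: borel_measurable_continuous_onI continuous_intros)

text \<open>Trigonometric sums are bounded but not integrable, so the transform is tested after
  multiplication by a Gaussian. On the transform side this is smoothing with a positive kernel,
  which preserves nonnegativity.\<close>

definition nonneg_FT :: "(real \<Rightarrow> complex) \<Rightarrow> bool" where
  "nonneg_FT g \<longleftrightarrow> g \<in> borel_measurable borel \<and>
     (\<forall>x. \<forall>\<epsilon>>0. 0 \<le> Re (\<integral>\<xi>. g \<xi> * (iexp (\<xi> * x) * exp (- \<epsilon> * \<xi>\<^sup>2 / 2)) \<partial>lborel))"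

lemma integrable_bounded_gauss:
  fixes g :: "real \<Rightarrow> complex"
  assumes "g \<in> borel_measurable borel" "\<And>\<xi>. cmod (g \<xi>) \<le> B" "0 < \<epsilon>"
  shows "integrable lborel (\<lambda>\<xi>. g \<xi> * (iexp (\<xi> * x) * exp (- \<epsilon> * \<xi>\<^sup>2 / 2)))"
proof (rule Bochner_Integration.integrable_bound)
  show "integrable lborel (\<lambda>\<xi>. B * exp (- \<epsilon> * \<xi>\<^sup>2 / 2))"
    using integrable_gauss[OF assms(3)] by simp
  have "0 \<le> B" using order_trans[OF norm_ge_zero assms(2)] .
  have "cmod (exp (- complex_of_real \<epsilon> * (complex_of_real \<xi>)\<^sup>2 / 2)) = exp (- \<epsilon> * \<xi>\<^sup>2 / 2)" for \<xi>
    by (simp flip: of_real_power of_real_mult)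
  then show "AE \<xi> in lborel. norm (g \<xi> * (iexp (\<xi> * x) * exp (- \<epsilon> * \<xi>\<^sup>2 / 2))) \<le> norm (B * exp (- \<epsilon> * \<xi>\<^sup>2 / 2))"
    using assms \<open>0 \<le> B\<close> by (auto intro!: AE_I2 mult_right_mono simp: norm_mult)
qed (use assms in auto)

text \<open>A factor \<open>iexp (\<xi> * y)\<close> shifts the transform of the Gaussian, which is
  a positive Gaussian by \<open>fourier_gauss\<close>; sums follow by linearity.\<close>

lemma nonneg_FT_pos_trig: "pos_trig f \<Longrightarrow> nonneg_FT f"
proof (induction rule: pos_trig.induct)
  case (pos_trig_iexp c y)
  have "Re (\<integral>\<xi>. of_real c * iexp (\<xi> * y) * (iexp (\<xi> * x) * exp (- \<epsilon> * \<xi>\<^sup>2 / 2)) \<partial>lborel) \<ge> 0" if "\<epsilon> > 0" for x \<epsilon>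
  proof -
    have "(\<integral>\<xi>. of_real c * iexp (\<xi> * y) * (iexp (\<xi> * x) * exp (- \<epsilon> * \<xi>\<^sup>2 / 2)) \<partial>lborel)
        = (\<integral>\<xi>. of_real c * (iexp (\<xi> * (y + x)) * exp (- \<epsilon> * \<xi>\<^sup>2 / 2)) \<partial>lborel)"
      by (intro Bochner_Integration.integral_cong) (auto simp: exp_add distrib_left mult_ac)
    then show ?thesis
      using that pos_trig_iexp fourier_gauss[of \<epsilon> "y + x"] by simp
  qed
  then show ?case
    using pos_trig_measurable[OF pos_trig.pos_trig_iexp[OF pos_trig_iexp]] by (auto simp: nonneg_FT_def)
next
  case (pos_trig_add f g)
  have "Re (\<integral>\<xi>. (f \<xi> + g \<xi>) * (iexp (\<xi> * x) * exp (- \<epsilon> * \<xi>\<^sup>2 / 2)) \<partial>lborel) \<ge> 0" if "\<epsilon> > 0" for x \<epsilon>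
  proof -
    have i: "integrable lborel (\<lambda>\<xi>. h \<xi> * (iexp (\<xi> * x) * exp (- \<epsilon> * \<xi>\<^sup>2 / 2)))" if "pos_trig h" for h
      by (rule integrable_bounded_gauss[OF pos_trig_measurable[OF that] pos_trig_bound[OF that] \<open>\<epsilon> > 0\<close>])
    show ?thesis
      unfolding distrib_right
      using i[OF pos_trig_add.hyps(1)] i[OF pos_trig_add.hyps(2)] pos_trig_add.IH that
      by (simp add: nonneg_FT_def)
  qed
  then show ?case using pos_trig_add.IH by (auto simp: nonneg_FT_def)
qed

lemma nonneg_FT_limit:
  assumes g: "\<And>n. nonneg_FT (g n)" and B: "\<And>n \<xi>. cmod (g n \<xi>) \<le> B"
    and lim: "\<And>\<xi>. (\<lambda>n. g n \<xi>) \<longlonglongrightarrow> h \<xi>"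
  shows "nonneg_FT h"
proof -
  have [measurable]: "g n \<in> borel_measurable borel" for n using g by (auto simp: nonneg_FT_def)
  have [measurable]: "h \<in> borel_measurable borel"
    by (rule borel_measurable_LIMSEQ_metric[where f=g]) (use lim in auto)
  have "0 \<le> Re (\<integral>\<xi>. h \<xi> * (iexp (\<xi> * x) * exp (- \<epsilon> * \<xi>\<^sup>2 / 2)) \<partial>lborel)" if \<epsilon>: "\<epsilon> > 0" for x \<epsilon>
  proof -
    have "(\<lambda>n. \<integral>\<xi>. g n \<xi> * (iexp (\<xi> * x) * exp (- \<epsilon> * \<xi>\<^sup>2 / 2)) \<partial>lborel)
       \<longlonglongrightarrow> (\<integral>\<xi>. h \<xi> * (iexp (\<xi> * x) * exp (- \<epsilon> * \<xi>\<^sup>2 / 2)) \<partial>lborel)"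
    proof (rule integral_dominated_convergence)
      show "integrable lborel (\<lambda>\<xi>. B * exp (- \<epsilon> * \<xi>\<^sup>2 / 2))"
        using integrable_gauss[OF \<epsilon>] by simp
      have "cmod (exp (- complex_of_real \<epsilon> * (complex_of_real \<xi>)\<^sup>2 / 2)) = exp (- \<epsilon> * \<xi>\<^sup>2 / 2)" for \<xi>
        by (simp flip: of_real_power of_real_mult)
      then show "AE \<xi> in lborel. norm (g n \<xi> * (iexp (\<xi> * x) * exp (- \<epsilon> * \<xi>\<^sup>2 / 2))) \<le> B * exp (- \<epsilon> * \<xi>\<^sup>2 / 2)" for n
        using B by (auto intro!: AE_I2 mult_right_mono simp: norm_mult)
      show "AE \<xi> in lborel. (\<lambda>n. g n \<xi> * (iexp (\<xi> * x) * exp (- \<epsilon> * \<xi>\<^sup>2 / 2))) \<longlonglongrightarrow> h \<xi> * (iexp (\<xi> * x) * exp (- \<epsilon> * \<xi>\<^sup>2 / 2))"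
        using lim by (auto intro!: AE_I2 tendsto_mult_right)
    qed auto
    then have "(\<lambda>n. Re (\<integral>\<xi>. g n \<xi> * (iexp (\<xi> * x) * exp (- \<epsilon> * \<xi>\<^sup>2 / 2)) \<partial>lborel))
       \<longlonglongrightarrow> Re (\<integral>\<xi>. h \<xi> * (iexp (\<xi> * x) * exp (- \<epsilon> * \<xi>\<^sup>2 / 2)) \<partial>lborel)"
      by (rule tendsto_Re)
    then show ?thesis
      by (rule LIMSEQ_le_const) (use g \<epsilon> in \<open>auto simp: nonneg_FT_def\<close>)
  qed
  then show ?thesis by (auto simp: nonneg_FT_def)
qed

lemma nonneg_FT_exp_pos_trig:
  assumes "pos_trig f"
  shows "nonneg_FT (\<lambda>\<xi>. exp (f \<xi>))"
proof -
  let ?g = "\<lambda>n \<xi>. \<Sum>k<n. of_real (1 / fact k) * f \<xi> ^ k"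
  have p: "pos_trig (?g n)" for n
    by (rule pos_trig_sum, rule pos_trig_mult[OF pos_trig_const pos_trig_power[OF assms]]) simp
  have lim: "(\<lambda>n. ?g n \<xi>) \<longlonglongrightarrow> exp (f \<xi>)" for \<xi>
    using exp_converges[of "f \<xi>"] by (simp add: sums_def scaleR_conv_of_real divide_inverse)
  \<comment> \<open>At \<open>\<xi> = 0\<close> the partial sums converge and are therefore bounded;
    \<open>pos_trig_bound\<close> carries the bound to every \<open>\<xi>\<close>.\<close>
  have "Bseq (\<lambda>n. ?g n 0)" by (rule convergent_imp_Bseq) (use lim in \<open>auto simp: convergent_def\<close>)
  then obtain B where B: "\<forall>n. cmod (?g n 0) \<le> B" by (elim BseqE)
  show ?thesis
  proof (rule nonneg_FT_limit[where g="?g" and B=B])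
    show "cmod (?g n \<xi>) \<le> B" for n \<xi>
      using pos_trig_bound[OF p[of n], of \<xi>] B[rule_format, of n] complex_Re_le_cmod[of "?g n 0"]
      by linarith
  qed (use lim nonneg_FT_pos_trig[OF p] in auto)
qed

section \<open>Shifted binomial differences\<close>

lemma nonneg_FT_scale:
  assumes "nonneg_FT g" "0 \<le> c"
  shows "nonneg_FT (\<lambda>\<xi>. of_real c * g \<xi>)"
  using assms by (auto simp: nonneg_FT_def mult.assoc)

text \<open>The weights of the binomial series of \<open>(1 - z)^a\<close>, known from
  Gruenwald-Letnikov difference quotients.\<close>

definition gl_coeff :: "real \<Rightarrow> nat \<Rightarrow> real" where
  "gl_coeff a k = (-1) ^ k * (a gchoose k)"

lemma gl_coeff_0 [simp]: "gl_coeff a 0 = 1" and gl_coeff_1 [simp]: "gl_coeff a (Suc 0) = - a"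
  by (simp_all add: gl_coeff_def)

lemma gl_coeff_Suc: "gl_coeff a (Suc k) = (real k - a) / real (Suc k) * gl_coeff a k"
proof -
  have "real (Suc k) * (a gchoose Suc k) = (a - real k) * (a gchoose k)"
    using gbinomial_mult_1[of a k] by (simp add: algebra_simps)
  then have "(a gchoose Suc k) = (a - real k) / real (Suc k) * (a gchoose k)"
    by (simp add: field_simps)
  then have "gl_coeff a (Suc k) = - ((-1) ^ k * ((a - real k) / real (Suc k) * (a gchoose k)))"
    by (simp only: gl_coeff_def) simp
  also have "\<dots> = - ((a - real k) / real (Suc k)) * gl_coeff a k"
    by (simp only: gl_coeff_def) (simp add: mult_ac)
  also have "- ((a - real k) / real (Suc k)) = (real k - a) / real (Suc k)"
    by (simp add: minus_divide_left)
  finally show ?thesis .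
qed

text \<open>The weight at 2 is \<open>a * (a - 1) / 2\<close>, nonnegative for
  \<open>a >= 1\<close>; each further factor \<open>(k - a) / (k + 1)\<close> of the recursion has
  \<open>k >= 2\<close> and is nonnegative for \<open>a <= 2\<close>.\<close>

lemma gl_coeff_nonneg:
  assumes "1 \<le> a" "a \<le> 2"
  shows "0 \<le> gl_coeff a (k + 2)"
proof (induction k)
  case 0
  show ?case using assms by (simp add: gl_coeff_Suc numeral_2_eq_2 mult_nonpos_nonneg)
next
  case (Suc k)
  have "gl_coeff a (Suc k + 2) = (real (k + 2) - a) / real (k + 3) * gl_coeff a (k + 2)"
    using gl_coeff_Suc[of a "k + 2"] by (simp add: add_ac numeral_eq_Suc)
  moreover have "0 \<le> (real (k + 2) - a) / real (k + 3)"
    using assms by (intro divide_nonneg_nonneg) auto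
  ultimately show ?case using Suc by (simp only: mult_nonneg_nonneg)
qed

lemma gl_coeff_sums:
  fixes z :: complex
  assumes "cmod z < 1"
  shows "(\<lambda>k. of_real (gl_coeff a k) * z ^ k) sums (1 - z) powr (of_real a)"
proof -
  have "complex_of_real a gchoose n = of_real (a gchoose n)" for n
    by (simp add: gbinomial_prod_rev)
  then show ?thesis
    using gen_binomial_complex[of "- z" "of_real a"] assms
    by (simp add: gl_coeff_def power_minus[of z] mult_ac)
qed

definition gl_arg :: "real \<Rightarrow> real \<Rightarrow> complex" where
  "gl_arg h \<xi> = of_real (exp (- h\<^sup>2)) * iexp (\<xi> * h)"

text \<open>The symbol of the shifted Gruenwald--Letnikov difference operator (exponentially damped by
  \<open>exp (- h\<^sup>2)\<close>, so that the binomial series converges).\<close>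

definition gl_symbol :: "real \<Rightarrow> real \<Rightarrow> real \<Rightarrow> complex" where
  "gl_symbol a h \<xi> = (1 - gl_arg h \<xi>) powr (of_real a) / gl_arg h \<xi>"

lemma gl_arg_nonzero [simp]: "gl_arg h \<xi> \<noteq> 0"
  by (simp add: gl_arg_def)

text \<open>Partial sums of the binomial series divided by \<open>z\<close>, with the linear term
  \<open>- a * z\<close> left out: index 0 gives \<open>1 / z\<close>, index \<open>k + 2\<close>
  the power \<open>k + 1\<close>.\<close>

definition gl_partial :: "real \<Rightarrow> real \<Rightarrow> nat \<Rightarrow> real \<Rightarrow> complex" where
  "gl_partial a h n \<xi> = 1 / gl_arg h \<xi> + (\<Sum>k<n. of_real (gl_coeff a (k + 2)) * gl_arg h \<xi> ^ (k + 1))"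

lemma gl_partial_limit:
  assumes "0 < h"
  shows "(\<lambda>n. gl_partial a h n \<xi>) \<longlonglongrightarrow> gl_symbol a h \<xi> + of_real a"
proof -
  let ?z = "gl_arg h \<xi>"
  have "cmod ?z < 1" using assms by (simp add: gl_arg_def norm_mult)
  then have "(\<lambda>k. of_real (gl_coeff a k) * ?z ^ k) sums (1 - ?z) powr (of_real a)"
    by (rule gl_coeff_sums)
  \<comment> \<open>The two terms split off are \<open>1\<close> and \<open>- a * z\<close>; divided
    by \<open>z\<close> they account for the \<open>1 / z\<close> in \<open>gl_partial\<close> and
    the constant \<open>a\<close> in the claim.\<close>
  from sums_split_initial_segment[OF this, of 2]
  have "(\<lambda>k. of_real (gl_coeff a (k + 2)) * ?z ^ (k + 2)) sums ((1 - ?z) powr (of_real a) - 1 + of_real a * ?z)"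
    by (simp add: numeral_2_eq_2 algebra_simps)
  then have "(\<lambda>k. of_real (gl_coeff a (k + 2)) * ?z ^ (k + 2) / ?z) sums (((1 - ?z) powr (of_real a) - 1 + of_real a * ?z) / ?z)"
    by (rule sums_divide)
  then have "(\<lambda>k. of_real (gl_coeff a (k + 2)) * ?z ^ (k + 1)) sums (gl_symbol a h \<xi> + of_real a - 1 / ?z)"
    by (simp add: gl_symbol_def diff_divide_distrib add_divide_distrib diff_add_eq)
  then have "(\<lambda>n. 1 / ?z + (\<Sum>k<n. of_real (gl_coeff a (k + 2)) * ?z ^ (k + 1))) \<longlonglongrightarrow> 1 / ?z + (gl_symbol a h \<xi> + of_real a - 1 / ?z)"
    unfolding sums_def by (intro tendsto_add tendsto_const)
  then show ?thesis by (simp add: gl_partial_def)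
qed

lemma pos_trig_gl_partial:
  assumes "1 \<le> a" "a \<le> 2"
  shows "pos_trig (gl_partial a h n)"
proof -
  have 1: "pos_trig (\<lambda>\<xi>. 1 / gl_arg h \<xi>)"
  proof -
    have "(\<lambda>\<xi>. 1 / gl_arg h \<xi>) = (\<lambda>\<xi>. of_real (exp (h\<^sup>2)) * iexp (\<xi> * - h))"
      by (rule ext) (simp add: gl_arg_def exp_minus field_simps)
    then show ?thesis using pos_trig_iexp[of "exp (h\<^sup>2)" "- h"] by simp
  qed
  have 2: "pos_trig (gl_arg h)"
    unfolding gl_arg_def[abs_def] by (rule pos_trig_iexp) simp
  have "pos_trig (\<lambda>\<xi>. of_real (gl_coeff a (k + 2)) * gl_arg h \<xi> ^ (k + 1))" for k
    by (rule pos_trig_mult[OF pos_trig_const pos_trig_power[OF 2]]) (rule gl_coeff_nonneg[OF assms])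
  then show ?thesis
    unfolding gl_partial_def[abs_def] by (intro pos_trig_add[OF 1] pos_trig_sum)
qed

text \<open>This is \<open>pos_trig_bound\<close> in the limit, where the constant \<open>a\<close>
  cancels. It reduces uniform bounds on the symbol to the frequency 0.\<close>

lemma gl_symbol_bound:
  assumes "1 \<le> a" "a \<le> 2" "0 < h"
  shows "Re (gl_symbol a h \<xi>) \<le> Re (gl_symbol a h 0)"
proof -
  have "Re (gl_symbol a h \<xi> + of_real a) \<le> Re (gl_symbol a h 0 + of_real a)"
  proof (rule LIMSEQ_le)
    show "\<exists>N. \<forall>n\<ge>N. Re (gl_partial a h n \<xi>) \<le> Re (gl_partial a h n 0)"
      using pos_trig_bound[OF pos_trig_gl_partial[OF assms(1,2)]] complex_Re_le_cmod order_trans by blast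
  qed (intro tendsto_Re gl_partial_limit assms(3))+
  then show ?thesis by simp
qed

lemma nonneg_FT_gl_symbol:
  assumes a: "1 \<le> a" "a \<le> 2" "0 < h" and p: "0 \<le> p" and q: "0 \<le> q"
  shows "nonneg_FT (\<lambda>\<xi>. exp (of_real p * gl_symbol a h \<xi> + of_real q * gl_symbol a h (- \<xi>)))"
proof -
  let ?e = "\<lambda>n \<xi>. of_real p * gl_partial a h n \<xi> + of_real q * gl_partial a h n (- \<xi>)"
  let ?f = "\<lambda>\<xi>. of_real p * (gl_symbol a h \<xi> + of_real a) + of_real q * (gl_symbol a h (- \<xi>) + of_real a)"
  have e: "pos_trig (?e n)" for n
    by (intro pos_trig_add pos_trig_mult[OF pos_trig_const[OF p]] pos_trig_mult[OF pos_trig_const[OF q]]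
          pos_trig_reflect[of "gl_partial a h n"] pos_trig_gl_partial a)
  have lim: "(\<lambda>n. ?e n \<xi>) \<longlonglongrightarrow> ?f \<xi>" for \<xi>
    by (intro tendsto_intros gl_partial_limit a)
  have "Bseq (\<lambda>n. ?e n 0)" using lim[of 0] by (intro convergent_imp_Bseq) (rule convergentI)
  then obtain B where B: "\<forall>n. cmod (?e n 0) \<le> B" by (elim BseqE)
  have "nonneg_FT (\<lambda>\<xi>. exp (?f \<xi>))"
  proof (rule nonneg_FT_limit[where g="\<lambda>n \<xi>. exp (?e n \<xi>)" and B="exp B"])
    show "nonneg_FT (\<lambda>\<xi>. exp (?e n \<xi>))" for n by (rule nonneg_FT_exp_pos_trig[OF e])
    show "cmod (exp (?e n \<xi>)) \<le> exp B" for n \<xi>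
      unfolding norm_exp_eq_Re exp_le_cancel_iff
      using pos_trig_bound[OF e[of n], of \<xi>] B[rule_format, of n] complex_Re_le_cmod[of "?e n 0"]
        complex_Re_le_cmod[of "?e n \<xi>"] by linarith
    show "(\<lambda>n. exp (?e n \<xi>)) \<longlonglongrightarrow> exp (?f \<xi>)" for \<xi> by (intro tendsto_exp lim)
  qed
  \<comment> \<open>The exponent so far contains the constant \<open>(p + q) * a\<close>, added to
    make all weights nonnegative; the positive factor \<open>exp (- (p + q) * a)\<close> takes it
    out again.\<close>
  from nonneg_FT_scale[OF this, of "exp (- (p + q) * a)"]
  show ?thesis by (simp add: exp_of_real[symmetric] exp_add[symmetric] algebra_simps)
qed

text \<open>At frequency 0 only the damping is left: \<open>1 - exp (- h^2) <= h^2\<close> gives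
  \<open>h^(- a) * h^(2 * a) = h^a\<close>, and \<open>1 / z = exp (h^2) <= exp 1\<close>.\<close>

lemma gl_symbol_0_bound:
  assumes "0 \<le> a" "0 < h" "h \<le> 1"
  shows "cmod (of_real (h powr (- a)) * gl_symbol a h 0) \<le> h powr a * exp 1"
proof -
  have 1: "1 - exp (- h\<^sup>2) \<le> h\<^sup>2" using exp_ge_add_one_self[of "- h\<^sup>2"] by simp
  have 0: "0 \<le> 1 - exp (- h\<^sup>2)" by simp
  have "gl_symbol a h 0 = of_real ((1 - exp (- h\<^sup>2)) powr a * exp (h\<^sup>2))"
    using powr_of_real[OF 0, of a] by (simp add: gl_symbol_def gl_arg_def exp_minus field_simps)
  moreover have "(1 - exp (- h\<^sup>2)) powr a * exp (h\<^sup>2) \<le> h\<^sup>2 powr a * exp 1"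
    using assms 0 1 by (intro mult_mono powr_mono2) (auto simp: power_le_one)
  ultimately have "cmod (of_real (h powr (- a)) * gl_symbol a h 0) \<le> h powr (- a) * (h\<^sup>2 powr a * exp 1)"
    by (simp add: norm_mult mult_left_mono)
  also have "\<dots> = h powr a * exp 1"
    using assms by (simp add: power2_eq_square powr_mult powr_minus)
  finally show ?thesis .
qed

text \<open>To first order in \<open>h\<close>, \<open>1 - z\<close> is
  \<open>- \<i> * \<xi> * h\<close>, so the quotient tends to the principal power
  \<open>(- \<i> * \<xi>)^a\<close>. Frequency 0 is treated apart, because continuity of the power
  is used off the nonpositive real axis.\<close>

lemma gl_symbol_limit:
  assumes a: "1 < a" and h: "\<And>n. 0 < h n" "\<And>n. h n \<le> 1" "h \<longlonglongrightarrow> 0"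
  shows "(\<lambda>n. of_real (h n powr (- a)) * gl_symbol a (h n) \<xi>)
    \<longlonglongrightarrow> of_real (\<bar>\<xi>\<bar> powr a) * iexp (- (a * pi * sgn \<xi> / 2))"
proof (cases "\<xi> = 0")
  case True
  have "(\<lambda>n. of_real (h n powr (- a)) * gl_symbol a (h n) 0) \<longlonglongrightarrow> 0"
  proof (rule Lim_null_comparison)
    show "\<forall>\<^sub>F n in sequentially. cmod (of_real (h n powr (- a)) * gl_symbol a (h n) 0) \<le> h n powr a * exp 1"
      using a h by (intro always_eventually allI gl_symbol_0_bound) auto
    have "(\<lambda>n. h n powr a) \<longlonglongrightarrow> 0 powr a"
      by (rule tendsto_powr'[OF h(3) tendsto_const]) (use a h(1) in \<open>auto intro: always_eventually less_imp_le\<close>)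
    then show "(\<lambda>n. h n powr a * exp 1) \<longlonglongrightarrow> 0" by (intro tendsto_mult_left_zero) simp
  qed
  then show ?thesis using True a by simp
next
  case False
  have z: "gl_arg (h n) \<xi> = exp (of_real (- (h n)\<^sup>2) + \<i> * of_real (\<xi> * h n))" for n
    by (simp only: gl_arg_def exp_add exp_of_real)
  \<comment> \<open>The damping \<open>- w^2\<close> has derivative 0 at the origin and leaves no
    trace in the limit; this is why it is quadratic in \<open>h\<close>.\<close>
  have "((\<lambda>w. exp (- w\<^sup>2 + \<i> * \<xi> * w)) has_field_derivative (\<i> * \<xi>)) (at 0)"
    by (auto intro!: derivative_eq_intros)
  then have "((\<lambda>w. (exp (- w\<^sup>2 + \<i> * \<xi> * w) - 1) / w) \<longlongrightarrow> \<i> * \<xi>) (at 0)"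
    by (simp add: has_field_derivative_iff)
  moreover have "filterlim (\<lambda>n. complex_of_real (h n)) (at 0) sequentially"
    using h tendsto_of_real[OF h(3), where 'a=complex]
    by (auto simp: filterlim_at less_imp_neq[THEN not_sym])
  ultimately have "(\<lambda>n. (exp (- (complex_of_real (h n))\<^sup>2 + \<i> * \<xi> * complex_of_real (h n)) - 1) / h n) \<longlonglongrightarrow> \<i> * \<xi>"
    by (rule filterlim_compose)
  from tendsto_minus[OF this]
  have "(\<lambda>n. (1 - gl_arg (h n) \<xi>) / of_real (h n)) \<longlonglongrightarrow> - (\<i> * \<xi>)"
    by (simp add: z field_simps diff_divide_distrib)
  then have "(\<lambda>n. ((1 - gl_arg (h n) \<xi>) / of_real (h n)) powr (of_real a)) \<longlonglongrightarrow> (- (\<i> * \<xi>)) powr (of_real a)"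
    by (intro tendsto_powr_complex tendsto_const) (use False in \<open>auto simp: complex_nonpos_Reals_iff\<close>)
  moreover have "(\<lambda>n. gl_arg (h n) \<xi>) \<longlonglongrightarrow> 1"
    unfolding z by (rule tendsto_eq_intros h | simp)+
  ultimately have "(\<lambda>n. ((1 - gl_arg (h n) \<xi>) / of_real (h n)) powr (of_real a) / gl_arg (h n) \<xi>) \<longlonglongrightarrow> (- (\<i> * \<xi>)) powr (of_real a) / 1"
    by (intro tendsto_divide) auto
  moreover have "((1 - gl_arg (h n) \<xi>) / of_real (h n)) powr (of_real a) / gl_arg (h n) \<xi>
      = of_real (h n powr (- a)) * gl_symbol a (h n) \<xi>" for n
  proof -
    have "((1 - gl_arg (h n) \<xi>) / of_real (h n)) powr (of_real a)
        = (of_real (1 / h n) * (1 - gl_arg (h n) \<xi>)) powr (of_real a)" by (simp add: divide_inverse mult.commute)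
    \<comment> \<open>A positive real factor may be pulled out of a principal power, whereas a
      general complex factor could change the branch.\<close>
    also have "\<dots> = of_real (1 / h n) powr of_real a * (1 - gl_arg (h n) \<xi>) powr (of_real a)"
      using h(1)[of n] by (intro powr_times_real_left) auto
    also have "complex_of_real (1 / h n) powr of_real a = of_real ((1 / h n) powr a)"
      using h(1)[of n] by (intro powr_of_real) auto
    also have "(1 / h n) powr a = h n powr (- a)"
      using h(1)[of n] by (simp add: powr_minus inverse_powr divide_inverse)
    finally show ?thesis by (simp add: gl_symbol_def)
  qed
  moreover have "(- (\<i> * \<xi>)) powr (of_real a) = of_real (\<bar>\<xi>\<bar> powr a) * iexp (- (a * pi * sgn \<xi> / 2))"
  proof -
    \<comment> \<open>The argument of \<open>- \<i> * \<xi>\<close> is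
      \<open>- pi * sgn \<xi> / 2\<close>, inside the principal range, so taking the power
      multiplies it by \<open>a\<close>.\<close>
    have s: "- pi < - pi * sgn \<xi> / 2" "- pi * sgn \<xi> / 2 \<le> pi" using False pi_gt_zero by (auto simp: sgn_if intro: order_trans[of _ 0])
    have "- (\<i> * \<xi>) = of_real \<bar>\<xi>\<bar> * iexp (- pi * sgn \<xi> / 2)"
      using False by (auto simp: sgn_if abs_if complex_eq_iff Re_exp Im_exp)
    also have "\<dots> powr (of_real a) = of_real \<bar>\<xi>\<bar> powr (of_real a) * iexp (- pi * sgn \<xi> / 2) powr (of_real a)"
      by (intro powr_times_real_left) auto
    also have "iexp (- pi * sgn \<xi> / 2) powr (of_real a) = exp (\<i> * of_real (- pi * sgn \<xi> / 2) * of_real a)"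
      using s by (intro exp_powr_complex) auto
    also have "complex_of_real \<bar>\<xi>\<bar> powr (of_real a) = of_real (\<bar>\<xi>\<bar> powr a)"
      by (intro powr_of_real) auto
    finally show ?thesis by (simp add: mult_ac)
  qed
  ultimately show ?thesis by simp
qed

section \<open>The stable kernel\<close>

locale stable_params =
  fixes a \<delta> :: real
  assumes a: "1 < a" "a \<le> 2" and \<delta>: "\<bar>\<delta>\<bar> \<le> 2 - a"
begin

text \<open>By \<open>fourier_G\<close> below, this is the transform of \<open>G t\<close> in the
  convention with \<open>iexp (x * - \<eta>)\<close>.\<close>

definition psi :: "real \<Rightarrow> real \<Rightarrow> complex" where
  "psi t \<xi> = exp (- complex_of_real (t * \<bar>\<xi>\<bar> powr a) * exp (- \<i> * complex_of_real (\<delta> * pi * sgn \<xi> / 2)))"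

abbreviation G :: "real \<Rightarrow> real \<Rightarrow> real" where
  "G \<equiv> stableG a \<delta>"

text \<open>The rate in \<open>cmod (psi t \<xi>)\<close>: for either sign of \<open>\<xi>\<close>
  the cosine is the real part of the phase factor. It is positive since
  \<open>|\<delta>| <= 2 - a < 1\<close>.\<close>

definition decay :: real where "decay = cos (\<delta> * pi / 2)"

lemma G_eq_Re: "G t x = Re (\<integral>\<xi>. psi t \<xi> * iexp (\<xi> * x) \<partial>lborel) / (2 * pi)"
  by (simp add: stableG_def psi_def exp_add[symmetric])

lemma decay_pos: "0 < decay"
proof -
  have "\<bar>\<delta>\<bar> * pi < 1 * pi" using a \<delta> by (intro mult_strict_right_mono) auto
  then have "\<bar>\<delta> * pi\<bar> < pi" by (simp only: abs_mult abs_of_pos[OF pi_gt_zero] mult_1)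
  then have "- (pi / 2) < \<delta> * pi / 2" "\<delta> * pi / 2 < pi / 2" by linarith+
  then show ?thesis unfolding decay_def by (rule cos_gt_zero_pi)
qed

text \<open>The factor \<open>sgn \<xi>\<close>, discontinuous at 0, is absorbed into
  \<open>\<xi> * |\<xi>|^(a - 1)\<close>, which is continuous as \<open>a > 1\<close>. Continuity,
  modulus, additivity in \<open>t\<close> and conjugation symmetry are read off from this
  form.\<close>

lemma psi_alt: "psi t \<xi> = exp (of_real (- t) * (of_real (\<bar>\<xi>\<bar> powr a * decay) - \<i> * of_real (\<xi> * \<bar>\<xi>\<bar> powr (a - 1) * sin (\<delta> * pi / 2))))"
proof (cases "\<xi> = 0")
  case False
  then have "\<xi> * \<bar>\<xi>\<bar> powr (a - 1) = sgn \<xi> * (\<bar>\<xi>\<bar> * \<bar>\<xi>\<bar> powr (a - 1))"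
    by (simp only: mult.assoc[symmetric] sgn_mult_abs)
  also have "\<bar>\<xi>\<bar> * \<bar>\<xi>\<bar> powr (a - 1) = \<bar>\<xi>\<bar> powr a"
    using powr_mult_base[of "\<bar>\<xi>\<bar>" "a - 1"] by simp
  finally have m: "\<xi> * \<bar>\<xi>\<bar> powr (a - 1) = sgn \<xi> * \<bar>\<xi>\<bar> powr a" .
  have "exp (- \<i> * complex_of_real x) = of_real (cos x) - \<i> * of_real (sin x)" for x
    by (simp add: complex_eq_iff Re_exp Im_exp)
  moreover have "cos (\<delta> * pi * sgn \<xi> / 2) = decay" "sin (\<delta> * pi * sgn \<xi> / 2) = sgn \<xi> * sin (\<delta> * pi / 2)"
    using False by (cases "\<xi> > 0"; simp add: decay_def)+
  ultimately have e: "exp (- \<i> * complex_of_real (\<delta> * pi * sgn \<xi> / 2))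
      = of_real decay - \<i> * of_real (sgn \<xi> * sin (\<delta> * pi / 2))"
    by (simp only:)
  show ?thesis
    unfolding psi_def e m by (simp add: algebra_simps)
qed (simp add: psi_def)

lemma norm_psi: "cmod (psi t \<xi>) = exp (- (t * decay) * \<bar>\<xi>\<bar> powr a)"
  by (simp add: psi_alt norm_exp_eq_Re)

lemma norm_psi_le_1: "0 \<le> t \<Longrightarrow> cmod (psi t \<xi>) \<le> 1"
  using decay_pos by (simp add: norm_psi)

lemma psi_0 [simp]: "psi t 0 = 1"
  by (simp add: psi_def)

lemma psi_add: "psi (s + t) \<xi> = psi s \<xi> * psi t \<xi>"
  by (simp add: psi_alt exp_add[symmetric] algebra_simps)

lemma psi_minus: "psi t (- \<xi>) = cnj (psi t \<xi>)"
  by (simp add: psi_alt exp_cnj)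

lemma psi_scale:
  assumes "0 < t"
  shows "psi t \<xi> = psi 1 (t powr (1 / a) * \<xi>)"
proof -
  have "(t powr (1 / a) * \<bar>\<xi>\<bar>) powr a = t * \<bar>\<xi>\<bar> powr a"
    using assms a by (simp add: powr_mult powr_powr)
  then show ?thesis using assms by (simp add: psi_def abs_mult sgn_mult)
qed

lemma continuous_on_psi: "continuous_on UNIV (psi t)"
proof -
  have c: "continuous_on UNIV (\<lambda>\<xi>::real. \<bar>\<xi>\<bar> powr b)" if "0 < b" for b :: real
    using that by (intro continuous_on_powr') (auto intro!: continuous_intros)
  have "0 < a" "0 < a - 1" using a by auto
  then show ?thesis
    unfolding psi_alt[abs_def]
    by (intro continuous_on_exp continuous_on_mult continuous_on_diff continuous_on_of_real
          continuous_on_const continuous_on_id c) auto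
qed

lemma psi_measurable [measurable]: "psi t \<in> borel_measurable borel"
  by (rule borel_measurable_continuous_onI[OF continuous_on_psi])

lemma integrable_psi:
  assumes "0 < t"
  shows "integrable lborel (psi t)"
proof (rule Bochner_Integration.integrable_bound)
  show "integrable lborel (\<lambda>\<xi>. exp (- (t * decay) * \<bar>\<xi>\<bar> powr a))"
    using assms a decay_pos by (intro integrable_exp_neg_powr) auto
qed (auto simp: norm_psi)

text \<open>Here the restriction on \<open>\<delta>\<close> enters. Comparing real and imaginary
  parts leaves two linear equations, one for \<open>p + q\<close> and one for
  \<open>q - p\<close>.\<close>

lemma symbol_combination:
  obtains p q where "0 \<le> p" "0 \<le> q"
    "\<And>\<xi>. of_real p * (of_real (\<bar>\<xi>\<bar> powr a) * iexp (- (a * pi * sgn \<xi> / 2)))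
        + of_real q * (of_real (\<bar>\<xi>\<bar> powr a) * iexp (- (a * pi * sgn (- \<xi>) / 2)))
      = - of_real (\<bar>\<xi>\<bar> powr a) * exp (- \<i> * complex_of_real (\<delta> * pi * sgn \<xi> / 2))"
proof -
  have "\<exists>p q. 0 \<le> p \<and> 0 \<le> q \<and> (p + q) * cos (a * pi / 2) = - cos (\<delta> * pi / 2)
      \<and> (q - p) * sin (a * pi / 2) = sin (\<delta> * pi / 2)"
  proof (cases "a = 2")
    case True
    \<comment> \<open>For \<open>a = 2\<close> both sides of the sine equation vanish, as
      \<open>\<delta> = 0\<close>; \<open>p = q = 1/2\<close> solves the cosine equation.\<close>
    then show ?thesis using \<delta> by (intro exI[of _ "1/2"]) auto
  next
    case False
    define b where "b = (2 - a) * pi / 2"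
    have b: "0 < b" "b < pi / 2" using a False by (auto simp: b_def field_simps)
    define d where "d = \<delta> * pi / 2"
    \<comment> \<open>This is \<open>|\<delta>| <= 2 - a\<close>. It puts \<open>b + d\<close> and
      \<open>b - d\<close> into \<open>[0, pi]\<close>, where the sine is nonnegative; the solution
      has \<open>p\<close> proportional to \<open>sin (b - d)\<close> and \<open>q\<close> to
      \<open>sin (b + d)\<close>.\<close>
    have d: "\<bar>d\<bar> \<le> b" using \<delta> by (simp add: d_def b_def abs_mult)
    have ab: "a * pi / 2 = pi - b" by (simp add: b_def field_simps)
    have s: "0 < sin b" "0 < cos b"
      using b by (auto intro!: sin_gt_zero cos_gt_zero)
    have "0 \<le> sin (b + d)" "0 \<le> sin (b - d)" using b d by (auto intro!: sin_ge_zero)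
    moreover have "sin (b - d) / (2 * sin b * cos b) + sin (b + d) / (2 * sin b * cos b) = cos d / cos b"
      using s by (simp add: sin_diff sin_add field_simps)
    moreover have "sin (b + d) / (2 * sin b * cos b) - sin (b - d) / (2 * sin b * cos b) = sin d / sin b"
      using s by (simp add: sin_diff sin_add field_simps)
    ultimately show ?thesis
      using s by (intro exI[of _ "sin (b - d) / (2 * sin b * cos b)"] exI[of _ "sin (b + d) / (2 * sin b * cos b)"])
        (auto simp: ab d_def[symmetric])
  qed
  then obtain p q where pq: "0 \<le> p" "0 \<le> q" and C: "(p + q) * cos (a * pi / 2) = - cos (\<delta> * pi / 2)"
    and S: "(q - p) * sin (a * pi / 2) = sin (\<delta> * pi / 2)" by blast
  have "of_real p * (of_real r * iexp (- (a * pi * sgn \<xi> / 2)))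
        + of_real q * (of_real r * iexp (- (a * pi * sgn (- \<xi>) / 2)))
      = - of_real r * exp (- \<i> * complex_of_real (\<delta> * pi * sgn \<xi> / 2))" if "\<xi> \<noteq> 0" for \<xi> r
  proof -
    have C': "p * cos (a * pi / 2) + q * cos (a * pi / 2) = - cos (\<delta> * pi / 2)" 
      and S': "q * sin (a * pi / 2) - p * sin (a * pi / 2) = sin (\<delta> * pi / 2)" 
      using C S by (simp_all add: algebra_simps)
    have "p * (r * cos (a * pi / 2)) + q * (r * cos (a * pi / 2)) = - (r * cos (\<delta> * pi / 2))"
      using arg_cong[OF C', of "\<lambda>x. r * x"] by (simp add: algebra_simps)
    moreover have "q * (r * sin (a * pi / 2)) - p * (r * sin (a * pi / 2)) = r * sin (\<delta> * pi / 2)"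
      using arg_cong[OF S', of "\<lambda>x. r * x"] by (simp add: algebra_simps)
    ultimately show ?thesis
      using that by (auto simp: complex_eq_iff Re_exp Im_exp sgn_if)
  qed
  from this[where r="\<bar>\<xi>\<bar> powr a" and \<xi>=\<xi> for \<xi>]
  have "of_real p * (of_real (\<bar>\<xi>\<bar> powr a) * iexp (- (a * pi * sgn \<xi> / 2)))
        + of_real q * (of_real (\<bar>\<xi>\<bar> powr a) * iexp (- (a * pi * sgn (- \<xi>) / 2)))
      = - of_real (\<bar>\<xi>\<bar> powr a) * exp (- \<i> * complex_of_real (\<delta> * pi * sgn \<xi> / 2))" for \<xi>
    by (cases "\<xi> = 0") (simp, blast)
  then show thesis by (rule that[OF pq])
qed

lemma nonneg_FT_psi:
  assumes "0 < t"
  shows "nonneg_FT (psi t)"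
proof -
  obtain p q where pq: "0 \<le> p" "0 \<le> q" and
    eq: "\<And>\<xi>. of_real p * (of_real (\<bar>\<xi>\<bar> powr a) * iexp (- (a * pi * sgn \<xi> / 2)))
        + of_real q * (of_real (\<bar>\<xi>\<bar> powr a) * iexp (- (a * pi * sgn (- \<xi>) / 2)))
      = - of_real (\<bar>\<xi>\<bar> powr a) * exp (- \<i> * complex_of_real (\<delta> * pi * sgn \<xi> / 2))"
    by (rule symbol_combination, rule that)
  define h where "h n = 1 / real (Suc n)" for n
  have h: "0 < h n" "h n \<le> 1" for n by (auto simp: h_def)
  have h0: "h \<longlonglongrightarrow> 0" unfolding h_def using LIMSEQ_inverse_real_of_nat by (simp add: divide_inverse)
  let ?r = "\<lambda>n \<xi>. of_real (h n powr (- a)) * gl_symbol a (h n) \<xi>"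
  let ?e = "\<lambda>n \<xi>. of_real (t * p) * ?r n \<xi> + of_real (t * q) * ?r n (- \<xi>)"
  show ?thesis
  proof (rule nonneg_FT_limit[where g="\<lambda>n \<xi>. exp (?e n \<xi>)" and B="exp (t * p * exp 1 + t * q * exp 1)"])
    show "nonneg_FT (\<lambda>\<xi>. exp (?e n \<xi>))" for n
      using nonneg_FT_gl_symbol[of a "h n" "t * p * h n powr (- a)" "t * q * h n powr (- a)"] a h[of n] pq assms
      by (simp add: mult.assoc)
    \<comment> \<open>The real part is largest at frequency 0, where it is at most
      \<open>h^a * exp 1\<close>; this bounds the exponentials uniformly in \<open>n\<close> and
      \<open>\<xi>\<close>.\<close>
    have r: "Re (?r n \<xi>) \<le> exp 1" for n \<xi>
    proof -
      have "Re (?r n \<xi>) \<le> Re (?r n 0)"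
        using gl_symbol_bound[of a "h n" \<xi>] a h[of n] by (simp add: mult_left_mono)
      also have "\<dots> \<le> h n powr a * exp 1"
        using gl_symbol_0_bound[of a "h n"] complex_Re_le_cmod[of "?r n 0"] a h[of n] by linarith
      also have "\<dots> \<le> 1 * exp 1" using a h[of n] by (intro mult_right_mono) (auto simp: powr_le1)
      finally show ?thesis by simp
    qed
    show "cmod (exp (?e n \<xi>)) \<le> exp (t * p * exp 1 + t * q * exp 1)" for n \<xi>
    proof -
      have "Re (?e n \<xi>) = t * p * Re (?r n \<xi>) + t * q * Re (?r n (- \<xi>))" by simp
      also have "\<dots> \<le> t * p * exp 1 + t * q * exp 1"
        using r pq assms by (intro add_mono mult_left_mono) auto
      finally show ?thesis by (simp only: norm_exp_eq_Re exp_le_cancel_iff)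
    qed
    show "(\<lambda>n. exp (?e n \<xi>)) \<longlonglongrightarrow> psi t \<xi>" for \<xi>
    proof -
      let ?l = "\<lambda>\<xi>. of_real (\<bar>\<xi>\<bar> powr a) * iexp (- (a * pi * sgn \<xi> / 2))"
      have lim: "(\<lambda>n. ?r n \<xi>) \<longlonglongrightarrow> ?l \<xi>" for \<xi>
        using a h h0 by (intro gl_symbol_limit) auto
      have "(\<lambda>n. ?e n \<xi>) \<longlonglongrightarrow> of_real (t * p) * ?l \<xi> + of_real (t * q) * ?l (- \<xi>)"
        by (rule tendsto_add[OF tendsto_mult_left[OF lim] tendsto_mult_left[OF lim]])
      also have "of_real (t * p) * ?l \<xi> + of_real (t * q) * ?l (- \<xi>) = of_real t * (of_real p * ?l \<xi> + of_real q * ?l (- \<xi>))"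
        by (simp only: of_real_mult distrib_left mult.assoc abs_minus_cancel)
      also have "of_real p * ?l \<xi> + of_real q * ?l (- \<xi>) = - of_real (\<bar>\<xi>\<bar> powr a) * exp (- \<i> * complex_of_real (\<delta> * pi * sgn \<xi> / 2))"
        using eq[of \<xi>] by simp
      finally have "(\<lambda>n. exp (?e n \<xi>)) \<longlonglongrightarrow> exp (of_real t * (- of_real (\<bar>\<xi>\<bar> powr a) * exp (- \<i> * complex_of_real (\<delta> * pi * sgn \<xi> / 2))))"
        by (rule tendsto_exp)
      then show ?thesis by (simp add: psi_def mult.assoc)
    qed
  qed
qed

text \<open>Since \<open>psi t\<close> is integrable for \<open>t > 0\<close>, dominated convergence
  removes the Gaussian factor of \<open>nonneg_FT\<close> along
  \<open>\<epsilon> = 1 / (n + 1)\<close>.\<close>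

lemma G_nonneg:
  assumes "0 < t"
  shows "0 \<le> G t x"
proof -
  let ?h = "\<lambda>n \<xi>. exp (- (1 / real (Suc n)) * \<xi>\<^sup>2 / 2)"
  have "(\<lambda>n. \<integral>\<xi>. psi t \<xi> * (iexp (\<xi> * x) * ?h n \<xi>) \<partial>lborel) \<longlonglongrightarrow> (\<integral>\<xi>. psi t \<xi> * iexp (\<xi> * x) \<partial>lborel)"
  proof (rule integral_dominated_convergence)
    show "integrable lborel (\<lambda>\<xi>. cmod (psi t \<xi>))" using integrable_psi[OF assms] by simp
    have "(\<lambda>n. ?h n \<xi>) \<longlonglongrightarrow> exp (- 0 * \<xi>\<^sup>2 / 2)" for \<xi>
      using LIMSEQ_inverse_real_of_nat unfolding inverse_eq_divide by (intro tendsto_intros) auto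
    then have "(\<lambda>n. complex_of_real (?h n \<xi>)) \<longlonglongrightarrow> 1" for \<xi>
      using tendsto_of_real[where 'a=complex] by fastforce
    then have "(\<lambda>n. psi t \<xi> * (iexp (\<xi> * x) * ?h n \<xi>)) \<longlonglongrightarrow> psi t \<xi> * (iexp (\<xi> * x) * 1)" for \<xi>
      by (intro tendsto_mult tendsto_const)
    then show "AE \<xi> in lborel. (\<lambda>n. psi t \<xi> * (iexp (\<xi> * x) * ?h n \<xi>)) \<longlonglongrightarrow> psi t \<xi> * iexp (\<xi> * x)"
      by (simp only: mult_1_right AE_I2)
    have "cmod (iexp (\<xi> * x) * ?h n \<xi>) \<le> 1" for n \<xi>
      unfolding norm_mult by (simp only: norm_exp_i_times norm_of_real) simp
    then show "AE \<xi> in lborel. cmod (psi t \<xi> * (iexp (\<xi> * x) * ?h n \<xi>)) \<le> cmod (psi t \<xi>)" for n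
      unfolding norm_mult[of "psi t _"] by (intro AE_I2 mult_left_le) auto
  qed auto
  then have "(\<lambda>n. Re (\<integral>\<xi>. psi t \<xi> * (iexp (\<xi> * x) * ?h n \<xi>) \<partial>lborel)) \<longlonglongrightarrow> Re (\<integral>\<xi>. psi t \<xi> * iexp (\<xi> * x) \<partial>lborel)"
    by (rule tendsto_Re)
  then have "0 \<le> Re (\<integral>\<xi>. psi t \<xi> * iexp (\<xi> * x) \<partial>lborel)"
  proof (rule LIMSEQ_le_const, intro exI allI impI)
    show "0 \<le> Re (\<integral>\<xi>. psi t \<xi> * (iexp (\<xi> * x) * ?h n \<xi>) \<partial>lborel)" for n
      using nonneg_FT_psi[OF assms, unfolded nonneg_FT_def, THEN conjunct2, rule_format, of "1 / real (Suc n)" x]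
      by simp
  qed
  then show ?thesis by (simp add: G_eq_Re)
qed

end

lemma (in pair_sigma_finite) integrable_prod_mult:
  fixes f :: "'a \<Rightarrow> real" and g :: "'b \<Rightarrow> real"
  assumes f: "integrable M1 f" and g: "integrable M2 g"
  shows "integrable (M1 \<Otimes>\<^sub>M M2) (\<lambda>(x, y). f x * g y)"
proof (rule Fubini_integrable)
  have [measurable]: "f \<in> borel_measurable M1" "g \<in> borel_measurable M2" using f g by auto
  show "(\<lambda>(x, y). f x * g y) \<in> borel_measurable (M1 \<Otimes>\<^sub>M M2)" by measurable
  show "integrable M1 (\<lambda>x. \<integral>y. norm (case (x, y) of (x, y) \<Rightarrow> f x * g y) \<partial>M2)"
    using f by (simp add: abs_mult)
  show "AE x in M1. integrable M2 (\<lambda>y. case (x, y) of (x, y) \<Rightarrow> f x * g y)"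
    using g by simp
qed

lemma tendsto_1_over_Suc: "(\<lambda>n. 1 / real (Suc n)) \<longlonglongrightarrow> 0"
  using LIMSEQ_inverse_real_of_nat by (simp add: divide_inverse)

section \<open>Fourier inversion, total mass and semigroup property of the kernel\<close>

context stable_params
begin

text \<open>The symmetry \<open>psi t (- \<xi>) = cnj (psi t \<xi>)\<close> makes the Fourier
  integral real, so the real part taken in \<open>stableG\<close> discards nothing.\<close>

lemma of_real_G:
  assumes "0 < t"
  shows "complex_of_real (G t x) = (\<integral>\<xi>. psi t \<xi> * iexp (\<xi> * x) \<partial>lborel) / (2 * pi)"
proof -
  let ?F = "\<integral>\<xi>. psi t \<xi> * iexp (\<xi> * x) \<partial>lborel"
  have "cnj ?F = (\<integral>\<xi>. cnj (psi t \<xi> * iexp (\<xi> * x)) \<partial>lborel)"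
    by (simp only: Bochner_Integration.integral_cnj)
  also have "\<dots> = (\<integral>\<xi>. psi t (0 + (-1) * \<xi>) * iexp ((0 + (-1) * \<xi>) * x) \<partial>lborel)"
    by (intro Bochner_Integration.integral_cong) (auto simp: psi_minus exp_cnj)
  also have "\<dots> = ?F"
    using lborel_integral_real_affine[where c="-1" and t=0 and f="\<lambda>\<xi>. psi t \<xi> * iexp (\<xi> * x)"] by simp
  finally have "Im ?F = 0" by (simp add: complex_eq_iff)
  then have "?F = of_real (Re ?F)" by (simp add: complex_eq_iff)
  then show ?thesis by (simp only: G_eq_Re of_real_divide of_real_mult of_real_numeral)
qed

lemma G_bound: "0 < t \<Longrightarrow> \<bar>G t x\<bar> \<le> (\<integral>\<xi>. cmod (psi t \<xi>) \<partial>lborel) / (2 * pi)"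
proof -
  assume t: "0 < t"
  have "\<bar>G t x\<bar> = cmod (complex_of_real (G t x))" by simp
  also have "\<dots> = cmod (\<integral>\<xi>. psi t \<xi> * iexp (\<xi> * x) \<partial>lborel) / (2 * pi)"
    unfolding of_real_G[OF t] by (simp add: norm_divide)
  also have "cmod (\<integral>\<xi>. psi t \<xi> * iexp (\<xi> * x) \<partial>lborel) \<le> (\<integral>\<xi>. cmod (psi t \<xi> * iexp (\<xi> * x)) \<partial>lborel)"
    by (rule integral_norm_bound)
  finally show ?thesis by (simp add: norm_mult divide_right_mono)
qed

lemma G_scale:
  assumes t: "0 < t"
  shows "G t x = t powr (- 1 / a) * G 1 (t powr (- 1 / a) * x)"
proof -
  let ?c = "t powr (- 1 / a)"
  have c: "?c \<noteq> 0" using t by simp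
  have "t powr (1 / a) * ?c = t powr (1 / a + - 1 / a)" by (rule powr_add[symmetric])
  then have c1: "t powr (1 / a) * ?c = 1" using t by simp
  have psi: "psi t (?c * v) = psi 1 v" for v
    unfolding psi_scale[OF t, of "?c * v"] mult.assoc[symmetric] c1 by simp
  have "(\<integral>\<xi>. psi t \<xi> * iexp (\<xi> * x) \<partial>lborel)
      = \<bar>?c\<bar> *\<^sub>R (\<integral>v. psi t (0 + ?c * v) * iexp ((0 + ?c * v) * x) \<partial>lborel)"
    by (rule lborel_integral_real_affine[OF c])
  also have "(\<lambda>v. psi t (0 + ?c * v) * iexp ((0 + ?c * v) * x)) = (\<lambda>v. psi 1 v * iexp (v * (?c * x)))"
    by (simp only: add_0 psi mult.assoc mult.left_commute[of "t powr (- 1 / a)"])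
  finally show ?thesis by (simp add: G_eq_Re)
qed

lemma continuous_on_G:
  assumes "0 < t"
  shows "continuous_on UNIV (G t)"
  unfolding continuous_on_sequentially
proof (intro allI ballI impI, elim conjE)
  fix X :: "nat \<Rightarrow> real" and x assume X: "X \<longlonglongrightarrow> x"
  have "(\<lambda>n. \<integral>\<xi>. psi t \<xi> * iexp (\<xi> * X n) \<partial>lborel) \<longlonglongrightarrow> (\<integral>\<xi>. psi t \<xi> * iexp (\<xi> * x) \<partial>lborel)"
  proof (rule integral_dominated_convergence)
    show "integrable lborel (\<lambda>\<xi>. cmod (psi t \<xi>))" using integrable_psi[OF assms] by simp
    show "AE \<xi> in lborel. (\<lambda>n. psi t \<xi> * iexp (\<xi> * X n)) \<longlonglongrightarrow> psi t \<xi> * iexp (\<xi> * x)"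
      by (intro AE_I2 tendsto_intros X)
  qed (auto simp: norm_mult)
  then have "(\<lambda>n. Re (\<integral>\<xi>. psi t \<xi> * iexp (\<xi> * X n) \<partial>lborel) / (2 * pi)) \<longlonglongrightarrow> Re (\<integral>\<xi>. psi t \<xi> * iexp (\<xi> * x) \<partial>lborel) / (2 * pi)"
    by (intro tendsto_intros) auto
  then show "(G t \<circ> X) \<longlonglongrightarrow> G t x" by (simp add: o_def G_eq_Re)
qed

lemma G_measurable: "0 < t \<Longrightarrow> G t \<in> borel_measurable borel"
  by (rule borel_measurable_continuous_onI[OF continuous_on_G])

text \<open>Integrability of \<open>G t\<close> is still open at this point; the Gaussian weight
  makes Fubini applicable without it. After the exchange the weight acts as an approximate identity,
  averaging \<open>psi t\<close> under a normal law with mean \<open>\<eta>\<close> and variance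
  \<open>\<epsilon>\<close>.\<close>

lemma fourier_G_gauss:
  assumes t: "0 < t" and \<epsilon>: "0 < \<epsilon>"
  shows "(\<integral>x. of_real (G t x) * (iexp (x * - \<eta>) * exp (- \<epsilon> * x\<^sup>2 / 2)) \<partial>lborel)
       = (\<integral>v. std_normal_density v *\<^sub>R psi t (\<eta> + sqrt \<epsilon> * v) \<partial>lborel)"
proof -
  let ?f = "\<lambda>x \<xi>. psi t \<xi> * iexp (\<xi> * x) * (iexp (x * - \<eta>) * exp (- \<epsilon> * x\<^sup>2 / 2))"
  have i: "integrable (lborel \<Otimes>\<^sub>M lborel) (\<lambda>(x, \<xi>). ?f x \<xi>)"
  proof (rule Bochner_Integration.integrable_bound)
    show "integrable (lborel \<Otimes>\<^sub>M lborel) (\<lambda>(x::real, \<xi>). exp (- \<epsilon> * x\<^sup>2 / 2) * cmod (psi t \<xi>))"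
      using integrable_gauss[OF \<epsilon>] integrable_psi[OF t] by (intro lborel_pair.integrable_prod_mult) auto
    show "(\<lambda>(x, \<xi>). ?f x \<xi>) \<in> borel_measurable (lborel \<Otimes>\<^sub>M lborel)" by measurable
    have "cmod (?f x \<xi>) = exp (- \<epsilon> * x\<^sup>2 / 2) * cmod (psi t \<xi>)" for x \<xi>
      unfolding norm_mult norm_exp_i_times norm_of_real by simp
    then show "AE p in lborel \<Otimes>\<^sub>M lborel. cmod (case p of (x, \<xi>) \<Rightarrow> ?f x \<xi>)
        \<le> norm (case p of (x, \<xi>) \<Rightarrow> exp (- \<epsilon> * x\<^sup>2 / 2) * cmod (psi t \<xi>))"
      by (intro AE_I2) (auto simp only: split_beta real_norm_def abs_mult abs_exp_cancel abs_norm_cancel order_refl)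
  qed
  have "(\<integral>x. of_real (G t x) * (iexp (x * - \<eta>) * exp (- \<epsilon> * x\<^sup>2 / 2)) \<partial>lborel)
      = (\<integral>x. (\<integral>\<xi>. ?f x \<xi> \<partial>lborel) / (2 * pi) \<partial>lborel)"
    by (intro Bochner_Integration.integral_cong refl) (simp only: of_real_G[OF t] integral_mult_left_zero times_divide_eq_left)
  also have "\<dots> = (\<integral>x. \<integral>\<xi>. ?f x \<xi> \<partial>lborel \<partial>lborel) / (2 * pi)" by simp
  also have "(\<integral>x. \<integral>\<xi>. ?f x \<xi> \<partial>lborel \<partial>lborel) = (\<integral>\<xi>. \<integral>x. ?f x \<xi> \<partial>lborel \<partial>lborel)"
    by (rule lborel_pair.Fubini_integral[OF i, symmetric])
  also have "(\<lambda>\<xi>. \<integral>x. ?f x \<xi> \<partial>lborel) = (\<lambda>\<xi>. psi t \<xi> * of_real (sqrt (2 * pi / \<epsilon>) * exp (- (\<xi> - \<eta>)\<^sup>2 / (2 * \<epsilon>))))"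
  proof (rule ext)
    fix \<xi>
    have "?f x \<xi> = psi t \<xi> * (iexp (x * (\<xi> - \<eta>)) * exp (- \<epsilon> * x\<^sup>2 / 2))" for x
    proof -
      have "iexp (x * (\<xi> - \<eta>)) = iexp (\<xi> * x) * iexp (x * - \<eta>)"
        by (simp add: exp_add[symmetric] algebra_simps)
      then show ?thesis by (simp only: mult.assoc)
    qed
    then have "(\<integral>x. ?f x \<xi> \<partial>lborel) = (\<integral>x. psi t \<xi> * (iexp (x * (\<xi> - \<eta>)) * exp (- \<epsilon> * x\<^sup>2 / 2)) \<partial>lborel)"
      by (simp only:)
    then show "(\<integral>x. ?f x \<xi> \<partial>lborel) = psi t \<xi> * of_real (sqrt (2 * pi / \<epsilon>) * exp (- (\<xi> - \<eta>)\<^sup>2 / (2 * \<epsilon>)))"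
      by (simp only: integral_mult_right_zero fourier_gauss[OF \<epsilon>])
  qed
  also have "(\<integral>\<xi>. psi t \<xi> * of_real (sqrt (2 * pi / \<epsilon>) * exp (- (\<xi> - \<eta>)\<^sup>2 / (2 * \<epsilon>))) \<partial>lborel)
     = \<bar>sqrt \<epsilon>\<bar> *\<^sub>R (\<integral>v. psi t (\<eta> + sqrt \<epsilon> * v) * of_real (sqrt (2 * pi / \<epsilon>) * exp (- (\<eta> + sqrt \<epsilon> * v - \<eta>)\<^sup>2 / (2 * \<epsilon>))) \<partial>lborel)"
    by (rule lborel_integral_real_affine) (use \<epsilon> in auto)
  also have "(\<lambda>v. psi t (\<eta> + sqrt \<epsilon> * v) * of_real (sqrt (2 * pi / \<epsilon>) * exp (- (\<eta> + sqrt \<epsilon> * v - \<eta>)\<^sup>2 / (2 * \<epsilon>))))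
     = (\<lambda>v. of_real (2 * pi / sqrt \<epsilon>) * (std_normal_density v *\<^sub>R psi t (\<eta> + sqrt \<epsilon> * v)))"
  proof (rule ext)
    fix v
    have 1: "exp (- (\<eta> + sqrt \<epsilon> * v - \<eta>)\<^sup>2 / (2 * \<epsilon>)) = exp (- v\<^sup>2 / 2)"
      using \<epsilon> by (simp add: power_mult_distrib)
    have "sqrt (2 * pi) * sqrt (2 * pi) = 2 * pi" by simp
    then have "sqrt (2 * pi / \<epsilon>) = 2 * pi / sqrt \<epsilon> * (1 / sqrt (2 * pi))"
      using \<epsilon> by (simp add: real_sqrt_divide field_simps)
    then have "sqrt (2 * pi / \<epsilon>) * exp (- (\<eta> + sqrt \<epsilon> * v - \<eta>)\<^sup>2 / (2 * \<epsilon>)) = 2 * pi / sqrt \<epsilon> * std_normal_density v"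
      unfolding 1 std_normal_density_def by (simp only: mult.assoc)
    then show "psi t (\<eta> + sqrt \<epsilon> * v) * of_real (sqrt (2 * pi / \<epsilon>) * exp (- (\<eta> + sqrt \<epsilon> * v - \<eta>)\<^sup>2 / (2 * \<epsilon>)))
        = of_real (2 * pi / sqrt \<epsilon>) * (std_normal_density v *\<^sub>R psi t (\<eta> + sqrt \<epsilon> * v))"
      by (simp only: scaleR_conv_of_real of_real_mult mult.commute mult.left_commute)
  qed
  finally show ?thesis
    using \<epsilon> by (simp add: scaleR_conv_of_real)
qed

lemma fourier_G_gauss_limit:
  assumes t: "0 < t"
  shows "(\<lambda>n. \<integral>x. of_real (G t x) * (iexp (x * - \<eta>) * exp (- (1 / real (Suc n)) * x\<^sup>2 / 2)) \<partial>lborel) \<longlonglongrightarrow> psi t \<eta>"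
proof -
  let ?e = "\<lambda>n. 1 / real (Suc n)"
  have "(\<lambda>n. \<integral>v. std_normal_density v *\<^sub>R psi t (\<eta> + sqrt (?e n) * v) \<partial>lborel)
    \<longlonglongrightarrow> (\<integral>v. std_normal_density v *\<^sub>R psi t \<eta> \<partial>lborel)"
  proof (rule integral_dominated_convergence)
    show "integrable lborel std_normal_density" by simp
    have "(\<lambda>n. \<eta> + sqrt (?e n) * v) \<longlonglongrightarrow> \<eta> + sqrt 0 * v" for v
      by (intro tendsto_intros tendsto_1_over_Suc)
    then have "(\<lambda>n. psi t (\<eta> + sqrt (?e n) * v)) \<longlonglongrightarrow> psi t \<eta>" for v
      by (intro continuous_on_tendsto_compose[OF continuous_on_psi]) auto
    then show "AE v in lborel. (\<lambda>n. std_normal_density v *\<^sub>R psi t (\<eta> + sqrt (?e n) * v)) \<longlonglongrightarrow> std_normal_density v *\<^sub>R psi t \<eta>"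
      by (intro AE_I2 tendsto_intros)
    show "AE v in lborel. norm (std_normal_density v *\<^sub>R psi t (\<eta> + sqrt (?e n) * v)) \<le> std_normal_density v" for n
      using norm_psi_le_1[of t] t by (intro AE_I2) (simp add: mult_left_le)
  qed auto
  moreover have "(\<integral>x. of_real (G t x) * (iexp (x * - \<eta>) * exp (- (?e n) * x\<^sup>2 / 2)) \<partial>lborel)
      = (\<integral>v. std_normal_density v *\<^sub>R psi t (\<eta> + sqrt (?e n) * v) \<partial>lborel)" for n
    by (rule fourier_G_gauss[OF t]) simp
  ultimately show ?thesis by simp
qed

text \<open>The Gaussian-weighted masses tend to \<open>psi t 0 = 1\<close>. As \<open>G t\<close>
  is nonnegative, Fatou's lemma then bounds its total mass by 1.\<close>

lemma integrable_G:
  assumes t: "0 < t"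
  shows "integrable lborel (G t)"
proof (rule integrableI_nonneg)
  note [measurable] = G_measurable[OF t]
  let ?g = "\<lambda>n x. G t x * exp (- (1 / real (Suc n)) * x\<^sup>2 / 2)"
  have gi: "integrable lborel (?g n)" for n
  proof (rule Bochner_Integration.integrable_bound)
    show "integrable lborel (\<lambda>x. (\<integral>\<xi>. cmod (psi t \<xi>) \<partial>lborel) / (2 * pi) * exp (- (1 / real (Suc n)) * x\<^sup>2 / 2))"
      using integrable_gauss[of "1 / real (Suc n)"] by (intro integrable_mult_right) simp
    show "AE x in lborel. norm (?g n x) \<le> norm ((\<integral>\<xi>. cmod (psi t \<xi>) \<partial>lborel) / (2 * pi) * exp (- (1 / real (Suc n)) * x\<^sup>2 / 2))"
      using G_bound[OF t] unfolding norm_mult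
      by (intro AE_I2 mult_right_mono) (auto intro: order_trans)
  qed simp
  have eq: "complex_of_real (\<integral>x. ?g n x \<partial>lborel) = (\<integral>x. of_real (G t x) * (iexp (x * - 0) * exp (- (1 / real (Suc n)) * x\<^sup>2 / 2)) \<partial>lborel)" for n
    by (simp only: integral_complex_of_real[symmetric] of_real_mult) simp
  have "(\<lambda>n. complex_of_real (\<integral>x. ?g n x \<partial>lborel)) \<longlonglongrightarrow> psi t 0"
    unfolding eq by (rule fourier_G_gauss_limit[OF t])
  from tendsto_Re[OF this] have lim: "(\<lambda>n. \<integral>x. ?g n x \<partial>lborel) \<longlonglongrightarrow> 1"
    by (simp only: psi_0 Re_complex_of_real one_complex.sel)
  have "(\<integral>\<^sup>+x. ennreal (G t x) \<partial>lborel) = (\<integral>\<^sup>+x. liminf (\<lambda>n. ennreal (?g n x)) \<partial>lborel)"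
  proof (intro nn_integral_cong)
    fix x
    have "(\<lambda>n. ?g n x) \<longlonglongrightarrow> G t x * exp (- 0 * x\<^sup>2 / 2)"
      by (intro tendsto_intros tendsto_1_over_Suc) auto
    then have "(\<lambda>n. ennreal (?g n x)) \<longlonglongrightarrow> ennreal (G t x)" by (intro tendsto_ennrealI) simp
    then show "ennreal (G t x) = liminf (\<lambda>n. ennreal (?g n x))"
      by (intro lim_imp_Liminf[symmetric]) auto
  qed
  also have "\<dots> \<le> liminf (\<lambda>n. \<integral>\<^sup>+x. ennreal (?g n x) \<partial>lborel)"
    by (rule nn_integral_liminf) simp
  also have "(\<lambda>n. \<integral>\<^sup>+x. ennreal (?g n x) \<partial>lborel) = (\<lambda>n. ennreal (\<integral>x. ?g n x \<partial>lborel))"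
    using gi G_nonneg[OF t] by (intro ext nn_integral_eq_integral) auto
  also have "liminf (\<lambda>n. ennreal (\<integral>x. ?g n x \<partial>lborel)) = ennreal 1"
    by (intro lim_imp_Liminf tendsto_ennrealI lim) simp
  finally show "(\<integral>\<^sup>+x. ennreal (G t x) \<partial>lborel) < \<infinity>" by (auto simp: ennreal_less_top order_le_less_trans)
qed (use G_measurable[OF t] G_nonneg[OF t] in auto)

text \<open>With \<open>G t\<close> integrable, the weighted integrals converge to the plain one;
  their limit is already identified in \<open>fourier_G_gauss_limit\<close>.\<close>

lemma fourier_G:
  assumes t: "0 < t"
  shows "(\<integral>x. of_real (G t x) * iexp (x * - \<eta>) \<partial>lborel) = psi t \<eta>"
proof -
  note [measurable] = G_measurable[OF t]
  let ?h = "\<lambda>n x. exp (- (1 / real (Suc n)) * x\<^sup>2 / 2)"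
  have "(\<lambda>n. \<integral>x. of_real (G t x) * (iexp (x * - \<eta>) * ?h n x) \<partial>lborel) \<longlonglongrightarrow> (\<integral>x. of_real (G t x) * iexp (x * - \<eta>) \<partial>lborel)"
  proof (rule integral_dominated_convergence)
    show "integrable lborel (\<lambda>x. \<bar>G t x\<bar>)" using integrable_G[OF t] by simp
    have "(\<lambda>n. complex_of_real (?h n x)) \<longlonglongrightarrow> complex_of_real (exp (- 0 * x\<^sup>2 / 2))" for x
      by (intro tendsto_intros tendsto_1_over_Suc) auto
    then have "(\<lambda>n. of_real (G t x) * (iexp (x * - \<eta>) * ?h n x)) \<longlonglongrightarrow> of_real (G t x) * (iexp (x * - \<eta>) * complex_of_real (exp (- 0 * x\<^sup>2 / 2)))" for x
      by (intro tendsto_mult tendsto_const)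
    then show "AE x in lborel. (\<lambda>n. of_real (G t x) * (iexp (x * - \<eta>) * ?h n x)) \<longlonglongrightarrow> of_real (G t x) * iexp (x * - \<eta>)"
      by (intro AE_I2) simp
    have "cmod (iexp (x * - \<eta>) * ?h n x) \<le> 1" for n x
      unfolding norm_mult by (simp only: norm_exp_i_times norm_of_real) simp
    then show "AE x in lborel. cmod (of_real (G t x) * (iexp (x * - \<eta>) * ?h n x)) \<le> \<bar>G t x\<bar>" for n
      unfolding norm_mult[of "of_real _"] norm_of_real by (intro AE_I2 mult_left_le) auto
  qed auto
  with fourier_G_gauss_limit[OF t] show ?thesis by (rule LIMSEQ_unique[rotated])
qed

lemma integral_G: "0 < t \<Longrightarrow> (\<integral>x. G t x \<partial>lborel) = 1"
  using fourier_G[of t 0] by simp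

text \<open>The Fourier integral is inserted for \<open>G s\<close> alone. Exchanging the integrals
  turns \<open>G t\<close> into its transform \<open>psi t\<close>, and
  \<open>psi s * psi t = psi (s + t)\<close>.\<close>

lemma G_semigroup:
  assumes s: "0 < s" and t: "0 < t"
  shows "G (s + t) x = (\<integral>y. G s (x - y) * G t y \<partial>lborel)"
proof -
  note [measurable] = G_measurable[OF t] G_measurable[OF s]
  let ?f = "\<lambda>y \<xi>. psi s \<xi> * iexp (\<xi> * (x - y)) * of_real (G t y)"
  have i: "integrable (lborel \<Otimes>\<^sub>M lborel) (\<lambda>(y, \<xi>). ?f y \<xi>)"
  proof (rule Bochner_Integration.integrable_bound)
    show "integrable (lborel \<Otimes>\<^sub>M lborel) (\<lambda>(y, \<xi>). G t y * cmod (psi s \<xi>))"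
      using integrable_G[OF t] integrable_psi[OF s] by (intro lborel_pair.integrable_prod_mult) auto
    have "cmod (?f y \<xi>) = \<bar>G t y * cmod (psi s \<xi>)\<bar>" for y \<xi>
      unfolding norm_mult norm_exp_i_times norm_of_real by (simp add: abs_mult)
    then show "AE p in lborel \<Otimes>\<^sub>M lborel. cmod (case p of (y, \<xi>) \<Rightarrow> ?f y \<xi>)
        \<le> norm (case p of (y, \<xi>) \<Rightarrow> G t y * cmod (psi s \<xi>))"
      by (intro AE_I2) (auto simp only: split_beta real_norm_def order_refl)
  qed measurable
  have "complex_of_real (\<integral>y. G s (x - y) * G t y \<partial>lborel) = (\<integral>y. (\<integral>\<xi>. ?f y \<xi> \<partial>lborel) / (2 * pi) \<partial>lborel)"
    unfolding integral_complex_of_real[symmetric] of_real_mult of_real_G[OF s]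
    by (simp only: integral_mult_left_zero times_divide_eq_left)
  also have "\<dots> = (\<integral>y. \<integral>\<xi>. ?f y \<xi> \<partial>lborel \<partial>lborel) / (2 * pi)" by simp
  also have "(\<integral>y. \<integral>\<xi>. ?f y \<xi> \<partial>lborel \<partial>lborel) = (\<integral>\<xi>. \<integral>y. ?f y \<xi> \<partial>lborel \<partial>lborel)"
    by (rule lborel_pair.Fubini_integral[OF i, symmetric])
  also have "(\<lambda>\<xi>. \<integral>y. ?f y \<xi> \<partial>lborel) = (\<lambda>\<xi>. psi (s + t) \<xi> * iexp (\<xi> * x))"
  proof (rule ext)
    fix \<xi>
    have "?f y \<xi> = psi s \<xi> * iexp (\<xi> * x) * (of_real (G t y) * iexp (y * - \<xi>))" for y
    proof -
      have "iexp (\<xi> * (x - y)) = iexp (\<xi> * x) * iexp (y * - \<xi>)"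
        by (simp add: exp_add[symmetric] algebra_simps)
      then show ?thesis by (simp only: mult_ac)
    qed
    then have "(\<integral>y. ?f y \<xi> \<partial>lborel) = (\<integral>y. psi s \<xi> * iexp (\<xi> * x) * (of_real (G t y) * iexp (y * - \<xi>)) \<partial>lborel)"
      by (simp only:)
    then show "(\<integral>y. ?f y \<xi> \<partial>lborel) = psi (s + t) \<xi> * iexp (\<xi> * x)"
      by (simp only: integral_mult_right_zero fourier_G[OF t] psi_add) (simp only: mult_ac)
  qed
  also have "(\<integral>\<xi>. psi (s + t) \<xi> * iexp (\<xi> * x) \<partial>lborel) / (2 * pi) = of_real (G (s + t) x)"
    by (rule of_real_G[symmetric]) (use s t in simp)
  finally show ?thesis by (simp only: of_real_eq_iff)
qed

end

section \<open>Comparison of kernels\<close>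

context stable_params
begin

lemma G_pos_point: "\<exists>x. 0 < G 1 x"
proof (rule ccontr)
  assume "\<not> ?thesis"
  then have "G 1 x = 0" for x using G_nonneg[of 1 x] by (auto simp: not_less intro: antisym)
  then show False using integral_G[of 1] by simp
qed

lemma integrable_G_shift:
  assumes "0 < t"
  shows "integrable lborel (\<lambda>z. G t (z - y))"
  using lborel_integrable_real_affine[OF integrable_G[OF assms], of 1 "- y"] by simp

lemma G_shift_measurable [measurable]:
  assumes "0 < t"
  shows "(\<lambda>z. G t (z - y)) \<in> borel_measurable borel" "(\<lambda>z. G t (y - z)) \<in> borel_measurable borel"
  using G_measurable[OF assms] by measurable

lemma G_semigroup_shift:
  assumes s: "0 < s" and t: "0 < t"
  shows "G (s + t) (x - y) = (\<integral>z. G s (x - z) * G t (z - y) \<partial>lborel)"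
proof -
  have "G (s + t) (x - y) = (\<integral>v. G s (x - y - v) * G t v \<partial>lborel)"
    by (rule G_semigroup[OF assms])
  also have "\<dots> = \<bar>1\<bar> *\<^sub>R (\<integral>z. G s (x - y - (- y + 1 * z)) * G t (- y + 1 * z) \<partial>lborel)"
    by (rule lborel_integral_real_affine) simp
  finally show ?thesis by (simp add: algebra_simps)
qed

lemma integrable_G_bounded_mult:
  fixes g :: "real \<Rightarrow> real"
  assumes "0 < t" "g \<in> borel_measurable borel" "\<And>z. \<bar>g z\<bar> \<le> B"
  shows "integrable lborel (\<lambda>z. g z * G t (z - y))"
proof (rule Bochner_Integration.integrable_bound)
  show "integrable lborel (\<lambda>z. B * G t (z - y))" using integrable_G_shift[OF assms(1)] by simp
  have "0 \<le> B" using order_trans[OF abs_ge_zero assms(3)] .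
  then show "AE z in lborel. norm (g z * G t (z - y)) \<le> norm (B * G t (z - y))"
    using assms(3) by (intro AE_I2) (auto simp: abs_mult intro!: mult_right_mono)
qed (use assms in measurable)

text \<open>The argument starts from one point \<open>x1\<close> with \<open>G 1 x1 > 0\<close> and
  from continuity there. At a large time \<open>T\<close> the rescaled window is so short that, seen
  from near \<open>x0\<close>, all of it falls into the neighbourhood of \<open>x1\<close>. The unit
  of freedom in \<open>x\<close> matters later: the initial measure gives finiteness for almost
  every \<open>x\<close>.\<close>

lemma window_lower_bound:
  assumes "0 < K"
  obtains T t0 x0 C where "0 < t0" "t0 < T" "0 < C"
    "\<And>t x z. 0 \<le> t \<Longrightarrow> t \<le> t0 \<Longrightarrow> \<bar>x - x0\<bar> \<le> 1 \<Longrightarrow> \<bar>z\<bar> \<le> K \<Longrightarrow> 1 \<le> C * G (T - t) (x - z)"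
proof -
  obtain x1 where x1: "0 < G 1 x1" using G_pos_point ..
  have "isCont (G 1) x1" using continuous_on_G[of 1] by (simp add: continuous_on_eq_continuous_at)
  then obtain \<eta> where \<eta>: "0 < \<eta>" and near: "\<And>w. \<bar>w - x1\<bar> < \<eta> \<Longrightarrow> \<bar>G 1 w - G 1 x1\<bar> < G 1 x1 / 2"
    using x1 unfolding continuous_at_eps_delta dist_real_def
    by (metis half_gt_zero)
  \<comment> \<open>\<open>T\<close> is taken so large that a deviation of \<open>K + 1\<close>, for
    the window and the freedom in \<open>x\<close>, scales to less than \<open>\<eta> / 2\<close>.
    The time \<open>T / 2\<close> is a lower bound for all \<open>T - t\<close> with
    \<open>t <= t0\<close>.\<close>
  have "filterlim (\<lambda>T::real. T / 2) at_top at_top"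
    using filterlim_tendsto_pos_mult_at_top[OF tendsto_const[of "1 / 2 :: real"] _ filterlim_ident] by simp
  then have "((\<lambda>T. (K + 1) * (T / 2) powr (- 1 / a)) \<longlongrightarrow> (K + 1) * 0) at_top"
    using a by (intro tendsto_mult_left tendsto_neg_powr) auto
  then have "\<forall>\<^sub>F T in at_top. (K + 1) * (T / 2) powr (- 1 / a) < \<eta> / 2"
    using \<eta> by (intro order_tendstoD) auto
  then have "\<forall>\<^sub>F T in at_top. (K + 1) * (T / 2) powr (- 1 / a) < \<eta> / 2 \<and> (1::real) \<le> T"
    by (rule eventually_conj) (rule eventually_ge_at_top)
  then obtain T :: real where T: "1 \<le> T" "(K + 1) * (T / 2) powr (- 1 / a) < \<eta> / 2"
    by (auto dest: eventually_happens)
  \<comment> \<open>For small \<open>t\<close> the moved centre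
    \<open>x1 * (T / (T - t)) powr (1 / a)\<close> stays within \<open>\<eta> / 2\<close> of
    \<open>x1\<close>; this fixes the range of \<open>t\<close>.\<close>
  have "((\<lambda>t. \<bar>x1\<bar> * \<bar>(T / (T - t)) powr (1 / a) - 1\<bar>) \<longlongrightarrow> \<bar>x1\<bar> * \<bar>(T / (T - 0)) powr (1 / a) - 1\<bar>) (at 0)"
    using T by (intro tendsto_intros) auto
  then have "\<forall>\<^sub>F t in at 0. \<bar>x1\<bar> * \<bar>(T / (T - t)) powr (1 / a) - 1\<bar> < \<eta> / 2"
    by (rule order_tendstoD(2)) (use T \<eta> in auto)
  then obtain d where d: "0 < d" and dd: "\<And>t. t \<noteq> 0 \<Longrightarrow> \<bar>t\<bar> < d \<Longrightarrow> \<bar>x1\<bar> * \<bar>(T / (T - t)) powr (1 / a) - 1\<bar> < \<eta> / 2"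
    by (auto simp: eventually_at dist_real_def)
  define t0 where "t0 = min (d / 2) (T / 2)"
  have t0: "0 < t0" "t0 < T" "t0 < d" "t0 \<le> T / 2" using d T by (auto simp: t0_def)
  \<comment> \<open>\<open>x0\<close> is \<open>x1\<close> in the length scale of time
    \<open>T\<close>. In \<open>C\<close>, the factor \<open>2 / G 1 x1\<close> offsets
    \<open>G 1 w >= G 1 x1 / 2\<close>, and \<open>T powr (1 / a)\<close> offsets the prefactor in
    \<open>G_scale\<close>.\<close>
  define x0 where "x0 = x1 * T powr (1 / a)"
  define C where "C = 2 * T powr (1 / a) / G 1 x1"
  have C: "0 < C" using x1 T by (simp add: C_def)
  show thesis
  proof (rule that[OF t0(1,2) C])
    fix t x z :: real assume t: "0 \<le> t" "t \<le> t0" and x: "\<bar>x - x0\<bar> \<le> 1" and z: "\<bar>z\<bar> \<le> K"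
    define \<tau> where "\<tau> = T - t"
    have \<tau>: "T / 2 \<le> \<tau>" "\<tau> \<le> T" "0 < \<tau>" using t t0 T by (auto simp: \<tau>_def)
    define w where "w = \<tau> powr (- 1 / a) * (x - z)"
    have m: "\<tau> powr (- 1 / a) = inverse (\<tau> powr (1 / a))"
      using powr_minus[of \<tau> "1 / a"] by simp
    have "(T / \<tau>) powr (1 / a) = T powr (1 / a) / \<tau> powr (1 / a)"
      by (rule powr_divide)
    also have "\<dots> = T powr (1 / a) * \<tau> powr (- 1 / a)"
      unfolding m by (rule divide_inverse)
    finally have "(T / \<tau>) powr (1 / a) = T powr (1 / a) * \<tau> powr (- 1 / a)" .
    \<comment> \<open>The first summand is the error from scaling with \<open>T - t\<close> in place
      of \<open>T\<close>, the second the offset of \<open>x\<close> and \<open>z\<close> from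
      \<open>x0\<close> and 0.\<close>
    then have "w - x1 = x1 * ((T / \<tau>) powr (1 / a) - 1) + \<tau> powr (- 1 / a) * (x - x0 - z)"
      by (simp add: w_def x0_def algebra_simps)
    then have "\<bar>w - x1\<bar> \<le> \<bar>x1 * ((T / \<tau>) powr (1 / a) - 1)\<bar> + \<bar>\<tau> powr (- 1 / a) * (x - x0 - z)\<bar>"
      by (simp only: abs_triangle_ineq)
    also have "\<bar>x1 * ((T / \<tau>) powr (1 / a) - 1)\<bar> < \<eta> / 2"
      using dd[of t] t t0 T \<eta> by (cases "t = 0") (auto simp: \<tau>_def abs_mult)
    also have "\<bar>\<tau> powr (- 1 / a) * (x - x0 - z)\<bar> \<le> (T / 2) powr (- 1 / a) * (K + 1)"
      unfolding abs_mult using x z \<tau> T a by (intro mult_mono) (auto intro!: powr_mono2')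
    finally have "\<bar>w - x1\<bar> < \<eta>" using T by (simp add: mult.commute)
    then have "G 1 x1 / 2 \<le> G 1 w" using near[of w] by (simp add: abs_if split: if_splits)
    moreover have "1 \<le> T powr (1 / a) * \<tau> powr (- 1 / a)"
    proof -
      have "\<tau> powr (1 / a) \<le> T powr (1 / a)" using \<tau> a by (intro powr_mono2) auto
      then show ?thesis unfolding m using \<tau> by (simp add: divide_inverse[symmetric])
    qed
    ultimately have "1 * (G 1 x1 / 2) \<le> (T powr (1 / a) * \<tau> powr (- 1 / a)) * G 1 w"
      using x1 by (intro mult_mono) auto
    then show "1 \<le> C * G (T - t) (x - z)"
      using x1 G_scale[OF \<tau>(3), of "x - z"] unfolding \<tau>_def[symmetric]
      by (simp add: C_def w_def field_simps)
  qed
qed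

text \<open>By the semigroup property, a fixed kernel at a later time dominates the mass that the kernels
  at small times send to a window.\<close>

lemma kernel_comparison:
  assumes "0 < K"
  obtains T t0 x0 C where "0 < t0" "t0 < T" "0 < C"
    "\<And>s t x y. 0 \<le> s \<Longrightarrow> s < t \<Longrightarrow> t \<le> t0 \<Longrightarrow> \<bar>x - x0\<bar> \<le> 1 \<Longrightarrow>
      (\<integral>z. indicator {-K..K} z * G (t - s) (z - y) \<partial>lborel) \<le> C * G (T - s) (x - y)"
proof -
  obtain T t0 x0 C where *: "0 < t0" "t0 < T" "0 < C"
    and low: "\<And>t x z. 0 \<le> t \<Longrightarrow> t \<le> t0 \<Longrightarrow> \<bar>x - x0\<bar> \<le> 1 \<Longrightarrow> \<bar>z\<bar> \<le> K \<Longrightarrow> 1 \<le> C * G (T - t) (x - z)"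
    using window_lower_bound[OF assms] by metis
  show thesis
  proof (rule that[OF *])
    fix s t x y assume st: "0 \<le> s" "s < t" "t \<le> t0" and x: "\<bar>x - x0\<bar> \<le> 1"
    have pos: "0 < T - t" "0 < t - s" using st * by auto
    \<comment> \<open>On the window the weight 1 is raised to \<open>C * G (T - t) (x - z)\<close>;
      off the window nonnegativity is enough. The times then add up to
      \<open>(T - t) + (t - s) = T - s\<close>.\<close>
    have "(\<integral>z. indicator {-K..K} z * G (t - s) (z - y) \<partial>lborel)
        \<le> (\<integral>z. C * (G (T - t) (x - z) * G (t - s) (z - y)) \<partial>lborel)"
    proof (rule integral_mono)
      show "integrable lborel (\<lambda>z. indicator {-K..K} z * G (t - s) (z - y))"
        using pos by (intro integrable_G_bounded_mult[where B=1]) (auto simp: indicator_def)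
      show "integrable lborel (\<lambda>z. C * (G (T - t) (x - z) * G (t - s) (z - y)))"
        using pos G_bound[OF pos(1)] G_shift_measurable[OF pos(1)]
        by (intro integrable_mult_right integrable_G_bounded_mult) auto
      fix z
      show "indicator {-K..K} z * G (t - s) (z - y) \<le> C * (G (T - t) (x - z) * G (t - s) (z - y))"
      proof (cases "\<bar>z\<bar> \<le> K")
        case True
        then have "1 \<le> C * G (T - t) (x - z)" using low[of t x z] st x by auto
        then have "1 * G (t - s) (z - y) \<le> (C * G (T - t) (x - z)) * G (t - s) (z - y)"
          using G_nonneg[OF pos(2)] by (intro mult_right_mono) auto
        then show ?thesis using True by (auto simp: indicator_def mult.assoc abs_le_iff)
      next
        case False
        then show ?thesis using G_nonneg[OF pos(1)] G_nonneg[OF pos(2)] * by (auto simp: indicator_def abs_le_iff)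
      qed
    qed
    also have "\<dots> = C * G (T - s) (x - y)"
      using G_semigroup_shift[OF pos, of x y] by (simp add: algebra_simps)
    finally show "(\<integral>z. indicator {-K..K} z * G (t - s) (z - y) \<partial>lborel) \<le> C * G (T - s) (x - y)" .
  qed
qed

text \<open>Substituting \<open>x = y + t powr (1 / a) * w\<close> fixes the kernel at
  \<open>G 1\<close> and moves \<open>t\<close> into the argument of \<open>\<phi>\<close>, where
  continuity applies.\<close>

lemma G_convolution_tendsto:
  fixes \<phi> :: "real \<Rightarrow> real"
  assumes cont: "continuous_on UNIV \<phi>" and B: "\<And>x. \<bar>\<phi> x\<bar> \<le> B"
  shows "((\<lambda>t. \<integral>x. G t (x - y) * \<phi> x \<partial>lborel) \<longlongrightarrow> \<phi> y) (at_right 0)"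
proof -
  have [measurable]: "\<phi> \<in> borel_measurable borel" by (rule borel_measurable_continuous_onI[OF cont])
  have [measurable]: "G 1 \<in> borel_measurable borel" by (rule G_measurable) simp
  have eq: "(\<integral>x. G t (x - y) * \<phi> x \<partial>lborel) = (\<integral>w. G 1 w * \<phi> (y + t powr (1 / a) * w) \<partial>lborel)" if t: "0 < t" for t
  proof -
    let ?c = "t powr (1 / a)"
    have c: "0 < ?c" "t powr (- 1 / a) = inverse ?c" using t by (auto simp: powr_minus)
    have "(\<integral>x. G t (x - y) * \<phi> x \<partial>lborel) = \<bar>?c\<bar> *\<^sub>R (\<integral>w. G t (y + ?c * w - y) * \<phi> (y + ?c * w) \<partial>lborel)"
      by (rule lborel_integral_real_affine) (use c in simp)
    also have "(\<lambda>w. G t (y + ?c * w - y) * \<phi> (y + ?c * w)) = (\<lambda>w. inverse ?c * (G 1 w * \<phi> (y + ?c * w)))"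
    proof
      fix w
      have e: "inverse ?c * (?c * w) = w" using c by (simp only: mult.assoc[symmetric]) simp
      then show "G t (y + ?c * w - y) * \<phi> (y + ?c * w) = inverse ?c * (G 1 w * \<phi> (y + ?c * w))"
        using G_scale[OF t, of "?c * w", unfolded c(2) e] by simp
    qed
    finally show ?thesis using c by simp
  qed
  have "((\<lambda>t. \<integral>w. G 1 w * \<phi> (y + t powr (1 / a) * w) \<partial>lborel) \<longlongrightarrow> \<phi> y) (at_right 0)"
  proof (rule tendsto_at_right_sequentially[of 0 1])
    fix S :: "nat \<Rightarrow> real" assume S: "\<And>n. 0 < S n" "S \<longlonglongrightarrow> 0"
    have S': "(\<lambda>n. S n powr (1 / a)) \<longlonglongrightarrow> 0 powr (1 / a)"
      using S a by (intro tendsto_powr' tendsto_const) (auto intro!: always_eventually less_imp_le)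
    have "(\<lambda>n. \<integral>w. G 1 w * \<phi> (y + S n powr (1 / a) * w) \<partial>lborel) \<longlonglongrightarrow> (\<integral>w. G 1 w * \<phi> y \<partial>lborel)"
    proof (rule integral_dominated_convergence)
      show "integrable lborel (\<lambda>w. G 1 w * B)" using integrable_G[of 1] by simp
      have "(\<lambda>n. y + S n powr (1 / a) * w) \<longlonglongrightarrow> y + 0 powr (1 / a) * w" for w
        by (intro tendsto_intros S')
      then have "(\<lambda>n. \<phi> (y + S n powr (1 / a) * w)) \<longlonglongrightarrow> \<phi> y" for w
        by (intro continuous_on_tendsto_compose[OF cont]) auto
      then show "AE w in lborel. (\<lambda>n. G 1 w * \<phi> (y + S n powr (1 / a) * w)) \<longlonglongrightarrow> G 1 w * \<phi> y"
        by (intro AE_I2 tendsto_intros)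
      show "AE w in lborel. norm (G 1 w * \<phi> (y + S n powr (1 / a) * w)) \<le> G 1 w * B" for n
        using B G_nonneg[of 1] by (intro AE_I2) (auto simp: abs_mult intro!: mult_left_mono)
    qed auto
    then show "(\<lambda>n. \<integral>w. G 1 w * \<phi> (y + S n powr (1 / a) * w) \<partial>lborel) \<longlonglongrightarrow> \<phi> y"
      using integral_G[of 1] by simp
  qed simp
  then show ?thesis
    by (rule Lim_transform_eventually) (auto simp: eventually_at_filter eq)
qed

end

section \<open>The contribution of the initial measure\<close>

lemma in_nat_interval: "\<exists>n::nat. x \<in> {- real n..real n}"
proof -
  obtain n :: nat where "\<bar>x\<bar> \<le> real n" using real_arch_simple by blast
  then show ?thesis by (intro exI[of _ n]) auto
qed

lemma sigma_finite_intervals: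
  fixes \<mu> :: "real measure"
  assumes "sets \<mu> = sets borel" "\<And>n::nat. emeasure \<mu> {- real n..real n} < \<infinity>"
  shows "sigma_finite_measure \<mu>"
proof
  let ?A = "range (\<lambda>n::nat. {- real n..real n})"
  have "\<Union> ?A = UNIV" using in_nat_interval by blast
  moreover have "space \<mu> = UNIV" using sets_eq_imp_space_eq[OF assms(1)] by simp
  ultimately show "\<exists>A. countable A \<and> A \<subseteq> sets \<mu> \<and> \<Union> A = space \<mu> \<and> (\<forall>a\<in>A. emeasure \<mu> a \<noteq> \<infinity>)"
    using assms by (intro exI[of _ ?A]) (auto simp: less_top)
qed

lemma AE_lborel_intervals:
  assumes "\<And>r::nat. AE x in lborel. x \<in> {- real r..real r} \<longrightarrow> P x"
  shows "AE x in lborel. P x"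
proof -
  have "AE x in lborel. \<forall>r::nat. x \<in> {- real r..real r} \<longrightarrow> P x"
    using assms by (subst AE_all_countable) auto
  then show ?thesis
  proof (rule AE_mp, intro AE_I2 impI)
    fix x assume "\<forall>r::nat. x \<in> {- real r..real r} \<longrightarrow> P x"
    then show "P x" using in_nat_interval[of x] by blast
  qed
qed

section \<open>Initial measures whose convolution with the kernel is finite almost
  everywhere\<close>

context stable_params
begin

text \<open>Both branches of \<open>M_star\<close> are reduced to this condition. Finiteness almost
  everywhere suffices, since the comparison point \<open>x\<close> may be chosen from an
  interval.\<close>

definition G_tempered :: "real measure \<Rightarrow> bool" where
  "G_tempered \<mu> \<longleftrightarrow> sets \<mu> = sets borel \<and> sigma_finite_measure \<mu> \<and>
     (\<forall>T>0. AE x in lborel. (\<integral>\<^sup>+ y. ennreal (G T (x - y)) \<partial>\<mu>) < \<infinity>)"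

lemma nn_integral_G: "0 < t \<Longrightarrow> (\<integral>\<^sup>+ x. ennreal (G t x) \<partial>lborel) = 1"
  using nn_integral_eq_integral[OF integrable_G] integral_G[of t] G_nonneg[of t] by simp

lemma G_diff_measurable:
  assumes "0 < t" "sets \<mu> = sets borel"
  shows "(\<lambda>(x, y). G t (x - y)) \<in> borel_measurable (lborel \<Otimes>\<^sub>M \<mu>)"
proof -
  have "borel_measurable (lborel \<Otimes>\<^sub>M \<mu>) = (borel_measurable (borel \<Otimes>\<^sub>M borel) :: (real \<times> real \<Rightarrow> real) set)"
    by (intro measurable_cong_sets sets_pair_measure_cong) (auto simp: assms)
  moreover have "(\<lambda>(x, y). G t (x - y)) \<in> borel_measurable (borel \<Otimes>\<^sub>M borel)"
    using G_measurable[OF assms(1)] by measurable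
  ultimately show ?thesis by (simp only:)
qed

text \<open>Tonelli: the average of \<open>G\<^sub>T * \<mu>\<close> over a bounded window is at most the largest \<open>\<mu>\<close>-mass of a
  translate of that window, since \<open>G\<^sub>T\<close> has mass 1. No tail estimate on \<open>G\<close> is needed.\<close>

lemma G_tempered_uniformly_finite:
  assumes sets: "sets \<mu> = sets borel" and D: "D < \<infinity>" "\<And>y. emeasure \<mu> {y - 1..y + 1} \<le> D"
  shows "G_tempered \<mu>"
proof -
  \<comment> \<open>The interval is covered by the \<open>2 * r + 1\<close> intervals of length 2
    centred at \<open>y - r + i\<close>; a point \<open>x\<close> lies in the one with
    \<open>i = floor (x - y + r)\<close>.\<close>
  have D': "emeasure \<mu> {y - real r..y + real r} \<le> of_nat (Suc (2 * r)) * D" for y and r :: nat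
  proof -
    have "\<exists>i\<in>{..2 * r}. x \<in> {y - real r + real i - 1..y - real r + real i + 1}"
      if x: "x \<in> {y - real r..y + real r}" for x
    proof -
      define m where "m = \<lfloor>x - y + real r\<rfloor>"
      have m: "of_int m \<le> x - y + real r" "x - y + real r < of_int m + 1"
        unfolding m_def by linarith+
      have "0 < real_of_int (m + 1)" using m(2) x by auto
      then have "0 \<le> m" by (simp only: of_int_0_less_iff)
      moreover have "real_of_int m \<le> real_of_int (int (2 * r))" using m x by simp
      then have "m \<le> int (2 * r)" by (simp only: of_int_le_iff)
      ultimately show ?thesis
        using m by (intro bexI[of _ "nat m"]) auto
    qed
    then have "{y - real r..y + real r} \<subseteq> (\<Union>i\<in>{..2 * r}. {y - real r + real i - 1..y - real r + real i + 1})"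
      by blast
    then have "emeasure \<mu> {y - real r..y + real r} \<le> emeasure \<mu> (\<Union>i\<in>{..2 * r}. {y - real r + real i - 1..y - real r + real i + 1})"
      by (rule emeasure_mono) (auto simp: sets)
    also have "\<dots> \<le> (\<Sum>i\<in>{..2 * r}. emeasure \<mu> {y - real r + real i - 1..y - real r + real i + 1})"
      by (rule emeasure_subadditive_finite) (auto simp: sets)
    also have "\<dots> \<le> (\<Sum>i\<in>{..2 * r}. D)" by (intro sum_mono D)
    finally show ?thesis by simp
  qed
  have fin: "of_nat (Suc (2 * r)) * D < \<infinity>" for r :: nat
    using D(1) of_nat_less_top[of "Suc (2 * r)"] by (simp add: ennreal_mult_less_top del: of_nat_Suc)
  have sf: "sigma_finite_measure \<mu>"
    using D'[of 0] fin by (intro sigma_finite_intervals[OF sets]) (auto intro: le_less_trans)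
  then interpret \<mu>: sigma_finite_measure \<mu> .
  interpret pair_sigma_finite lborel \<mu> ..
  have "AE x in lborel. (\<integral>\<^sup>+ y. ennreal (G T (x - y)) \<partial>\<mu>) < \<infinity>" if T: "0 < T" for T
  proof (rule AE_lborel_intervals)
    fix r :: nat
    note [measurable] = G_measurable[OF T] G_diff_measurable[OF T sets]
    note [measurable_cong] = sets
    let ?I = "{- real r..real r}"
    have "(\<integral>\<^sup>+x. indicator ?I x * (\<integral>\<^sup>+ y. ennreal (G T (x - y)) \<partial>\<mu>) \<partial>lborel)
        = (\<integral>\<^sup>+x. \<integral>\<^sup>+ y. indicator ?I x * ennreal (G T (x - y)) \<partial>\<mu> \<partial>lborel)"
      by (intro nn_integral_cong nn_integral_cmult[symmetric]) measurable
    also have "\<dots> = (\<integral>\<^sup>+ y. \<integral>\<^sup>+x. indicator ?I x * ennreal (G T (x - y)) \<partial>lborel \<partial>\<mu>)"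
      by (rule Fubini'[symmetric]) measurable
    \<comment> \<open>With \<open>x = y + v\<close> the kernel no longer depends on
      \<open>y\<close>, and the integral over \<open>y\<close> becomes the mass of an interval of
      half-length \<open>r\<close> centred at \<open>- v\<close>.\<close>
    also have "\<dots> = (\<integral>\<^sup>+ y. \<integral>\<^sup>+v. indicator ?I (y + v) * ennreal (G T v) \<partial>lborel \<partial>\<mu>)"
    proof (rule nn_integral_cong)
      fix y
      show "(\<integral>\<^sup>+x. indicator ?I x * ennreal (G T (x - y)) \<partial>lborel) = (\<integral>\<^sup>+v. indicator ?I (y + v) * ennreal (G T v) \<partial>lborel)"
        using nn_integral_real_affine[of "\<lambda>x. indicator ?I x * ennreal (G T (x - y))" 1 y] by simp
    qed
    also have "\<dots> = (\<integral>\<^sup>+v. \<integral>\<^sup>+ y. indicator ?I (y + v) * ennreal (G T v) \<partial>\<mu> \<partial>lborel)"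
      by (rule Fubini') measurable
    also have "\<dots> \<le> (\<integral>\<^sup>+v. of_nat (Suc (2 * r)) * D * ennreal (G T v) \<partial>lborel)"
    proof (rule nn_integral_mono)
      fix v
      have "(\<integral>\<^sup>+ y. indicator ?I (y + v) * ennreal (G T v) \<partial>\<mu>) = (\<integral>\<^sup>+ y. indicator {- v - real r..- v + real r} y \<partial>\<mu>) * ennreal (G T v)"
        by (subst nn_integral_multc[symmetric]) (auto simp: sets intro!: nn_integral_cong split: split_indicator)
      also have "\<dots> \<le> of_nat (Suc (2 * r)) * D * ennreal (G T v)"
        using D'[of "- v" r] by (intro mult_right_mono) (auto simp: sets)
      finally show "(\<integral>\<^sup>+ y. indicator ?I (y + v) * ennreal (G T v) \<partial>\<mu>) \<le> of_nat (Suc (2 * r)) * D * ennreal (G T v)" .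
    qed
    also have "\<dots> = of_nat (Suc (2 * r)) * D"
      by (subst nn_integral_cmult) (auto simp: nn_integral_G[OF T])
    finally have "(\<integral>\<^sup>+x. indicator ?I x * (\<integral>\<^sup>+ y. ennreal (G T (x - y)) \<partial>\<mu>) \<partial>lborel) \<noteq> \<infinity>"
      using fin[of r] by (auto simp: top_unique)
    then have "AE x in lborel. indicator ?I x * (\<integral>\<^sup>+ y. ennreal (G T (x - y)) \<partial>\<mu>) \<noteq> \<infinity>"
      by (intro nn_integral_PInf_AE) measurable
    then show "AE x in lborel. x \<in> ?I \<longrightarrow> (\<integral>\<^sup>+ y. ennreal (G T (x - y)) \<partial>\<mu>) < \<infinity>"
      by (rule AE_mp) (auto intro!: AE_I2 simp: less_top)
  qed
  with sf sets show ?thesis by (auto simp: G_tempered_def)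
qed

text \<open>The classical heat kernel \<open>exp (- x^2 / (4 * t)) / sqrt (4 * pi * t)\<close>:
  \<open>a = 2\<close> forces \<open>\<delta> = 0\<close> and makes \<open>psi t\<close> a
  Gaussian.\<close>

lemma G_gauss:
  assumes "a = 2" "0 < t"
  shows "G t x = sqrt (pi / t) * exp (- x\<^sup>2 / (4 * t)) / (2 * pi)"
proof -
  have d: "\<delta> = 0" using assms(1) \<delta> by simp
  have "psi t \<xi> = exp (- complex_of_real (t * \<bar>\<xi>\<bar> powr a) * exp (- \<i> * complex_of_real (\<delta> * pi * sgn \<xi> / 2)))" for \<xi>
    by (rule psi_def)
  then have "psi t \<xi> = of_real (exp (- (2 * t) * \<xi>\<^sup>2 / 2))" for \<xi>
    unfolding d assms(1) by (simp add: powr_numeral exp_of_real[symmetric])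
  then have "(\<integral>\<xi>. psi t \<xi> * iexp (\<xi> * x) \<partial>lborel) = (\<integral>\<xi>. iexp (\<xi> * x) * exp (- (2 * t) * \<xi>\<^sup>2 / 2) \<partial>lborel)"
    by (simp only: mult.commute)
  also have "\<dots> = of_real (sqrt (2 * pi / (2 * t)) * exp (- x\<^sup>2 / (2 * (2 * t))))"
    by (rule fourier_gauss) (use assms in simp)
  finally show ?thesis by (simp add: G_eq_Re)
qed

lemma G_tempered_gauss:
  assumes a2: "a = 2" and sets: "sets \<mu> = sets borel"
    and fin: "\<And>c. 0 < c \<Longrightarrow> (\<integral>\<^sup>+ x. ennreal (exp (- c * x\<^sup>2)) \<partial>\<mu>) < \<infinity>"
  shows "G_tempered \<mu>"
proof -
  note [measurable_cong] = sets
  have "emeasure \<mu> {- real n..real n} < \<infinity>" for n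
  proof -
    have "emeasure \<mu> {- real n..real n} = (\<integral>\<^sup>+ x. indicator {- real n..real n} x \<partial>\<mu>)"
      by (simp add: sets)
    also have "\<dots> \<le> (\<integral>\<^sup>+ x. ennreal (exp ((real n)\<^sup>2)) * ennreal (exp (- 1 * x\<^sup>2)) \<partial>\<mu>)"
    proof (rule nn_integral_mono)
      fix x :: real
      have "x\<^sup>2 \<le> (real n)\<^sup>2" if "x \<in> {- real n..real n}"
        using that by (intro power2_le_iff_abs_le[THEN iffD2]) (auto simp: abs_le_iff)
      then show "indicator {- real n..real n} x \<le> ennreal (exp ((real n)\<^sup>2)) * ennreal (exp (- 1 * x\<^sup>2))"
        by (auto simp: ennreal_mult[symmetric] exp_add[symmetric] split: split_indicator simp flip: ennreal_1)
    qed
    also have "\<dots> < \<infinity>"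
      using fin[of 1] by (subst nn_integral_cmult) (auto simp: ennreal_mult_less_top)
    finally show ?thesis .
  qed
  then have sf: "sigma_finite_measure \<mu>" by (rule sigma_finite_intervals[OF sets])
  have "(\<integral>\<^sup>+ y. ennreal (G T (x - y)) \<partial>\<mu>) < \<infinity>" if T: "0 < T" for T x
  proof -
    let ?C = "sqrt (pi / T) / (2 * pi) * exp (x\<^sup>2 / (4 * T))"
    have "(\<integral>\<^sup>+ y. ennreal (G T (x - y)) \<partial>\<mu>) \<le> (\<integral>\<^sup>+ y. ennreal ?C * ennreal (exp (- (1 / (8 * T)) * y\<^sup>2)) \<partial>\<mu>)"
    proof (rule nn_integral_mono)
      fix y
      \<comment> \<open>This amounts to \<open>(2 * x - y)^2 >= 0\<close>. It trades the kernel
        centred at \<open>x\<close> for the weight \<open>exp (- c * y^2)\<close> with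
        \<open>c = 1 / (8 * T)\<close>; as \<open>T\<close> is arbitrary, arbitrarily small
        \<open>c\<close> occur.\<close>
      have "y\<^sup>2 / 2 - x\<^sup>2 \<le> (x - y)\<^sup>2"
        using zero_le_power2[of "2 * x - y"] by (simp add: power2_eq_square algebra_simps)
      then have "- (x - y)\<^sup>2 / (4 * T) \<le> (x\<^sup>2 - y\<^sup>2 / 2) / (4 * T)"
        using T by (intro divide_right_mono) auto
      also have "\<dots> = x\<^sup>2 / (4 * T) + - (1 / (8 * T)) * y\<^sup>2"
        using T by (simp add: field_simps)
      finally have "exp (- (x - y)\<^sup>2 / (4 * T)) \<le> exp (x\<^sup>2 / (4 * T)) * exp (- (1 / (8 * T)) * y\<^sup>2)"
        by (simp only: exp_le_cancel_iff exp_add[symmetric])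
      then have "sqrt (pi / T) / (2 * pi) * exp (- (x - y)\<^sup>2 / (4 * T)) \<le> sqrt (pi / T) / (2 * pi) * (exp (x\<^sup>2 / (4 * T)) * exp (- (1 / (8 * T)) * y\<^sup>2))"
        using T by (intro mult_left_mono) auto
      then have "G T (x - y) \<le> ?C * exp (- (1 / (8 * T)) * y\<^sup>2)"
        by (simp add: G_gauss[OF a2 T] mult.assoc)
      then show "ennreal (G T (x - y)) \<le> ennreal ?C * ennreal (exp (- (1 / (8 * T)) * y\<^sup>2))"
        using T by (subst ennreal_mult[symmetric]) (auto intro!: ennreal_leI)
    qed
    also have "\<dots> < \<infinity>"
      using fin[of "1 / (8 * T)"] T by (subst nn_integral_cmult) (auto simp: ennreal_mult_less_top)
    finally show ?thesis .
  qed
  with sf sets show ?thesis by (auto simp: G_tempered_def)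
qed

text \<open>For \<open>a < 2\<close> the weight centred at \<open>y\<close> is at least
  \<open>1 / 2\<close> on \<open>{y - 1..y + 1}\<close>, so the masses of these intervals are at
  most \<open>2 * C\<close>, uniformly in \<open>y\<close>. For \<open>a = 2\<close> the Gaussian
  condition is compared with the explicit kernel.\<close>

lemma M_star_tempered:
  assumes "M_star a mp mn"
  shows "G_tempered mp" "G_tempered mn"
proof -
  have sets: "sets mp = sets borel" "sets mn = sets borel"
    using assms by (auto simp: M_star_def jordan_pair_def)
  have "G_tempered mp \<and> G_tempered mn"
  proof (cases "a < 2")
    case True
    then obtain C :: real where C: "\<And>y. (\<integral>\<^sup>+ x. ennreal (1 / (1 + \<bar>y - x\<bar> powr (1 + a))) \<partial>mp)
         + (\<integral>\<^sup>+ x. ennreal (1 / (1 + \<bar>y - x\<bar> powr (1 + a))) \<partial>mn) \<le> ennreal C"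
      using assms by (auto simp: M_star_def)
    have "G_tempered \<mu>" if s: "sets \<mu> = sets borel"
      and b: "\<And>y. (\<integral>\<^sup>+ x. ennreal (1 / (1 + \<bar>y - x\<bar> powr (1 + a))) \<partial>\<mu>) \<le> ennreal C" for \<mu>
    proof (rule G_tempered_uniformly_finite[OF s])
      show "2 * ennreal C < \<infinity>" by (simp add: ennreal_mult_less_top)
      fix y
      note [measurable_cong] = s
      have "emeasure \<mu> {y - 1..y + 1} = (\<integral>\<^sup>+ x. indicator {y - 1..y + 1} x \<partial>\<mu>)"
        by (simp add: s)
      also have "\<dots> \<le> (\<integral>\<^sup>+ x. 2 * ennreal (1 / (1 + \<bar>y - x\<bar> powr (1 + a))) \<partial>\<mu>)"
      proof (rule nn_integral_mono)
        fix x
        have "1 / 2 \<le> 1 / (1 + \<bar>y - x\<bar> powr (1 + a))" if "x \<in> {y - 1..y + 1}"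
          using that a powr_le1[of "1 + a" "\<bar>y - x\<bar>"] by (intro divide_left_mono) (auto simp: abs_le_iff add_pos_nonneg)
        then have "1 \<le> 2 * (1 / (1 + \<bar>y - x\<bar> powr (1 + a)))" if "x \<in> {y - 1..y + 1}"
          using that by fastforce
        then have "ennreal 1 \<le> ennreal (2 * (1 / (1 + \<bar>y - x\<bar> powr (1 + a))))" if "x \<in> {y - 1..y + 1}"
          using that by (intro ennreal_leI)
        moreover have "ennreal (2 * (1 / (1 + \<bar>y - x\<bar> powr (1 + a)))) = 2 * ennreal (1 / (1 + \<bar>y - x\<bar> powr (1 + a)))"
          by (subst ennreal_mult) (auto simp: add_nonneg_nonneg)
        ultimately have "x \<in> {y - 1..y + 1} \<Longrightarrow> 1 \<le> 2 * ennreal (1 / (1 + \<bar>y - x\<bar> powr (1 + a)))"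
          by (simp only: ennreal_1)
        then show "indicator {y - 1..y + 1} x \<le> 2 * ennreal (1 / (1 + \<bar>y - x\<bar> powr (1 + a)))"
          by (auto split: split_indicator)
      qed
      also have "\<dots> = 2 * (\<integral>\<^sup>+ x. ennreal (1 / (1 + \<bar>y - x\<bar> powr (1 + a))) \<partial>\<mu>)"
        by (rule nn_integral_cmult) measurable
      also have "\<dots> \<le> 2 * ennreal C" using b by (intro mult_left_mono) auto
      finally show "emeasure \<mu> {y - 1..y + 1} \<le> 2 * ennreal C" .
    qed
    note unif = this
    show ?thesis
    proof
      show "G_tempered mp" by (rule unif[OF sets(1) order_trans[OF _ C]]) (rule add_increasing2, auto)
      show "G_tempered mn" by (rule unif[OF sets(2) order_trans[OF _ C]]) (rule add_increasing, auto)
    qed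
  next
    case False
    then have "a = 2" using a by simp
    then show ?thesis using assms sets by (intro conjI G_tempered_gauss) (auto simp: M_star_def)
  qed
  then show "G_tempered mp" "G_tempered mn" by auto
qed

text \<open>Integrability is recorded besides the limit: a Bochner integral that does not exist has
  the value 0, and the integral of \<open>u t x * \<phi> x\<close> is later split into two
  parts.\<close>

lemma initial_data_convergence:
  fixes \<phi> :: "real \<Rightarrow> real"
  assumes \<mu>: "G_tempered \<mu>" and cont: "continuous_on UNIV \<phi>" and supp: "\<And>x. \<bar>x\<bar> > K \<Longrightarrow> \<phi> x = 0" and K: "0 < K"
    and B: "\<And>x. \<bar>\<phi> x\<bar> \<le> B"
  shows "((\<lambda>t. \<integral>x. (\<integral>y. G t (x - y) \<partial>\<mu>) * \<phi> x \<partial>lborel) \<longlongrightarrow> (\<integral>y. \<phi> y \<partial>\<mu>)) (at_right 0)"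
    and "\<exists>t0>0. \<forall>t. 0 < t \<longrightarrow> t \<le> t0 \<longrightarrow> integrable lborel (\<lambda>x. (\<integral>y. G t (x - y) \<partial>\<mu>) * \<phi> x)"
proof -
  have sets: "sets \<mu> = sets borel" and "sigma_finite_measure \<mu>" using \<mu> by (auto simp: G_tempered_def)
  interpret \<mu>: sigma_finite_measure \<mu> by fact
  interpret pair_sigma_finite lborel \<mu> ..
  note [measurable_cong] = sets
  have [measurable]: "\<phi> \<in> borel_measurable borel" by (rule borel_measurable_continuous_onI[OF cont])
  obtain T t0 x0 C where T: "0 < t0" "t0 < T" "0 < C" and comp:
    "\<And>s t x y. 0 \<le> s \<Longrightarrow> s < t \<Longrightarrow> t \<le> t0 \<Longrightarrow> \<bar>x - x0\<bar> \<le> 1 \<Longrightarrow>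
      (\<integral>z. indicator {-K..K} z * G (t - s) (z - y) \<partial>lborel) \<le> C * G (T - s) (x - y)"
    by (rule kernel_comparison[OF K], rule that)
  have "0 \<le> B" using order_trans[OF abs_ge_zero B] .
  have "AE x in lborel. (\<integral>\<^sup>+ y. ennreal (G T (x - y)) \<partial>\<mu>) < \<infinity>" using \<mu> T by (auto simp: G_tempered_def)
  \<comment> \<open>The interval \<open>{x0 - 1..x0 + 1}\<close> has positive length and cannot lie
    inside the exceptional null set.\<close>
  then have "\<exists>x. \<bar>x - x0\<bar> \<le> 1 \<and> (\<integral>\<^sup>+ y. ennreal (G T (x - y)) \<partial>\<mu>) < \<infinity>"
  proof (rule contrapos_pp)
    assume "\<not> (\<exists>x. \<bar>x - x0\<bar> \<le> 1 \<and> (\<integral>\<^sup>+ y. ennreal (G T (x - y)) \<partial>\<mu>) < \<infinity>)"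
    then have *: "(\<integral>\<^sup>+ y. ennreal (G T (x - y)) \<partial>\<mu>) < \<infinity> \<longrightarrow> x \<notin> {x0 - 1..x0 + 1}" for x
      by (auto simp: abs_le_iff)
    show "\<not> (AE x in lborel. (\<integral>\<^sup>+ y. ennreal (G T (x - y)) \<partial>\<mu>) < \<infinity>)"
    proof
      assume "AE x in lborel. (\<integral>\<^sup>+ y. ennreal (G T (x - y)) \<partial>\<mu>) < \<infinity>"
      then have "AE x in lborel. x \<notin> {x0 - 1..x0 + 1}" by (rule AE_mp) (use * in \<open>auto intro!: AE_I2\<close>)
      then have "{x0 - 1..x0 + 1} \<in> null_sets lborel" by (subst AE_iff_null_sets) auto
      then have "emeasure lborel {x0 - 1..x0 + 1} = 0" by (rule null_setsD1)
      then show False by (subst (asm) emeasure_lborel_Icc) auto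
    qed
  qed
  then obtain x where x: "\<bar>x - x0\<bar> \<le> 1" and fin: "(\<integral>\<^sup>+ y. ennreal (G T (x - y)) \<partial>\<mu>) < \<infinity>" by blast
  have T0: "0 < T" using T by simp
  have [measurable]: "G T \<in> borel_measurable borel" by (rule G_measurable[OF T0])
  \<comment> \<open>The comparison at \<open>s = 0\<close>, with \<open>B\<close> bounding
    \<open>\<phi>\<close>: one \<open>\<mu>\<close>-integrable function that dominates the inner
    integrals for all \<open>t <= t0\<close>.\<close>
  define dom where "dom y = B * C * G T (x - y)" for y
  have dom: "integrable \<mu> dom"
    unfolding dom_def using fin G_nonneg[OF T0] by (intro integrable_mult_right integrableI_nonneg) auto
  have ind: "\<bar>\<phi> z\<bar> \<le> B * indicator {-K..K} z" for z
    using B supp[of z] by (auto simp: indicator_def abs_le_iff not_le)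
  have bnd: "(\<integral>z. \<bar>G t (z - y) * \<phi> z\<bar> \<partial>lborel) \<le> dom y"
    and int1: "integrable lborel (\<lambda>z. G t (z - y) * \<phi> z)" if t: "0 < t" "t \<le> t0" for t y
  proof -
    have i: "integrable lborel (\<lambda>z. \<phi> z * G t (z - y))" using t B by (intro integrable_G_bounded_mult) auto
    then show int1: "integrable lborel (\<lambda>z. G t (z - y) * \<phi> z)" by (simp add: mult.commute)
    have "(\<integral>z. \<bar>G t (z - y) * \<phi> z\<bar> \<partial>lborel) \<le> (\<integral>z. B * (indicator {-K..K} z * G t (z - y)) \<partial>lborel)"
    proof (rule integral_mono)
      show "integrable lborel (\<lambda>z. \<bar>G t (z - y) * \<phi> z\<bar>)" using int1 by simp
      show "integrable lborel (\<lambda>z. B * (indicator {-K..K} z * G t (z - y)))"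
        using t by (intro integrable_mult_right integrable_G_bounded_mult[where B=1]) (auto simp: indicator_def)
      show "\<bar>G t (z - y) * \<phi> z\<bar> \<le> B * (indicator {-K..K} z * G t (z - y))" for z
        using mult_right_mono[OF ind[of z], of "G t (z - y)"] G_nonneg[OF t(1)]
        by (simp add: abs_mult mult_ac)
    qed
    also have "\<dots> = B * (\<integral>z. indicator {-K..K} z * G t (z - y) \<partial>lborel)" by simp
    also have "\<dots> \<le> B * (C * G T (x - y))"
      using comp[of 0 t x y] t x \<open>0 \<le> B\<close> by (intro mult_left_mono) auto
    finally show "(\<integral>z. \<bar>G t (z - y) * \<phi> z\<bar> \<partial>lborel) \<le> dom y" by (simp add: dom_def mult.assoc)
  qed
  have intp: "integrable (lborel \<Otimes>\<^sub>M \<mu>) (\<lambda>(z, y). G t (z - y) * \<phi> z)" if t: "0 < t" "t \<le> t0" for t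
  proof (rule integrableI_bounded)
    note [measurable] = G_diff_measurable[OF t(1) sets] G_measurable[OF t(1)]
    show "(\<lambda>(z, y). G t (z - y) * \<phi> z) \<in> borel_measurable (lborel \<Otimes>\<^sub>M \<mu>)" by measurable
    have "(\<integral>\<^sup>+p. ennreal (norm (case p of (z, y) \<Rightarrow> G t (z - y) * \<phi> z)) \<partial>(lborel \<Otimes>\<^sub>M \<mu>))
       = (\<integral>\<^sup>+y. \<integral>\<^sup>+z. ennreal \<bar>G t (z - y) * \<phi> z\<bar> \<partial>lborel \<partial>\<mu>)"
      by (subst nn_integral_snd[symmetric]) (auto intro!: nn_integral_cong)
    also have "\<dots> = (\<integral>\<^sup>+y. ennreal (\<integral>z. \<bar>G t (z - y) * \<phi> z\<bar> \<partial>lborel) \<partial>\<mu>)"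
      using int1[OF t] by (intro nn_integral_cong nn_integral_eq_integral) auto
    also have "\<dots> \<le> (\<integral>\<^sup>+y. ennreal (dom y) \<partial>\<mu>)" using bnd[OF t] by (intro nn_integral_mono ennreal_leI)
    also have "\<dots> < \<infinity>" using dom by (auto simp: real_integrable_def less_top)
    finally show "(\<integral>\<^sup>+p. ennreal (norm (case p of (z, y) \<Rightarrow> G t (z - y) * \<phi> z)) \<partial>(lborel \<Otimes>\<^sub>M \<mu>)) < \<infinity>" .
  qed
  show "\<exists>t0>0. \<forall>t. 0 < t \<longrightarrow> t \<le> t0 \<longrightarrow> integrable lborel (\<lambda>x. (\<integral>y. G t (x - y) \<partial>\<mu>) * \<phi> x)"
    using integrable_fst[OF intp] T(1) by (auto intro!: exI[of _ t0])
  have eq: "(\<integral>x. (\<integral>y. G t (x - y) \<partial>\<mu>) * \<phi> x \<partial>lborel) = (\<integral>y. \<integral>x. G t (x - y) * \<phi> x \<partial>lborel \<partial>\<mu>)" if t: "0 < t" "t \<le> t0" for t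
    using Fubini_integral[OF intp[OF t]] by simp
  have "((\<lambda>t. \<integral>y. \<integral>x. G t (x - y) * \<phi> x \<partial>lborel \<partial>\<mu>) \<longlongrightarrow> (\<integral>y. \<phi> y \<partial>\<mu>)) (at_right 0)"
  proof (rule tendsto_at_right_sequentially[OF T(1)])
    fix S :: "nat \<Rightarrow> real" assume S: "\<And>n. 0 < S n" "\<And>n. S n < t0" "S \<longlonglongrightarrow> 0"
    show "(\<lambda>n. \<integral>y. \<integral>x. G (S n) (x - y) * \<phi> x \<partial>lborel \<partial>\<mu>) \<longlonglongrightarrow> (\<integral>y. \<phi> y \<partial>\<mu>)"
    proof (rule integral_dominated_convergence[OF _ _ dom])
      show "\<phi> \<in> borel_measurable \<mu>" by measurable
      show "(\<lambda>y. \<integral>x. G (S n) (x - y) * \<phi> x \<partial>lborel) \<in> borel_measurable \<mu>" for n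
        using G_diff_measurable[OF S(1) sets] G_measurable[OF S(1)] by measurable
      have "((\<lambda>n. \<integral>x. G (S n) (x - y) * \<phi> x \<partial>lborel) \<longlonglongrightarrow> \<phi> y)" for y
        by (rule filterlim_compose[OF G_convolution_tendsto[OF cont B]])
          (use S in \<open>auto simp: filterlim_at less_imp_neq[THEN not_sym]\<close>)
      then show "AE y in \<mu>. (\<lambda>n. \<integral>x. G (S n) (x - y) * \<phi> x \<partial>lborel) \<longlonglongrightarrow> \<phi> y" by simp
      show "AE y in \<mu>. norm (\<integral>x. G (S n) (x - y) * \<phi> x \<partial>lborel) \<le> dom y" for n
        using bnd[OF S(1) less_imp_le[OF S(2)]]
        by (intro AE_I2 order_trans[OF integral_norm_bound]) (simp only: real_norm_def)
    qed
  qed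
  then show "((\<lambda>t. \<integral>x. (\<integral>y. G t (x - y) \<partial>\<mu>) * \<phi> x \<partial>lborel) \<longlongrightarrow> (\<integral>y. \<phi> y \<partial>\<mu>)) (at_right 0)"
    by (rule Lim_transform_eventually)
      (use T(1) eq in \<open>auto simp: eventually_at_right_field intro!: exI[of _ t0]\<close>)
qed

end

section \<open>Independence via characteristic functions\<close>

lemma integrable_mult_square:
  fixes f g :: "'a \<Rightarrow> real"
  assumes [measurable]: "f \<in> borel_measurable M" "g \<in> borel_measurable M"
    and f: "integrable M (\<lambda>x. (f x)\<^sup>2)" and g: "integrable M (\<lambda>x. (g x)\<^sup>2)"
  shows "integrable M (\<lambda>x. f x * g x)"
proof (rule Bochner_Integration.integrable_bound)
  show "integrable M (\<lambda>x. (f x)\<^sup>2 + (g x)\<^sup>2)" using f g by simp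
  have "\<bar>f x * g x\<bar> \<le> (f x)\<^sup>2 + (g x)\<^sup>2" for x
  proof -
    have "2 * (\<bar>f x\<bar> * \<bar>g x\<bar>) \<le> (f x)\<^sup>2 + (g x)\<^sup>2"
      using sum_squares_bound[of "\<bar>f x\<bar>" "\<bar>g x\<bar>"] by (simp add: mult.assoc)
    moreover have "0 \<le> \<bar>f x\<bar> * \<bar>g x\<bar>" by simp
    ultimately show ?thesis unfolding abs_mult by linarith
  qed
  then show "AE x in M. norm (f x * g x) \<le> norm ((f x)\<^sup>2 + (g x)\<^sup>2)" by simp
qed measurable

lemma Cauchy_Schwarz_integral:
  fixes f g :: "'a \<Rightarrow> real"
  assumes [measurable]: "f \<in> borel_measurable M" "g \<in> borel_measurable M"
    and f: "integrable M (\<lambda>x. (f x)\<^sup>2)" and g: "integrable M (\<lambda>x. (g x)\<^sup>2)"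
  shows "(\<integral>x. f x * g x \<partial>M)\<^sup>2 \<le> (\<integral>x. (f x)\<^sup>2 \<partial>M) * (\<integral>x. (g x)\<^sup>2 \<partial>M)"
proof -
  have fg: "integrable M (\<lambda>x. f x * g x)" by (rule integrable_mult_square[OF assms])
  have "(\<integral>\<^sup>+x. ennreal \<bar>f x\<bar> * ennreal \<bar>g x\<bar> \<partial>M)\<^sup>2
      \<le> (\<integral>\<^sup>+x. (ennreal \<bar>f x\<bar>)\<^sup>2 \<partial>M) * (\<integral>\<^sup>+x. (ennreal \<bar>g x\<bar>)\<^sup>2 \<partial>M)"
    by (rule Cauchy_Schwarz_nn_integral) measurable
  also have "(\<integral>\<^sup>+x. ennreal \<bar>f x\<bar> * ennreal \<bar>g x\<bar> \<partial>M) = ennreal (\<integral>x. \<bar>f x * g x\<bar> \<partial>M)"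
    using integrable_abs[OF fg]
    by (subst nn_integral_eq_integral[symmetric]) (auto simp: ennreal_mult[symmetric] abs_mult)
  also have "(\<integral>\<^sup>+x. (ennreal \<bar>f x\<bar>)\<^sup>2 \<partial>M) = ennreal (\<integral>x. (f x)\<^sup>2 \<partial>M)"
    using f by (subst nn_integral_eq_integral[symmetric]) (auto simp: ennreal_power)
  also have "(\<integral>\<^sup>+x. (ennreal \<bar>g x\<bar>)\<^sup>2 \<partial>M) = ennreal (\<integral>x. (g x)\<^sup>2 \<partial>M)"
    using g by (subst nn_integral_eq_integral[symmetric]) (auto simp: ennreal_power)
  finally have "(\<integral>x. \<bar>f x * g x\<bar> \<partial>M)\<^sup>2 \<le> (\<integral>x. (f x)\<^sup>2 \<partial>M) * (\<integral>x. (g x)\<^sup>2 \<partial>M)"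
    by (simp add: ennreal_power ennreal_mult[symmetric] ennreal_le_iff)
  moreover have "\<bar>\<integral>x. f x * g x \<partial>M\<bar> \<le> (\<integral>x. \<bar>f x * g x\<bar> \<partial>M)"
    using integral_norm_bound[of M "\<lambda>x. f x * g x"] by simp
  then have "(\<integral>x. f x * g x \<partial>M)\<^sup>2 \<le> (\<integral>x. \<bar>f x * g x\<bar> \<partial>M)\<^sup>2"
    by (metis abs_ge_zero power2_abs power_mono)
  ultimately show ?thesis by linarith
qed

context prob_space
begin

text \<open>If \<open>f = 1 + V / C\<close> is a probability density, then \<open>X\<close> has the same characteristic function
  under \<open>f M\<close> as under \<open>M\<close>; Levy's uniqueness theorem gives the claim.\<close>

lemma fourier_zero_imp_zero_real:
  fixes V X :: "'a \<Rightarrow> real"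
  assumes [measurable]: "V \<in> borel_measurable M" "X \<in> borel_measurable M" "B \<in> sets borel"
    and b: "\<And>\<omega>. \<bar>V \<omega>\<bar> \<le> C"
    and zero: "\<And>\<xi>. (\<integral>\<omega>. of_real (V \<omega>) * iexp (\<xi> * X \<omega>) \<partial>M) = 0"
  shows "(\<integral>\<omega>. V \<omega> * indicator B (X \<omega>) \<partial>M) = 0"
proof -
  \<comment> \<open>\<open>C\<close> may be 0. With \<open>D = C + 1\<close> the quotient
    \<open>V / D\<close> makes sense and does not drop below \<open>-1\<close>, so \<open>f\<close>
    is a density.\<close>
  define D where "D = C + 1"
  have D1: "0 < D" using order_trans[OF abs_ge_zero b] by (simp add: D_def)
  have D2: "\<bar>V \<omega>\<bar> \<le> D" for \<omega> using b[of \<omega>] by (simp add: D_def)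
  note D = D1 D2
  define f where "f \<omega> = 1 + V \<omega> / D" for \<omega>
  have [measurable]: "f \<in> borel_measurable M" unfolding f_def by measurable
  have f0: "0 \<le> f \<omega>" for \<omega>
    using D(1) D(2)[of \<omega>] by (simp add: f_def field_simps)
  have iV: "integrable M (\<lambda>\<omega>. V \<omega> * g \<omega>)" if "g \<in> borel_measurable M" "\<And>\<omega>. \<bar>g \<omega>\<bar> \<le> 1" for g :: "'a \<Rightarrow> real"
    using that D by (intro integrable_const_bound[where B=D]) (auto simp: abs_mult intro!: AE_I2 mult_left_le order_trans[OF mult_left_le])
  \<comment> \<open>Frequency 0 says that \<open>V\<close> has mean zero; hence \<open>f\<close> has
    total mass 1.\<close>
  have V0: "(\<integral>\<omega>. V \<omega> \<partial>M) = 0" using zero[of 0] by simp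
  have iV1: "integrable M V" using iV[of "\<lambda>_. 1"] by simp
  have "emeasure (density M f) (space M) = (\<integral>\<^sup>+\<omega>. ennreal (f \<omega>) \<partial>M)"
    by (simp add: emeasure_density)
  also have "\<dots> = ennreal (\<integral>\<omega>. f \<omega> \<partial>M)"
    using iV1 f0 by (intro nn_integral_eq_integral) (auto simp: f_def)
  also have "(\<integral>\<omega>. f \<omega> \<partial>M) = 1" using iV1 V0 by (simp add: f_def prob_space)
  finally have "prob_space (density M f)" by (intro prob_spaceI) simp
  then interpret Q: prob_space "density M f" .
  have r1: "real_distribution (distr M borel X)" by (rule real_distribution_distr) simp
  have r2: "real_distribution (distr (density M f) borel X)"
    by (rule Q.real_distribution_distr) simp
  have "char (distr (density M f) borel X) \<xi> = char (distr M borel X) \<xi>" for \<xi>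
  proof -
    have ie: "integrable M (\<lambda>\<omega>. iexp (\<xi> * X \<omega>))"
      by (intro integrable_const_bound[where B=1]) auto
    have "integrable M (\<lambda>\<omega>. of_real (V \<omega>) * iexp (\<xi> * X \<omega>))"
      using D by (intro integrable_const_bound[where B=D]) (auto simp: norm_mult)
    then have iVe: "integrable M (\<lambda>\<omega>. of_real (V \<omega>) * iexp (\<xi> * X \<omega>) / of_real D)" by simp
    have "char (distr (density M f) borel X) \<xi> = (\<integral>\<omega>. f \<omega> *\<^sub>R iexp (\<xi> * X \<omega>) \<partial>M)"
      unfolding char_def by (simp add: integral_distr integral_density f0)
    also have "\<dots> = (\<integral>\<omega>. iexp (\<xi> * X \<omega>) + of_real (V \<omega>) * iexp (\<xi> * X \<omega>) / of_real D \<partial>M)"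
      by (intro Bochner_Integration.integral_cong) (auto simp: f_def scaleR_conv_of_real field_simps)
    also have "\<dots> = (\<integral>\<omega>. iexp (\<xi> * X \<omega>) \<partial>M) + (\<integral>\<omega>. of_real (V \<omega>) * iexp (\<xi> * X \<omega>) / of_real D \<partial>M)"
      using ie iVe by (rule Bochner_Integration.integral_add)
    also have "\<dots> = (\<integral>\<omega>. iexp (\<xi> * X \<omega>) \<partial>M)" using zero[of \<xi>] by simp
    finally show ?thesis unfolding char_def by (simp add: integral_distr)
  qed
  then have "distr (density M f) borel X = distr M borel X"
    by (intro Levy_uniqueness r1 r2 ext)
  then have "measure (distr (density M f) borel X) B = measure (distr M borel X) B" by simp
  moreover have "measure (distr (density M f) borel X) B = (\<integral>\<omega>. f \<omega> * indicator B (X \<omega>) \<partial>M)"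
  proof -
    interpret R: real_distribution "distr (density M f) borel X" by (rule r2)
    have "measure (distr (density M f) borel X) B = (\<integral>x. indicator B x \<partial>distr (density M f) borel X)" by simp
    also have "\<dots> = (\<integral>\<omega>. f \<omega> * indicator B (X \<omega>) \<partial>M)"
      by (subst integral_distr) (auto simp: integral_density f0)
    finally show ?thesis .
  qed
  moreover have "measure (distr M borel X) B = (\<integral>\<omega>. indicator B (X \<omega>) \<partial>M)"
  proof -
    interpret R: real_distribution "distr M borel X" by (rule r1)
    have "measure (distr M borel X) B = (\<integral>x. indicator B x \<partial>distr M borel X)" by simp
    also have "\<dots> = (\<integral>\<omega>. indicator B (X \<omega>) \<partial>M)"
      by (subst integral_distr) auto
    finally show ?thesis .
  qed
  moreover have "(\<integral>\<omega>. f \<omega> * indicator B (X \<omega>) \<partial>M) = (\<integral>\<omega>. indicator B (X \<omega>) + V \<omega> * indicator B (X \<omega>) / D \<partial>M)"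
    by (intro Bochner_Integration.integral_cong) (auto simp: f_def field_simps)
  moreover have "\<dots> = (\<integral>\<omega>. indicator B (X \<omega>) \<partial>M) + (\<integral>\<omega>. V \<omega> * indicator B (X \<omega>) / D \<partial>M)"
    by (intro Bochner_Integration.integral_add integrable_divide iV integrable_const_bound[where B=1]) (auto simp: indicator_def)
  ultimately show ?thesis using D by simp
qed

text \<open>Conjugation together with \<open>\<xi>\<close> replaced by \<open>- \<xi>\<close>
  preserves the hypothesis, so it holds for \<open>Re V\<close> and \<open>Im V\<close>
  separately.\<close>

lemma fourier_zero_imp_zero:
  fixes V :: "'a \<Rightarrow> complex" and X :: "'a \<Rightarrow> real"
  assumes [measurable]: "V \<in> borel_measurable M" "X \<in> borel_measurable M" "B \<in> sets borel"
    and b: "\<And>\<omega>. cmod (V \<omega>) \<le> C"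
    and zero: "\<And>\<xi>. (\<integral>\<omega>. V \<omega> * iexp (\<xi> * X \<omega>) \<partial>M) = 0"
  shows "(\<integral>\<omega>. V \<omega> * indicator B (X \<omega>) \<partial>M) = 0"
proof -
  have i: "integrable M (\<lambda>\<omega>. V \<omega> * iexp (\<xi> * X \<omega>))" for \<xi>
    using b by (intro integrable_const_bound[where B=C]) (auto simp: norm_mult)
  have [measurable]: "(\<lambda>\<omega>. cnj (V \<omega>)) \<in> borel_measurable M"
    by (rule measurable_compose[OF assms(1) borel_measurable_continuous_onI[OF continuous_on_cnj[OF continuous_on_id]]])
  have ic: "integrable M (\<lambda>\<omega>. cnj (V \<omega>) * iexp (\<xi> * X \<omega>))" for \<xi>
    using b by (intro integrable_const_bound[where B=C]) (auto simp: norm_mult)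
  have zero': "(\<integral>\<omega>. cnj (V \<omega>) * iexp (\<xi> * X \<omega>) \<partial>M) = 0" for \<xi>
  proof -
    have "(\<integral>\<omega>. cnj (V \<omega>) * iexp (\<xi> * X \<omega>) \<partial>M) = (\<integral>\<omega>. cnj (V \<omega> * iexp (- \<xi> * X \<omega>)) \<partial>M)"
      by (intro Bochner_Integration.integral_cong) (auto simp: exp_cnj)
    also have "\<dots> = cnj 0" unfolding Bochner_Integration.integral_cnj zero ..
    finally show ?thesis by simp
  qed
  have re: "(\<integral>\<omega>. Re (V \<omega>) * indicator B (X \<omega>) \<partial>M) = 0"
  proof (rule fourier_zero_imp_zero_real)
    show "\<bar>Re (V \<omega>)\<bar> \<le> C" for \<omega> using abs_Re_le_cmod b by (rule order_trans)
    have "of_real (Re (V \<omega>)) * iexp (\<xi> * X \<omega>) = (V \<omega> * iexp (\<xi> * X \<omega>) + cnj (V \<omega>) * iexp (\<xi> * X \<omega>)) / 2" for \<omega> \<xi>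
      by (simp add: complex_add_cnj distrib_right[symmetric])
    then show "(\<integral>\<omega>. of_real (Re (V \<omega>)) * iexp (\<xi> * X \<omega>) \<partial>M) = 0" for \<xi>
      using Bochner_Integration.integral_add[OF i[of \<xi>] ic[of \<xi>]] by (simp only: zero zero' integral_divide_zero) simp
  qed measurable
  have im: "(\<integral>\<omega>. Im (V \<omega>) * indicator B (X \<omega>) \<partial>M) = 0"
  proof (rule fourier_zero_imp_zero_real)
    show "\<bar>Im (V \<omega>)\<bar> \<le> C" for \<omega> using abs_Im_le_cmod b by (rule order_trans)
    have "of_real (Im (V \<omega>)) * iexp (\<xi> * X \<omega>) = (V \<omega> * iexp (\<xi> * X \<omega>) - cnj (V \<omega>) * iexp (\<xi> * X \<omega>)) / (2 * \<i>)" for \<omega> \<xi>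
      by (subst nonzero_eq_divide_eq) (simp_all add: complex_eq_iff algebra_simps del: exp_Euler)
    then show "(\<integral>\<omega>. of_real (Im (V \<omega>)) * iexp (\<xi> * X \<omega>) \<partial>M) = 0" for \<xi>
      using Bochner_Integration.integral_diff[OF i[of \<xi>] ic[of \<xi>]] by (simp only: zero zero' integral_divide_zero) simp
  qed measurable
  have iV: "integrable M (\<lambda>\<omega>. V \<omega> * indicator B (X \<omega>))"
    using b order_trans[OF norm_ge_zero b]
    by (intro integrable_const_bound[where B=C]) (auto simp: indicator_def)
  have "Re (\<integral>\<omega>. V \<omega> * indicator B (X \<omega>) \<partial>M) = (\<integral>\<omega>. Re (V \<omega> * indicator B (X \<omega>)) \<partial>M)"
    by (rule integral_Re[OF iV, symmetric])
  also have "\<dots> = 0" unfolding re[symmetric]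
    by (intro Bochner_Integration.integral_cong) (auto simp: indicator_def)
  finally have 1: "Re (\<integral>\<omega>. V \<omega> * indicator B (X \<omega>) \<partial>M) = 0" .
  have "Im (\<integral>\<omega>. V \<omega> * indicator B (X \<omega>) \<partial>M) = (\<integral>\<omega>. Im (V \<omega> * indicator B (X \<omega>)) \<partial>M)"
    by (rule integral_Im[OF iV, symmetric])
  also have "\<dots> = 0" unfolding im[symmetric]
    by (intro Bochner_Integration.integral_cong) (auto simp: indicator_def)
  finally show ?thesis using 1 by (simp add: complex_eq_iff)
qed

end

section \<open>Gaussian sums over the white noise\<close>

text \<open>Simple deterministic integrands, as lists of weighted noise sets inside
  \<open>S\<close>: \<open>wfun\<close> is the step function, \<open>wvar\<close> its squared
  \<open>L2\<close> norm, and \<open>wsum\<close> below its Wiener integral. Lists may contain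
  overlapping sets and match the shape of \<open>white_noise\<close>.\<close>

definition noise_list :: "(real \<times> real) set \<Rightarrow> (real \<times> (real \<times> real) set) list \<Rightarrow> bool" where
  "noise_list S ps \<longleftrightarrow> (\<forall>(c, A)\<in>set ps. noise_set A \<and> A \<subseteq> S)"

definition wfun :: "(real \<times> (real \<times> real) set) list \<Rightarrow> real \<times> real \<Rightarrow> real" where
  "wfun ps p = (\<Sum>(c, A)\<leftarrow>ps. c * indicator A p)"

definition wvar :: "(real \<times> (real \<times> real) set) list \<Rightarrow> real" where
  "wvar ps = (\<integral>p. (wfun ps p)\<^sup>2 \<partial>lborel)"

definition wscale :: "real \<Rightarrow> (real \<times> (real \<times> real) set) list \<Rightarrow> (real \<times> (real \<times> real) set) list" where
  "wscale k ps = map (\<lambda>(c, A). (k * c, A)) ps"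

lemma noise_list_Nil [simp]: "noise_list S []"
  and noise_list_Cons [simp]: "noise_list S ((c, A) # ps) \<longleftrightarrow> noise_set A \<and> A \<subseteq> S \<and> noise_list S ps"
  and noise_list_append [simp]: "noise_list S (ps @ qs) \<longleftrightarrow> noise_list S ps \<and> noise_list S qs"
  and noise_list_wscale [simp]: "noise_list S (wscale k ps) \<longleftrightarrow> noise_list S ps"
  by (auto simp: noise_list_def wscale_def split_beta)

lemma noise_list_mono: "noise_list S ps \<Longrightarrow> S \<subseteq> T \<Longrightarrow> noise_list T ps"
proof (induction ps)
  case (Cons q ps)
  then show ?case by (cases q) (simp, blast)
qed simp

lemma wfun_Nil [simp]: "wfun [] p = 0"
  and wfun_Cons [simp]: "wfun ((c, A) # ps) p = c * indicator A p + wfun ps p"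
  and wfun_append [simp]: "wfun (ps @ qs) p = wfun ps p + wfun qs p"
  by (simp_all add: wfun_def)

lemma wfun_wscale [simp]: "wfun (wscale k ps) p = k * wfun ps p"
  by (induction ps) (auto simp: wscale_def algebra_simps)

lemma wfun_outside: "noise_list S ps \<Longrightarrow> p \<notin> S \<Longrightarrow> wfun ps p = 0"
  by (induction ps) (auto simp: indicator_def)

lemma noise_set_measurable: "noise_set A \<Longrightarrow> A \<in> sets borel"
  by (simp add: noise_set_def)

lemma noise_set_finite: "noise_set A \<Longrightarrow> emeasure lborel A < \<infinity>"
  by (simp add: noise_set_def)

lemma wfun_measurable: "noise_list S ps \<Longrightarrow> wfun ps \<in> borel_measurable lborel"
proof (induction ps)
  case (Cons q ps)
  then show ?case
    by (cases q) (auto simp: fun_eq_iff[symmetric] dest!: noise_set_measurable)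
qed (simp add: wfun_def[abs_def])

lemma integrable_wfun_square: "noise_list S ps \<Longrightarrow> integrable lborel (\<lambda>p. (wfun ps p)\<^sup>2)"
proof (induction ps)
  case (Cons q ps)
  obtain c A where q: "q = (c, A)" by (cases q)
  have A: "noise_set A" and ps: "noise_list S ps" using Cons.prems by (auto simp: q)
  have [measurable]: "A \<in> sets lborel" "wfun ps \<in> borel_measurable lborel"
    using A noise_set_measurable wfun_measurable[OF ps] by auto
  have i: "integrable lborel (indicator A :: real \<times> real \<Rightarrow> real)"
    using A by (intro integrable_real_indicator) (auto simp: noise_set_def)
  have *: "integrable lborel (\<lambda>p. (c * indicator A p)\<^sup>2)"
  proof -
    have "(\<lambda>p. (c * indicator A p)\<^sup>2) = (\<lambda>p. c\<^sup>2 * indicator A p)"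
      by (auto simp: fun_eq_iff indicator_def)
    then show ?thesis using i by simp
  qed
  have "(\<lambda>p. (wfun (q # ps) p)\<^sup>2) = (\<lambda>p. (c * indicator A p)\<^sup>2 + (wfun ps p)\<^sup>2 + 2 * ((c * indicator A p) * wfun ps p))"
    by (auto simp: q power2_sum)
  moreover have "integrable lborel (\<lambda>p. (c * indicator A p) * wfun ps p)"
    by (intro integrable_mult_square * Cons.IH ps) auto
  ultimately show ?case using * Cons.IH[OF ps] by simp
qed simp

lemma wvar_nonneg: "0 \<le> wvar ps"
  by (simp add: wvar_def)

lemma wvar_append_disjoint:
  assumes "noise_list S ps" "noise_list T qs" "S \<inter> T = {}"
  shows "wvar (ps @ qs) = wvar ps + wvar qs"
proof -
  have "(wfun (ps @ qs) p)\<^sup>2 = (wfun ps p)\<^sup>2 + (wfun qs p)\<^sup>2" for p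
    using wfun_outside[OF assms(1), of p] wfun_outside[OF assms(2), of p] assms(3)
    by (cases "p \<in> S"; cases "p \<in> T") auto
  then show ?thesis
    using integrable_wfun_square[OF assms(1)] integrable_wfun_square[OF assms(2)] by (simp add: wvar_def)
qed

lemma wfun_sum: "wfun ps p = (\<Sum>i<length ps. fst (ps ! i) * indicator (snd (ps ! i)) p)"
  by (simp add: wfun_def sum_list_sum_nth atLeast0LessThan split_beta)

text \<open>Expanding the square yields exactly the double sum that \<open>white_noise\<close>
  prescribes as variance.\<close>

lemma wvar_sum:
  assumes "noise_list S ps"
  shows "wvar ps = (\<Sum>i<length ps. \<Sum>j<length ps. fst (ps ! i) * fst (ps ! j) * measure lborel (snd (ps ! i) \<inter> snd (ps ! j)))"
proof -
  have n: "noise_set (snd (ps ! i))" if "i < length ps" for i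
    using assms nth_mem[OF that] by (auto simp: noise_list_def split_beta)
  have int: "integrable lborel (indicator (snd (ps ! i) \<inter> snd (ps ! j)) :: real \<times> real \<Rightarrow> real)"
    if "i < length ps" "j < length ps" for i j
  proof (intro integrable_real_indicator)
    show "snd (ps ! i) \<inter> snd (ps ! j) \<in> sets lborel" using n that by (auto simp: noise_set_def)
    have "emeasure lborel (snd (ps ! i) \<inter> snd (ps ! j)) \<le> emeasure lborel (snd (ps ! i))"
      using n[OF that(1)] by (intro emeasure_mono) (auto simp: noise_set_def)
    then show "emeasure lborel (snd (ps ! i) \<inter> snd (ps ! j)) < \<infinity>"
      using noise_set_finite[OF n[OF that(1)]] by (rule le_less_trans)
  qed
  have "(wfun ps p)\<^sup>2 = (\<Sum>i<length ps. \<Sum>j<length ps. fst (ps ! i) * fst (ps ! j) * indicator (snd (ps ! i) \<inter> snd (ps ! j)) p)" for p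
    unfolding wfun_sum power2_eq_square sum_product
    by (intro sum.cong refl) (simp only: indicator_inter_arith mult_ac)
  then have "wvar ps = (\<integral>p. (\<Sum>i<length ps. \<Sum>j<length ps. fst (ps ! i) * fst (ps ! j) * indicator (snd (ps ! i) \<inter> snd (ps ! j)) p) \<partial>lborel)"
    by (simp add: wvar_def)
  also have "\<dots> = (\<Sum>i<length ps. \<Sum>j<length ps. fst (ps ! i) * fst (ps ! j) * measure lborel (snd (ps ! i) \<inter> snd (ps ! j)))"
  proof (subst Bochner_Integration.integral_sum)
    have i: "integrable lborel (\<lambda>p. fst (ps ! i) * fst (ps ! j) * indicator (snd (ps ! i) \<inter> snd (ps ! j)) p :: real)"
      if "i < length ps" "j < length ps" for i j
      using int[OF that] by (rule integrable_mult_right)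
    then show "integrable lborel (\<lambda>p. \<Sum>j<length ps. fst (ps ! i) * fst (ps ! j) * indicator (snd (ps ! i) \<inter> snd (ps ! j)) p :: real)"
      if "i \<in> {..<length ps}" for i
      using that by (intro Bochner_Integration.integrable_sum) simp
    show "(\<Sum>i<length ps. \<integral>p. (\<Sum>j<length ps. fst (ps ! i) * fst (ps ! j) * indicator (snd (ps ! i) \<inter> snd (ps ! j)) p) \<partial>lborel)
      = (\<Sum>i<length ps. \<Sum>j<length ps. fst (ps ! i) * fst (ps ! j) * measure lborel (snd (ps ! i) \<inter> snd (ps ! j)))"
    proof (rule sum.cong[OF refl])
      fix k assume k: "k \<in> {..<length ps}"
      have "(\<integral>p. (\<Sum>j<length ps. fst (ps ! k) * fst (ps ! j) * indicator (snd (ps ! k) \<inter> snd (ps ! j)) p) \<partial>lborel)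
        = (\<Sum>j<length ps. \<integral>p. fst (ps ! k) * fst (ps ! j) * indicator (snd (ps ! k) \<inter> snd (ps ! j)) p \<partial>lborel)"
        using i k by (intro Bochner_Integration.integral_sum) simp
      then show "(\<integral>p. (\<Sum>j<length ps. fst (ps ! k) * fst (ps ! j) * indicator (snd (ps ! k) \<inter> snd (ps ! j)) p) \<partial>lborel)
        = (\<Sum>j<length ps. fst (ps ! k) * fst (ps ! j) * measure lborel (snd (ps ! k) \<inter> snd (ps ! j)))"
        by (simp only: integral_mult_right_zero) simp
    qed
  qed
  finally show ?thesis .
qed

locale noise_space = prob_space M for M :: "'w measure" +
  fixes W :: "(real \<times> real) set \<Rightarrow> 'w \<Rightarrow> real"
  assumes white_noise: "white_noise M W"
begin

definition wsum :: "(real \<times> (real \<times> real) set) list \<Rightarrow> 'w \<Rightarrow> real" where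
  "wsum ps \<omega> = (\<Sum>(c, A)\<leftarrow>ps. c * W A \<omega>)"

lemma wsum_Nil [simp]: "wsum [] \<omega> = 0"
  and wsum_Cons [simp]: "wsum ((c, A) # ps) \<omega> = c * W A \<omega> + wsum ps \<omega>"
  and wsum_append [simp]: "wsum (ps @ qs) \<omega> = wsum ps \<omega> + wsum qs \<omega>"
  by (simp_all add: wsum_def)

lemma wsum_wscale [simp]: "wsum (wscale k ps) \<omega> = k * wsum ps \<omega>"
  by (induction ps) (auto simp: wscale_def algebra_simps)

lemma W_measurable: "noise_set A \<Longrightarrow> W A \<in> borel_measurable M"
  using white_noise by (auto simp: white_noise_def)

lemma wsum_measurable: "noise_list S ps \<Longrightarrow> wsum ps \<in> borel_measurable M"
proof (induction ps)
  case (Cons q ps)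
  obtain c A where q: "q = (c, A)" by (cases q)
  have [measurable]: "W A \<in> borel_measurable M" "wsum ps \<in> borel_measurable M"
    using Cons W_measurable by (auto simp: q)
  show ?case unfolding q wsum_Cons[abs_def] by measurable
qed (simp add: wsum_def[abs_def])

lemma wsum_distribution:
  assumes "noise_list S ps"
  shows "wvar ps > 0 \<Longrightarrow> distributed M lborel (wsum ps) (normal_density 0 (sqrt (wvar ps)))"
    and "wvar ps = 0 \<Longrightarrow> AE \<omega> in M. wsum ps \<omega> = 0"
proof -
  let ?As = "map snd ps" and ?cs = "map fst ps"
  have h1: "length ?cs = length ?As \<and> (\<forall>A\<in>set ?As. noise_set A)"
    using assms by (auto simp: noise_list_def)
  have h2: "(\<lambda>\<omega>. \<Sum>i<length ?As. ?cs ! i * W (?As ! i) \<omega>) = wsum ps"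
    by (rule ext) (simp add: wsum_def sum_list_sum_nth atLeast0LessThan split_beta)
  have h3: "(\<Sum>i<length ?As. \<Sum>j<length ?As.
                    ?cs ! i * ?cs ! j * measure (lborel :: (real \<times> real) measure) (?As ! i \<inter> ?As ! j)) = wvar ps"
    unfolding wvar_sum[OF assms] by (intro sum.cong) auto
  have "(wvar ps > 0 \<longrightarrow> distributed M lborel (wsum ps) (normal_density 0 (sqrt (wvar ps))))
      \<and> (wvar ps = 0 \<longrightarrow> (AE \<omega> in M. wsum ps \<omega> = 0))"
    using white_noise[unfolded white_noise_def, THEN conjunct2, THEN conjunct2, rule_format, OF h1]
    unfolding Let_def h2 h3 .
  then show "wvar ps > 0 \<Longrightarrow> distributed M lborel (wsum ps) (normal_density 0 (sqrt (wvar ps)))"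
    "wvar ps = 0 \<Longrightarrow> AE \<omega> in M. wsum ps \<omega> = 0" by auto
qed

lemma expectation_iexp_wsum:
  assumes "noise_list S ps"
  shows "(\<integral>\<omega>. iexp (wsum ps \<omega>) \<partial>M) = of_real (exp (- wvar ps / 2))"
proof (cases "wvar ps = 0")
  case True
  have [measurable]: "wsum ps \<in> borel_measurable M" by (rule wsum_measurable[OF assms])
  have "(\<integral>\<omega>. iexp (wsum ps \<omega>) \<partial>M) = (\<integral>\<omega>. 1 \<partial>M)"
    by (rule integral_cong_AE) (use wsum_distribution(2)[OF assms True] in auto)
  then show ?thesis by (simp add: True prob_space)
next
  case False
  let ?v = "wvar ps"
  have v: "0 < ?v" using False wvar_nonneg[of ps] by simp
  have [measurable]: "wsum ps \<in> borel_measurable M" by (rule wsum_measurable[OF assms])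
  have "(\<integral>\<omega>. iexp (wsum ps \<omega>) \<partial>M) = (\<integral>x. iexp x \<partial>distr M lborel (wsum ps))"
    by (rule integral_distr[symmetric]) auto
  also have "distr M lborel (wsum ps) = density lborel (normal_density 0 (sqrt ?v))"
    by (rule distributed_distr_eq_density[OF wsum_distribution(1)[OF assms v]])
  also have "(\<integral>x. iexp x \<partial>density lborel (normal_density 0 (sqrt ?v))) = (\<integral>x. normal_density 0 (sqrt ?v) x *\<^sub>R iexp x \<partial>lborel)"
    by (rule integral_density) auto
  \<comment> \<open>Up to normalisation this is \<open>fourier_gauss\<close> at the point 1 with
    \<open>\<epsilon> = 1 / wvar ps\<close>.\<close>
  also have "\<dots> = (\<integral>x. of_real (1 / sqrt (2 * pi * ?v)) * (iexp (x * 1) * exp (- (1 / ?v) * x\<^sup>2 / 2)) \<partial>lborel)"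
    using v by (intro Bochner_Integration.integral_cong) (auto simp: normal_density_def scaleR_conv_of_real mult_ac)
  also have "\<dots> = of_real (1 / sqrt (2 * pi * ?v)) * of_real (sqrt (2 * pi / (1 / ?v)) * exp (- 1\<^sup>2 / (2 * (1 / ?v))))"
    using v by (subst integral_mult_right_zero, subst fourier_gauss) auto
  also have "\<dots> = of_real (1 / sqrt (2 * pi * ?v) * (sqrt (2 * pi / (1 / ?v)) * exp (- 1\<^sup>2 / (2 * (1 / ?v)))))"
    by (simp only: of_real_mult)
  also have "1 / sqrt (2 * pi * ?v) * (sqrt (2 * pi / (1 / ?v)) * exp (- 1\<^sup>2 / (2 * (1 / ?v)))) = exp (- ?v / 2)"
    using v by simp
  finally show ?thesis .
qed

lemma wsum_moments:
  assumes "noise_list S ps"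
  shows "integrable M (wsum ps)" "integrable M (\<lambda>\<omega>. (wsum ps \<omega>)\<^sup>2)"
    and "expectation (wsum ps) = 0" "(\<integral>\<omega>. (wsum ps \<omega>)\<^sup>2 \<partial>M) = wvar ps"
proof -
  have [measurable]: "wsum ps \<in> borel_measurable M" by (rule wsum_measurable[OF assms])
  have "integrable M (wsum ps) \<and> integrable M (\<lambda>\<omega>. (wsum ps \<omega>)\<^sup>2) \<and> expectation (wsum ps) = 0 \<and> (\<integral>\<omega>. (wsum ps \<omega>)\<^sup>2 \<partial>M) = wvar ps"
  proof (cases "wvar ps = 0")
    case True
    note ae = wsum_distribution(2)[OF assms True]
    have "integrable M (wsum ps)" using ae by (subst integrable_cong_AE[where g="\<lambda>_. 0"]) auto
    moreover have "integrable M (\<lambda>\<omega>. (wsum ps \<omega>)\<^sup>2)" using ae by (subst integrable_cong_AE[where g="\<lambda>_. 0"]) auto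
    moreover have "expectation (wsum ps) = 0" using ae by (intro integral_eq_zero_AE) auto
    moreover have "(\<integral>\<omega>. (wsum ps \<omega>)\<^sup>2 \<partial>M) = 0" using ae by (intro integral_eq_zero_AE) auto
    ultimately show ?thesis using True by simp
  next
    case False
    then have v: "0 < wvar ps" using wvar_nonneg[of ps] by simp
    then have s: "0 < sqrt (wvar ps)" by simp
    note D = wsum_distribution(1)[OF assms v]
    have e: "expectation (wsum ps) = 0" by (rule normal_distributed_expectation[OF s D])
    moreover have "(\<integral>\<omega>. (wsum ps \<omega>)\<^sup>2 \<partial>M) = wvar ps"
      using normal_distributed_variance[OF s D] v by (simp add: e)
    moreover have "integrable M (wsum ps)"
      using distributed_integrable[OF D, of "\<lambda>x. x"] integrable_normal_moment_nz_1[OF s, of 0] by simp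
    moreover have "integrable M (\<lambda>\<omega>. (wsum ps \<omega>)\<^sup>2)"
      using distributed_integrable[OF D, of "\<lambda>x. x\<^sup>2"] integrable_normal_moment[OF s, of 0 2] by simp
    ultimately show ?thesis by simp
  qed
  then show "integrable M (wsum ps)" "integrable M (\<lambda>\<omega>. (wsum ps \<omega>)\<^sup>2)"
    "expectation (wsum ps) = 0" "(\<integral>\<omega>. (wsum ps \<omega>)\<^sup>2 \<partial>M) = wvar ps" by auto
qed

text \<open>Additivity of \<open>W\<close> is not postulated by \<open>white_noise\<close>. It
  follows almost surely, because the difference of two sums with the same step function has variance
  0.\<close>

lemma wsum_AE_eq:
  assumes "noise_list S ps" "noise_list T qs" "\<And>p. wfun ps p = wfun qs p"
  shows "AE \<omega> in M. wsum ps \<omega> = wsum qs \<omega>"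
proof -
  have "wvar (ps @ wscale (-1) qs) = 0" using assms(3) by (simp add: wvar_def)
  moreover have "noise_list UNIV (ps @ wscale (-1) qs)"
    using assms(1,2) by (auto intro: noise_list_mono)
  ultimately have "AE \<omega> in M. wsum (ps @ wscale (-1) qs) \<omega> = 0" by (intro wsum_distribution(2))
  then show ?thesis by simp
qed

end

section \<open>Past and future of the noise\<close>

lemma tendsto_zero_square_bound:
  fixes x y :: "nat \<Rightarrow> real"
  assumes "\<And>n. (x n)\<^sup>2 \<le> y n" "y \<longlonglongrightarrow> 0"
  shows "x \<longlonglongrightarrow> 0"
proof (rule Lim_null_comparison)
  show "\<forall>\<^sub>F n in sequentially. norm (x n) \<le> sqrt (y n)"
    using real_sqrt_le_mono[OF assms(1)] by simp
  show "(\<lambda>n. sqrt (y n)) \<longlonglongrightarrow> 0" using tendsto_real_sqrt[OF assms(2)] by simp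
qed

definition past :: "real \<Rightarrow> (real \<times> real) set" where "past s = {0..s} \<times> UNIV"
definition future :: "real \<Rightarrow> (real \<times> real) set" where "future s = {s<..} \<times> UNIV"

lemma past_future_disjoint: "past s \<inter> future s = {}"
  by (auto simp: past_def future_def)

lemma (in prob_space) indep_set_mono:
  assumes "indep_set A B" "A' \<subseteq> A" "B' \<subseteq> B"
  shows "indep_set A' B'"
  using indep_setD_ev1[OF assms(1)] indep_setD_ev2[OF assms(1)] assms(2,3)
  by (intro indep_setI) (auto intro!: indep_setD[OF assms(1)])

context noise_space
begin

text \<open>Orthogonality to all characters of the past noise. The class is stable under
  multiplication by indicators of the events \<open>W A \<omega> \<in> B\<close> with
  \<open>A\<close> in the past, which leads from characters to events.\<close>

definition orth_past :: "real \<Rightarrow> ('w \<Rightarrow> real) \<Rightarrow> bool" where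
  "orth_past s V \<longleftrightarrow> V \<in> borel_measurable M \<and> (\<exists>C. \<forall>\<omega>. \<bar>V \<omega>\<bar> \<le> C) \<and>
     (\<forall>ps. noise_list (past s) ps \<longrightarrow> (\<integral>\<omega>. of_real (V \<omega>) * iexp (wsum ps \<omega>) \<partial>M) = 0)"

text \<open>Past and future are disjoint, so variances add and the joint characteristic function
  factors. With the centred past character as \<open>V\<close>, \<open>fourier_zero_imp_zero\<close>
  then replaces the future character by the indicator of \<open>B\<close>.\<close>

lemma orth_past_future:
  assumes qs: "noise_list (future s) qs" and B: "B \<in> sets borel"
  shows "orth_past s (\<lambda>\<omega>. indicator B (wsum qs \<omega>) - prob {\<omega> \<in> space M. wsum qs \<omega> \<in> B})"
proof -
  note [measurable] = B wsum_measurable[OF qs]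
  let ?P = "prob {\<omega> \<in> space M. wsum qs \<omega> \<in> B}"
  have "(\<integral>\<omega>. of_real (indicator B (wsum qs \<omega>) - ?P) * iexp (wsum ps \<omega>) \<partial>M) = 0" if ps: "noise_list (past s) ps" for ps
  proof -
    have [measurable]: "wsum ps \<in> borel_measurable M" by (rule wsum_measurable[OF ps])
    define c where "c = (\<integral>\<omega>. iexp (wsum ps \<omega>) \<partial>M)"
    have i: "integrable M (\<lambda>\<omega>. iexp (Y \<omega>))" if "Y \<in> borel_measurable M" for Y :: "'w \<Rightarrow> real"
      using that by (intro integrable_const_bound[where B=1]) auto
    have "(\<integral>\<omega>. (iexp (wsum ps \<omega>) - c) * indicator B (wsum qs \<omega>) \<partial>M) = 0"
    proof (rule fourier_zero_imp_zero)
      show "cmod (iexp (wsum ps \<omega>) - c) \<le> 1 + cmod c" for \<omega>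
        using norm_triangle_ineq4[of "iexp (wsum ps \<omega>)" c] by simp
      fix \<xi>
      have n: "noise_list (past s \<union> future s) (ps @ wscale \<xi> qs)" "noise_list (future s) (wscale \<xi> qs)"
        using ps qs by (auto intro: noise_list_mono)
      have "(\<integral>\<omega>. (iexp (wsum ps \<omega>) - c) * iexp (\<xi> * wsum qs \<omega>) \<partial>M)
         = (\<integral>\<omega>. iexp (wsum (ps @ wscale \<xi> qs) \<omega>) - c * iexp (wsum (wscale \<xi> qs) \<omega>) \<partial>M)"
        by (intro Bochner_Integration.integral_cong) (auto simp: left_diff_distrib distrib_left exp_add)
      also have "\<dots> = (\<integral>\<omega>. iexp (wsum (ps @ wscale \<xi> qs) \<omega>) \<partial>M) - (\<integral>\<omega>. c * iexp (wsum (wscale \<xi> qs) \<omega>) \<partial>M)"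
        using i[OF wsum_measurable[OF n(1)]] i[OF wsum_measurable[OF n(2)]]
        by (intro Bochner_Integration.integral_diff) auto
      also have "\<dots> = of_real (exp (- wvar (ps @ wscale \<xi> qs) / 2)) - c * of_real (exp (- wvar (wscale \<xi> qs) / 2))"
        by (simp only: integral_mult_right_zero expectation_iexp_wsum[OF n(1)] expectation_iexp_wsum[OF n(2)])
      also have "wvar (ps @ wscale \<xi> qs) = wvar ps + wvar (wscale \<xi> qs)"
        by (rule wvar_append_disjoint[OF ps n(2) past_future_disjoint])
      finally have e: "(\<integral>\<omega>. (iexp (wsum ps \<omega>) - c) * iexp (\<xi> * wsum qs \<omega>) \<partial>M)
        = of_real (exp (- (wvar ps + wvar (wscale \<xi> qs)) / 2)) - c * of_real (exp (- wvar (wscale \<xi> qs) / 2))" .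
      have "c = of_real (exp (- wvar ps / 2))"
        unfolding c_def by (rule expectation_iexp_wsum[OF ps])
      moreover have "exp (- (wvar ps + wvar (wscale \<xi> qs)) / 2) = exp (- wvar ps / 2) * exp (- wvar (wscale \<xi> qs) / 2)"
        unfolding exp_add[symmetric] by (simp add: add_divide_distrib)
      ultimately show "(\<integral>\<omega>. (iexp (wsum ps \<omega>) - c) * iexp (\<xi> * wsum qs \<omega>) \<partial>M) = 0"
        unfolding e by (simp only: of_real_mult) simp
    qed measurable
    then have *: "(\<integral>\<omega>. iexp (wsum ps \<omega>) * indicator B (wsum qs \<omega>) - c * indicator B (wsum qs \<omega>) \<partial>M) = 0"
      by (simp add: left_diff_distrib)
    have i1: "integrable M (\<lambda>\<omega>. iexp (wsum ps \<omega>) * indicator B (wsum qs \<omega>))"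
      by (intro integrable_const_bound[where B=1]) (auto simp: norm_mult indicator_def)
    have i2: "integrable M (\<lambda>\<omega>. indicator B (wsum qs \<omega>) :: complex)"
      by (intro integrable_const_bound[where B=1]) (auto simp: indicator_def)
    have P: "(\<integral>\<omega>. indicator B (wsum qs \<omega>) \<partial>M) = complex_of_real ?P"
    proof -
      have "(\<integral>\<omega>. indicator B (wsum qs \<omega>) \<partial>M) = (\<integral>\<omega>. complex_of_real (indicator {\<omega> \<in> space M. wsum qs \<omega> \<in> B} \<omega>) \<partial>M)"
        by (intro Bochner_Integration.integral_cong) (auto simp: indicator_def)
      then show ?thesis by (simp only: integral_complex_of_real) simp
    qed
    have "(\<integral>\<omega>. of_real (indicator B (wsum qs \<omega>) - ?P) * iexp (wsum ps \<omega>) \<partial>M)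
       = (\<integral>\<omega>. iexp (wsum ps \<omega>) * indicator B (wsum qs \<omega>) - of_real ?P * iexp (wsum ps \<omega>) \<partial>M)"
      by (intro Bochner_Integration.integral_cong) (auto simp: indicator_def algebra_simps)
    also have "\<dots> = (\<integral>\<omega>. iexp (wsum ps \<omega>) * indicator B (wsum qs \<omega>) \<partial>M) - (\<integral>\<omega>. of_real ?P * iexp (wsum ps \<omega>) \<partial>M)"
      using i1 i[of "wsum ps"] by (intro Bochner_Integration.integral_diff) auto
    also have "(\<integral>\<omega>. of_real ?P * iexp (wsum ps \<omega>) \<partial>M) = of_real ?P * c" by (simp add: c_def)
    also have "(\<integral>\<omega>. iexp (wsum ps \<omega>) * indicator B (wsum qs \<omega>) \<partial>M) = c * of_real ?P"
      using * i1 i2 by (subst (asm) Bochner_Integration.integral_diff) (auto simp: P)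
    finally show ?thesis by simp
  qed
  moreover have "\<bar>indicator B (wsum qs \<omega>) - ?P\<bar> \<le> 1 + ?P" for \<omega>
    by (auto simp: indicator_def)
  moreover have "(\<lambda>\<omega>. indicator B (wsum qs \<omega>) - ?P) \<in> borel_measurable M" by measurable
  ultimately show ?thesis unfolding orth_past_def by blast
qed

text \<open>A character of \<open>W A\<close> can be absorbed into the list \<open>ps\<close>,
  because \<open>A\<close> lies in the past; \<open>fourier_zero_imp_zero\<close> exchanges it for
  an indicator.\<close>

lemma orth_past_indicator:
  assumes V: "orth_past s V" and A: "noise_set A" "A \<subseteq> past s" and B: "B \<in> sets borel"
  shows "orth_past s (\<lambda>\<omega>. V \<omega> * indicator B (W A \<omega>))"
proof -
  note [measurable] = W_measurable[OF A(1)] B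
  have [measurable]: "V \<in> borel_measurable M" using V by (simp add: orth_past_def)
  obtain C where C: "\<And>\<omega>. \<bar>V \<omega>\<bar> \<le> C" using V by (auto simp: orth_past_def)
  have C0: "0 \<le> C" using order_trans[OF abs_ge_zero C] .
  have "(\<integral>\<omega>. of_real (V \<omega> * indicator B (W A \<omega>)) * iexp (wsum ps \<omega>) \<partial>M) = 0" if ps: "noise_list (past s) ps" for ps
  proof -
    have [measurable]: "wsum ps \<in> borel_measurable M" by (rule wsum_measurable[OF ps])
    have "(\<integral>\<omega>. (of_real (V \<omega>) * iexp (wsum ps \<omega>)) * indicator B (W A \<omega>) \<partial>M) = 0"
    proof (rule fourier_zero_imp_zero)
      show "cmod (of_real (V \<omega>) * iexp (wsum ps \<omega>)) \<le> C" for \<omega> using C by (simp add: norm_mult)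
      fix \<xi>
      have "(\<integral>\<omega>. of_real (V \<omega>) * iexp (wsum ps \<omega>) * iexp (\<xi> * W A \<omega>) \<partial>M) = (\<integral>\<omega>. of_real (V \<omega>) * iexp (wsum ((\<xi>, A) # ps) \<omega>) \<partial>M)"
        by (intro Bochner_Integration.integral_cong) (auto simp: distrib_left exp_add)
      also have "\<dots> = 0" using V A ps by (simp add: orth_past_def del: wsum_Cons)
      finally show "(\<integral>\<omega>. of_real (V \<omega>) * iexp (wsum ps \<omega>) * iexp (\<xi> * W A \<omega>) \<partial>M) = 0" .
    qed measurable
    moreover have "of_real (V \<omega> * indicator B (W A \<omega>)) * iexp (wsum ps \<omega>) = of_real (V \<omega>) * iexp (wsum ps \<omega>) * indicator B (W A \<omega>)" for \<omega>
      by (auto simp: indicator_def)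
    ultimately show ?thesis by (simp only:)
  qed
  moreover have "\<bar>V \<omega> * indicator B (W A \<omega>)\<bar> \<le> C" for \<omega>
    using C[of \<omega>] C0 by (auto simp: indicator_def)
  moreover have "(\<lambda>\<omega>. V \<omega> * indicator B (W A \<omega>)) \<in> borel_measurable M" by measurable
  ultimately show ?thesis unfolding orth_past_def by blast
qed

definition past_cylinder :: "((real \<times> real) set \<times> real set) list \<Rightarrow> 'w set" where
  "past_cylinder L = {\<omega> \<in> space M. \<forall>(A, B)\<in>set L. W A \<omega> \<in> B}"

definition past_list :: "real \<Rightarrow> ((real \<times> real) set \<times> real set) list \<Rightarrow> bool" where
  "past_list s L \<longleftrightarrow> (\<forall>(A, B)\<in>set L. noise_set A \<and> A \<subseteq> past s \<and> B \<in> sets borel)"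

lemma past_cylinder_measurable:
  assumes "past_list s L"
  shows "past_cylinder L \<in> events"
  using assms
proof (induction L)
  case (Cons q L)
  obtain A B where q: "q = (A, B)" by (cases q)
  then have [measurable]: "W A \<in> borel_measurable M" "B \<in> sets borel" "past_cylinder L \<in> events"
    using Cons by (auto simp: past_list_def W_measurable)
  have "past_cylinder (q # L) = (W A -` B \<inter> space M) \<inter> past_cylinder L"
    by (auto simp: past_cylinder_def q)
  then show ?case by simp
qed (simp add: past_cylinder_def)

lemma orth_past_cylinder:
  assumes "orth_past s V" "past_list s L"
  shows "orth_past s (\<lambda>\<omega>. V \<omega> * (\<Prod>(A, B)\<leftarrow>L. indicator B (W A \<omega>)))"
  using assms(2)
proof (induction L)
  case (Cons q L)
  obtain A B where q: "q = (A, B)" by (cases q)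
  have "orth_past s (\<lambda>\<omega>. V \<omega> * (\<Prod>(A, B)\<leftarrow>L. indicator B (W A \<omega>)) * indicator B (W A \<omega>))"
    using Cons by (intro orth_past_indicator) (auto simp: q past_list_def)
  then show ?case by (simp add: q mult_ac)
qed (use assms in simp)

lemma prod_indicator_cylinder:
  "\<omega> \<in> space M \<Longrightarrow> (\<Prod>(A, B)\<leftarrow>L. indicator B (W A \<omega>)) = (indicator (past_cylinder L) \<omega> :: real)"
  by (induction L) (auto simp: past_cylinder_def indicator_def)

lemma prob_past_future:
  assumes L: "past_list s L" and qs: "noise_list (future s) qs" and B: "B \<in> sets borel"
  shows "prob (past_cylinder L \<inter> (wsum qs -` B \<inter> space M)) = prob (past_cylinder L) * prob (wsum qs -` B \<inter> space M)"
proof -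
  note [measurable] = past_cylinder_measurable[OF L] wsum_measurable[OF qs] B
  let ?Y = "wsum qs -` B \<inter> space M" and ?C = "past_cylinder L"
  have Y: "?Y = {\<omega> \<in> space M. wsum qs \<omega> \<in> B}" by auto
  have [measurable]: "?Y \<in> events" by measurable
  let ?V = "\<lambda>\<omega>. (indicator B (wsum qs \<omega>) - prob ?Y) * (\<Prod>(A, B)\<leftarrow>L. indicator B (W A \<omega>))"
  have "orth_past s ?V"
    unfolding Y by (intro orth_past_cylinder[OF orth_past_future[OF qs B] L])
  \<comment> \<open>The empty list gives the constant character 1, so the mean of \<open>?V\<close>
    vanishes; written out, this is the product formula.\<close>
  then have "(\<integral>\<omega>. of_real (?V \<omega>) * iexp (wsum [] \<omega>) \<partial>M) = 0"
    unfolding orth_past_def by (elim conjE allE[of _ "[]"]) simp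
  then have "(\<integral>\<omega>. complex_of_real (?V \<omega>) \<partial>M) = 0" by simp
  then have "(\<integral>\<omega>. ?V \<omega> \<partial>M) = 0"
    by (simp only: integral_complex_of_real of_real_eq_0_iff)
  also have "(\<integral>\<omega>. ?V \<omega> \<partial>M) = (\<integral>\<omega>. indicator (?C \<inter> ?Y) \<omega> - prob ?Y * indicator ?C \<omega> \<partial>M)"
  proof (rule Bochner_Integration.integral_cong[OF refl])
    fix \<omega> assume "\<omega> \<in> space M"
    then show "?V \<omega> = indicator (?C \<inter> ?Y) \<omega> - prob ?Y * indicator ?C \<omega>"
      unfolding prod_indicator_cylinder[OF \<open>\<omega> \<in> space M\<close>] by (auto simp: indicator_def)
  qed
  also have "\<dots> = prob (?C \<inter> ?Y) - prob ?Y * prob ?C"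
    by (subst Bochner_Integration.integral_diff) (auto simp: integrable_real_indicator emeasure_eq_measure)
  finally show ?thesis by simp
qed

text \<open>Past cylinders together with the null sets are closed under intersection and generate a
  \<open>\<sigma>\<close>-algebra containing \<open>F0\<close>, so independence needs checking on
  them alone.\<close>

lemma indep_set_F0:
  assumes qs: "noise_list (future s) qs"
  shows "indep_set (F0 M W s) (sigma_sets (space M) {wsum qs -` B \<inter> space M | B. B \<in> sets borel})"
proof -
  let ?C = "{past_cylinder L | L. past_list s L} \<union> null_sets M"
  let ?Y = "{wsum qs -` B \<inter> space M | B. B \<in> sets (borel :: real measure)}"
  note [measurable] = wsum_measurable[OF qs]
  have Cev: "?C \<subseteq> events" using past_cylinder_measurable by auto
  have "indep_set ?C ?Y"
  proof (rule indep_setI[OF Cev])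
    show "?Y \<subseteq> events" by auto
    fix a b assume a: "a \<in> ?C" and b: "b \<in> ?Y"
    then obtain B where B: "b = wsum qs -` B \<inter> space M" "B \<in> sets borel" by auto
    show "prob (a \<inter> b) = prob a * prob b"
    proof (cases "a \<in> null_sets M")
      case True
      have "b \<in> events" using B by simp
      then have "a \<inter> b \<in> null_sets M" using True null_set_Int1 null_set_Int2 by blast
      then show ?thesis using True by (simp add: measure_def null_setsD1)
    next
      case False
      then obtain L where "a = past_cylinder L" "past_list s L" using a by auto
      then show ?thesis using prob_past_future[OF _ qs B(2)] B(1) by simp
    qed
  qed
  moreover have "Int_stable ?C"
  proof (rule Int_stableI)
    fix a b assume a: "a \<in> ?C" and b: "b \<in> ?C"
    show "a \<inter> b \<in> ?C"
    proof (cases "a \<in> null_sets M \<or> b \<in> null_sets M")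
      case True
      have ev: "a \<in> events" "b \<in> events" using a b Cev by blast+
      from True have "a \<inter> b \<in> null_sets M"
      proof
        assume "a \<in> null_sets M"
        then show ?thesis using ev(2) by (rule null_set_Int2)
      next
        assume "b \<in> null_sets M"
        then show ?thesis using ev(1) by (rule null_set_Int1)
      qed
      then show ?thesis by (rule UnI2)
    next
      case False
      then obtain L L' where L: "a = past_cylinder L" "past_list s L" "b = past_cylinder L'" "past_list s L'"
        using a b by blast
      have "a \<inter> b = past_cylinder (L @ L')" by (auto simp: L past_cylinder_def)
      moreover have "past_list s (L @ L')" using L by (auto simp: past_list_def)
      ultimately show ?thesis by blast
    qed
  qed
  moreover have "Int_stable ?Y"
  proof (rule Int_stableI)
    fix a b assume "a \<in> ?Y" "b \<in> ?Y"
    then obtain A B where "a = wsum qs -` A \<inter> space M" "b = wsum qs -` B \<inter> space M" "A \<in> sets borel" "B \<in> sets borel"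
      by auto
    then show "a \<inter> b \<in> ?Y" by (auto intro!: exI[of _ "A \<inter> B"])
  qed
  ultimately have "indep_set (sigma_sets (space M) ?C) (sigma_sets (space M) ?Y)"
    by (rule indep_set_sigma_sets)
  moreover have "F0 M W s \<subseteq> sigma_sets (space M) ?C"
    unfolding F0_def
  proof (rule sigma_sets_mono', safe)
    fix A B assume "noise_set A" "A \<subseteq> {0..s} \<times> UNIV" "B \<in> sets (borel :: real measure)"
      "W A -` B \<inter> space M \<notin> null_sets M"
    then show "\<exists>L. W A -` B \<inter> space M = past_cylinder L \<and> past_list s L"
      by (intro exI[of _ "[(A, B)]"]) (auto simp: past_cylinder_def past_list_def past_def)
  qed
  ultimately show ?thesis by (rule indep_set_mono[OF _ _ order_refl])
qed

lemma F0_events: "F0 M W s \<subseteq> events"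
  unfolding F0_def by (rule sets.sigma_sets_subset) (auto intro: measurable_sets W_measurable)

abbreviation Fm :: "real \<Rightarrow> 'w measure" where
  "Fm s \<equiv> sigma (space M) (F0 M W s)"

lemma sets_Fm: "sets (Fm s) = F0 M W s" and space_Fm: "space (Fm s) = space M"
proof -
  let ?G = "{W A -` B \<inter> space M | A B. noise_set A \<and> A \<subseteq> {0..s} \<times> UNIV \<and> B \<in> sets (borel :: real measure)}
      \<union> null_sets M"
  have P: "F0 M W s \<subseteq> Pow (space M)" using F0_events sets.sets_into_space by blast
  moreover have "?G \<subseteq> Pow (space M)" using sets.sets_into_space by blast
  then have "sigma_sets (space M) (F0 M W s) = F0 M W s"
    unfolding F0_def by (rule sigma_sets_sigma_sets_eq)
  ultimately show "sets (Fm s) = F0 M W s" by simp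
  show "space (Fm s) = space M" using P by simp
qed

lemma meas_wrt_F0: "meas_wrt M (F0 M W s) X \<longleftrightarrow> X \<in> borel_measurable (Fm s)"
  by (auto simp: meas_wrt_def measurable_def sets_Fm space_Fm)

lemma Fm_measurable: "X \<in> borel_measurable (Fm s) \<Longrightarrow> X \<in> borel_measurable M"
  using F0_events by (auto simp: measurable_def sets_Fm space_Fm)

lemma meas_wrt_filt: "meas_wrt M (filt M W s) X \<longleftrightarrow> (\<forall>r>s. X \<in> borel_measurable (Fm r))"
  by (auto simp: meas_wrt_F0[symmetric] meas_wrt_def filt_def)

lemma indep_var_future:
  assumes X: "X \<in> borel_measurable (Fm s)" and qs: "noise_list (future s) qs"
  shows "indep_var borel X borel (wsum qs)"
proof -
  have "sigma_sets (space M) {X -` A \<inter> space M | A. A \<in> sets borel} \<subseteq> F0 M W s"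
  proof -
    have "{X -` A \<inter> space (Fm s) | A. A \<in> sets borel} \<subseteq> sets (Fm s)"
      using X by (auto intro: measurable_sets)
    then have "sigma_sets (space (Fm s)) {X -` A \<inter> space (Fm s) | A. A \<in> sets borel} \<subseteq> sets (Fm s)"
      by (rule sets.sigma_sets_subset)
    then show ?thesis by (simp only: space_Fm sets_Fm)
  qed
  then have "indep_set (sigma_sets (space M) {X -` A \<inter> space M | A. A \<in> sets borel}) (sigma_sets (space M) {wsum qs -` B \<inter> space M | B. B \<in> sets borel})"
    by (rule indep_set_mono[OF indep_set_F0[OF qs] _ order_refl])
  then show ?thesis
    unfolding indep_var_eq by (intro conjI Fm_measurable[OF X] wsum_measurable[OF qs])
qed

lemma expectation_mult_future_strict:
  assumes X: "X \<in> borel_measurable (Fm s)" "integrable M X" and qs: "noise_list (future s) qs"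
  shows "(\<integral>\<omega>. X \<omega> * wsum qs \<omega> \<partial>M) = 0"
    and "(\<integral>\<omega>. X \<omega> * (wsum qs \<omega>)\<^sup>2 \<partial>M) = expectation X * wvar qs"
proof -
  note iv = indep_var_future[OF X(1) qs]
  show "(\<integral>\<omega>. X \<omega> * wsum qs \<omega> \<partial>M) = 0"
    using indep_var_lebesgue_integral[OF iv X(2) wsum_moments(1)[OF qs]] wsum_moments(3)[OF qs] by simp
  have "indep_var borel (id \<circ> X) borel ((\<lambda>x. x\<^sup>2) \<circ> wsum qs)"
    by (rule indep_var_compose[OF iv]) auto
  then have "indep_var borel X borel (\<lambda>\<omega>. (wsum qs \<omega>)\<^sup>2)" by (simp add: o_def)
  from indep_var_lebesgue_integral[OF this X(2) wsum_moments(2)[OF qs]]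
  show "(\<integral>\<omega>. X \<omega> * (wsum qs \<omega>)\<^sup>2 \<partial>M) = expectation X * wvar qs"
    using wsum_moments(4)[OF qs] by simp
qed

text \<open>Drops the noise up to time \<open>r\<close>. A variable measurable for
  \<open>filt\<close> at time \<open>s\<close> is measurable for \<open>Fm r\<close> with
  \<open>r > s\<close>, so \<open>expectation_mult_future_strict\<close> applies to the noise after
  \<open>r\<close>; then \<open>r\<close> decreases to \<open>s\<close>.\<close>

definition wtrunc :: "real \<Rightarrow> (real \<times> (real \<times> real) set) list \<Rightarrow> (real \<times> (real \<times> real) set) list" where
  "wtrunc r qs = map (\<lambda>(c, A). (c, A \<inter> future r)) qs"

lemma future_measurable: "future r \<in> sets borel"
  unfolding future_def by (simp add: borel_Times)

lemma noise_set_Int: "noise_set A \<Longrightarrow> B \<in> sets borel \<Longrightarrow> noise_set (A \<inter> B)"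
  using emeasure_mono[of "A \<inter> B" A "lborel :: (real \<times> real) measure"]
  by (auto simp: noise_set_def intro: le_less_trans)

lemma noise_list_wtrunc: "noise_list S qs \<Longrightarrow> noise_list (future r) (wtrunc r qs)"
proof (induction qs)
  case (Cons q qs)
  then show ?case by (cases q) (auto simp: wtrunc_def noise_set_Int future_measurable)
qed (simp add: wtrunc_def)

lemma wfun_wtrunc: "wfun (wtrunc r qs) p = wfun qs p * indicator (future r) p"
  by (induction qs) (auto simp: wtrunc_def indicator_def algebra_simps)

text \<open>What is cut off lives on the strip between \<open>s\<close> and
  \<open>s + 1 / (n + 1)\<close>. The strips shrink to the empty set because \<open>future s\<close>
  excludes the time \<open>s\<close> itself.\<close>

lemma wvar_wtrunc_tendsto:
  assumes "noise_list (future s) qs"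
  shows "(\<lambda>n. wvar (qs @ wscale (-1) (wtrunc (s + 1 / real (Suc n)) qs))) \<longlonglongrightarrow> 0"
proof -
  let ?r = "\<lambda>n. s + 1 / real (Suc n)"
  have [measurable]: "wfun qs \<in> borel_measurable lborel" "future r \<in> sets lborel" for r
    using wfun_measurable[OF assms] future_measurable by auto
  have "(\<lambda>n. \<integral>p. (wfun (qs @ wscale (-1) (wtrunc (?r n) qs)) p)\<^sup>2 \<partial>lborel) \<longlonglongrightarrow> (\<integral>p. 0 \<partial>(lborel :: (real \<times> real) measure))"
  proof (rule integral_dominated_convergence)
    show "integrable lborel (\<lambda>p. (wfun qs p)\<^sup>2)" by (rule integrable_wfun_square[OF assms])
    show "AE p in lborel. (\<lambda>n. (wfun (qs @ wscale (-1) (wtrunc (?r n) qs)) p)\<^sup>2) \<longlonglongrightarrow> 0"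
    proof (intro AE_I2)
      fix p :: "real \<times> real"
      show "(\<lambda>n. (wfun (qs @ wscale (-1) (wtrunc (?r n) qs)) p)\<^sup>2) \<longlonglongrightarrow> 0"
      proof (cases "p \<in> future s")
        case True
        have "?r \<longlonglongrightarrow> s + 0"
          using LIMSEQ_inverse_real_of_nat by (intro tendsto_intros) (simp add: inverse_eq_divide)
        then have "\<forall>\<^sub>F n in sequentially. ?r n < fst p"
          using True by (intro order_tendstoD) (auto simp: future_def)
        then have "\<forall>\<^sub>F n in sequentially. (wfun (qs @ wscale (-1) (wtrunc (?r n) qs)) p)\<^sup>2 = 0"
          by eventually_elim (auto simp: wfun_wtrunc future_def indicator_def mem_Times_iff)
        then show ?thesis by (rule tendsto_eventually)
      qed (use wfun_outside[OF assms] in \<open>simp add: wfun_wtrunc\<close>)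
    qed
    show "AE p in lborel. norm ((wfun (qs @ wscale (-1) (wtrunc (?r n) qs)) p)\<^sup>2) \<le> (wfun qs p)\<^sup>2" for n
      by (intro AE_I2) (auto simp: wfun_wtrunc indicator_def)
  qed (auto simp: wfun_wtrunc)
  then show ?thesis by (simp add: wvar_def)
qed

lemma expectation_mult_future:
  assumes X: "\<And>r. s < r \<Longrightarrow> X \<in> borel_measurable (Fm r)" "integrable M (\<lambda>\<omega>. (X \<omega>)\<^sup>2)"
    and qs: "noise_list (future s) qs"
  shows "(\<integral>\<omega>. X \<omega> * wsum qs \<omega> \<partial>M) = 0"
proof -
  have [measurable]: "X \<in> borel_measurable M" using Fm_measurable[OF X(1)[of "s + 1"]] by simp
  note [measurable] = wsum_measurable[OF qs]
  have iX: "integrable M X" using integrable_mult_square[OF _ _ X(2), of "\<lambda>_. 1"] by simp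
  let ?t = "\<lambda>n. wtrunc (s + 1 / real (Suc n)) qs"
  let ?d = "\<lambda>n. qs @ wscale (-1) (?t n)"
  have t: "noise_list (future (s + 1 / real (Suc n))) (?t n)" for n by (rule noise_list_wtrunc[OF qs])
  have d: "noise_list UNIV (?d n)" for n using qs t[of n] by (auto intro: noise_list_mono)
  \<comment> \<open>The truncated sum contributes 0; Cauchy-Schwarz bounds the remainder by the
    vanishing variance \<open>wvar (?d n)\<close>.\<close>
  have "(\<integral>\<omega>. X \<omega> * wsum qs \<omega> \<partial>M)\<^sup>2 \<le> (\<integral>\<omega>. (X \<omega>)\<^sup>2 \<partial>M) * wvar (?d n)" for n
  proof -
    note [measurable] = wsum_measurable[OF t[of n]] wsum_measurable[OF d[of n]]
    have i: "integrable M (\<lambda>\<omega>. X \<omega> * wsum (?d n) \<omega>)" "integrable M (\<lambda>\<omega>. X \<omega> * wsum (?t n) \<omega>)"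
      by (rule integrable_mult_square[OF \<open>X \<in> borel_measurable M\<close> _ X(2)], rule wsum_measurable[OF d], rule wsum_moments[OF d])
        (rule integrable_mult_square[OF \<open>X \<in> borel_measurable M\<close> _ X(2)], rule wsum_measurable[OF t], rule wsum_moments[OF t])
    have "(\<integral>\<omega>. X \<omega> * wsum qs \<omega> \<partial>M) = (\<integral>\<omega>. X \<omega> * wsum (?d n) \<omega> + X \<omega> * wsum (?t n) \<omega> \<partial>M)"
      by (intro Bochner_Integration.integral_cong) (auto simp: algebra_simps)
    also have "\<dots> = (\<integral>\<omega>. X \<omega> * wsum (?d n) \<omega> \<partial>M) + (\<integral>\<omega>. X \<omega> * wsum (?t n) \<omega> \<partial>M)"
      using i by (rule Bochner_Integration.integral_add)
    also have "(\<integral>\<omega>. X \<omega> * wsum (?t n) \<omega> \<partial>M) = 0"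
      by (rule expectation_mult_future_strict(1)[OF X(1) iX t]) simp
    finally have "(\<integral>\<omega>. X \<omega> * wsum qs \<omega> \<partial>M) = (\<integral>\<omega>. X \<omega> * wsum (?d n) \<omega> \<partial>M)" by simp
    then show ?thesis
      using Cauchy_Schwarz_integral[OF \<open>X \<in> borel_measurable M\<close> wsum_measurable[OF d[of n]] X(2) wsum_moments(2)[OF d[of n]]] wsum_moments(4)[OF d[of n]] by (simp del: wsum_append)
  qed
  moreover have "(\<lambda>n. (\<integral>\<omega>. (X \<omega>)\<^sup>2 \<partial>M) * wvar (?d n)) \<longlonglongrightarrow> (\<integral>\<omega>. (X \<omega>)\<^sup>2 \<partial>M) * 0"
    by (intro tendsto_mult_left wvar_wtrunc_tendsto[OF qs])
  ultimately have "(\<integral>\<omega>. X \<omega> * wsum qs \<omega> \<partial>M)\<^sup>2 \<le> (\<integral>\<omega>. (X \<omega>)\<^sup>2 \<partial>M) * 0"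
    by (intro LIMSEQ_le_const) auto
  then show ?thesis by simp
qed

text \<open>The square of the truncated sum is expanded around \<open>wsum qs\<close>.
  Cauchy-Schwarz controls the cross term and the bound on \<open>X\<close> the quadratic one, both
  through \<open>wvar (?d n)\<close>.\<close>

lemma expectation_mult_future_square:
  assumes X: "\<And>r. s < r \<Longrightarrow> X \<in> borel_measurable (Fm r)" and b: "\<And>\<omega>. \<omega> \<in> space M \<Longrightarrow> \<bar>X \<omega>\<bar> \<le> C"
    and qs: "noise_list (future s) qs"
  shows "(\<integral>\<omega>. X \<omega> * (wsum qs \<omega>)\<^sup>2 \<partial>M) = expectation X * wvar qs"
proof -
  let ?t = "\<lambda>n. wtrunc (s + 1 / real (Suc n)) qs"
  let ?d = "\<lambda>n. qs @ wscale (-1) (?t n)"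
  have t: "noise_list (future (s + 1 / real (Suc n))) (?t n)" for n by (rule noise_list_wtrunc[OF qs])
  have d: "noise_list UNIV (?d n)" for n using qs t[of n] by (auto intro: noise_list_mono)
  note [measurable] = wsum_measurable[OF qs] wsum_measurable[OF t] wsum_measurable[OF d]
  have lim: "(\<lambda>n. \<integral>\<omega>. X \<omega> * (wsum (?t n) \<omega>)\<^sup>2 \<partial>M) \<longlonglongrightarrow> (\<integral>\<omega>. X \<omega> * (wsum qs \<omega>)\<^sup>2 \<partial>M)"
    if [measurable]: "X \<in> borel_measurable M" and b: "\<And>\<omega>. \<omega> \<in> space M \<Longrightarrow> \<bar>X \<omega>\<bar> \<le> C" for X and C :: real
  proof -
    have iX: "integrable M (\<lambda>\<omega>. X \<omega> * Z \<omega>)" if "integrable M Z" for Z :: "'w \<Rightarrow> real"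
    proof (rule Bochner_Integration.integrable_bound)
      show "integrable M (\<lambda>\<omega>. C * Z \<omega>)" using that by simp
      show "AE \<omega> in M. norm (X \<omega> * Z \<omega>) \<le> norm (C * Z \<omega>)"
        using b by (intro AE_I2) (auto simp: abs_mult intro!: mult_right_mono order_trans[OF b abs_ge_self])
    qed (use that in auto)
    have XY: "(\<lambda>\<omega>. X \<omega> * wsum qs \<omega>) \<in> borel_measurable M" by measurable
    have sq: "integrable M (\<lambda>\<omega>. (X \<omega> * wsum qs \<omega>)\<^sup>2)"
    proof (rule Bochner_Integration.integrable_bound)
      show "integrable M (\<lambda>\<omega>. C\<^sup>2 * (wsum qs \<omega>)\<^sup>2)" using wsum_moments(2)[OF qs] by simp
      show "AE \<omega> in M. norm ((X \<omega> * wsum qs \<omega>)\<^sup>2) \<le> norm (C\<^sup>2 * (wsum qs \<omega>)\<^sup>2)"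
        using order_trans[OF b abs_ge_self]
        by (intro AE_I2) (auto simp: power_mult_distrib abs_le_square_iff[symmetric] intro!: mult_right_mono)
    qed simp
    have e: "(\<integral>\<omega>. X \<omega> * (wsum (?t n) \<omega>)\<^sup>2 \<partial>M) = (\<integral>\<omega>. X \<omega> * (wsum qs \<omega>)\<^sup>2 \<partial>M)
        - 2 * (\<integral>\<omega>. (X \<omega> * wsum qs \<omega>) * wsum (?d n) \<omega> \<partial>M) + (\<integral>\<omega>. X \<omega> * (wsum (?d n) \<omega>)\<^sup>2 \<partial>M)" for n
    proof -
      have i: "integrable M (\<lambda>\<omega>. X \<omega> * (wsum qs \<omega>)\<^sup>2)" "integrable M (\<lambda>\<omega>. (X \<omega> * wsum qs \<omega>) * wsum (?d n) \<omega>)"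
        "integrable M (\<lambda>\<omega>. X \<omega> * (wsum (?d n) \<omega>)\<^sup>2)"
        by (intro iX wsum_moments(2)[OF qs] wsum_moments(2)[OF d] integrable_mult_square sq; measurable)+
      have "(\<integral>\<omega>. X \<omega> * (wsum (?t n) \<omega>)\<^sup>2 \<partial>M) = (\<integral>\<omega>. X \<omega> * (wsum qs \<omega>)\<^sup>2 - 2 * ((X \<omega> * wsum qs \<omega>) * wsum (?d n) \<omega>) + X \<omega> * (wsum (?d n) \<omega>)\<^sup>2 \<partial>M)"
        by (intro Bochner_Integration.integral_cong refl) (simp add: power2_eq_square algebra_simps)
      then show ?thesis using i by (simp del: wsum_append)
    qed
    have c: "(\<lambda>n. \<integral>\<omega>. (X \<omega> * wsum qs \<omega>) * wsum (?d n) \<omega> \<partial>M) \<longlonglongrightarrow> 0"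
    proof (rule tendsto_zero_square_bound)
      show "(\<integral>\<omega>. (X \<omega> * wsum qs \<omega>) * wsum (?d n) \<omega> \<partial>M)\<^sup>2 \<le> (\<integral>\<omega>. (X \<omega> * wsum qs \<omega>)\<^sup>2 \<partial>M) * wvar (?d n)" for n
        using Cauchy_Schwarz_integral[OF XY wsum_measurable[OF d[of n]] sq wsum_moments(2)[OF d[of n]]] wsum_moments(4)[OF d[of n]] by (simp del: wsum_append)
      show "(\<lambda>n. (\<integral>\<omega>. (X \<omega> * wsum qs \<omega>)\<^sup>2 \<partial>M) * wvar (?d n)) \<longlonglongrightarrow> 0"
        by (rule tendsto_mult_right_zero[OF wvar_wtrunc_tendsto[OF qs]])
    qed
    have "(\<lambda>n. \<integral>\<omega>. X \<omega> * (wsum (?d n) \<omega>)\<^sup>2 \<partial>M) \<longlonglongrightarrow> 0"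
    proof (rule Lim_null_comparison)
      have "norm (\<integral>\<omega>. X \<omega> * (wsum (?d n) \<omega>)\<^sup>2 \<partial>M) \<le> C * wvar (?d n)" for n
      proof -
        have "norm (\<integral>\<omega>. X \<omega> * (wsum (?d n) \<omega>)\<^sup>2 \<partial>M) \<le> (\<integral>\<omega>. norm (X \<omega> * (wsum (?d n) \<omega>)\<^sup>2) \<partial>M)"
          by (rule integral_norm_bound)
        also have "\<dots> \<le> (\<integral>\<omega>. C * (wsum (?d n) \<omega>)\<^sup>2 \<partial>M)"
          by (rule integral_mono[OF integrable_norm[OF iX[OF wsum_moments(2)[OF d[of n]]]] integrable_mult_right[OF wsum_moments(2)[OF d[of n]]]])
            (use b in \<open>auto simp: abs_mult mult_right_mono simp del: wsum_append\<close>)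
        also have "\<dots> = C * wvar (?d n)" using wsum_moments(4)[OF d[of n]] by (simp del: wsum_append)
        finally show ?thesis .
      qed
      then show "\<forall>\<^sub>F n in sequentially. norm (\<integral>\<omega>. X \<omega> * (wsum (?d n) \<omega>)\<^sup>2 \<partial>M) \<le> C * wvar (?d n)" by simp
      show "(\<lambda>n. C * wvar (?d n)) \<longlonglongrightarrow> 0"
        by (rule tendsto_mult_right_zero[OF wvar_wtrunc_tendsto[OF qs]])
    qed
    then have "(\<lambda>n. (\<integral>\<omega>. X \<omega> * (wsum qs \<omega>)\<^sup>2 \<partial>M)
        - 2 * (\<integral>\<omega>. (X \<omega> * wsum qs \<omega>) * wsum (?d n) \<omega> \<partial>M) + (\<integral>\<omega>. X \<omega> * (wsum (?d n) \<omega>)\<^sup>2 \<partial>M))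
        \<longlonglongrightarrow> (\<integral>\<omega>. X \<omega> * (wsum qs \<omega>)\<^sup>2 \<partial>M) - 2 * 0 + 0"
      by (intro tendsto_intros c)
    then show ?thesis unfolding e by simp
  qed
  have Xm: "X \<in> borel_measurable M" using Fm_measurable[OF X[of "s + 1"]] by simp
  \<comment> \<open>The same limit with the constant 1 in place of \<open>X\<close> shows that the
    variances converge.\<close>
  have "(\<lambda>n. \<integral>\<omega>. 1 * (wsum (?t n) \<omega>)\<^sup>2 \<partial>M) \<longlonglongrightarrow> (\<integral>\<omega>. 1 * (wsum qs \<omega>)\<^sup>2 \<partial>M)"
    by (rule lim[of _ 1]) auto
  then have "(\<lambda>n. wvar (?t n)) \<longlonglongrightarrow> wvar qs"
    by (simp only: mult_1 wsum_moments(4)[OF qs] wsum_moments(4)[OF t])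
  then have r: "(\<lambda>n. expectation X * wvar (?t n)) \<longlonglongrightarrow> expectation X * wvar qs"
    by (rule tendsto_mult_left)
 have "integrable M X" using Xm b by (intro integrable_const_bound[where B=C]) auto
  then have eq: "(\<integral>\<omega>. X \<omega> * (wsum (?t n) \<omega>)\<^sup>2 \<partial>M) = expectation X * wvar (?t n)" for n
    by (intro expectation_mult_future_strict(2)[OF X _ t]) auto
  show ?thesis by (rule LIMSEQ_unique[OF lim[OF Xm b] r[folded eq]])
qed

end

section \<open>The Walsh isometry\<close>

lemma noise_set_rect:
  assumes "0 \<le> a" "A \<in> sets lborel" "emeasure lborel A < \<infinity>"
  shows "noise_set ({a<..b} \<times> A)"
proof -
  have 1: "{a<..b} \<times> A \<in> sets (borel :: (real \<times> real) measure)"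
    using assms by (intro borel_Times) auto
  have "emeasure (lborel \<Otimes>\<^sub>M lborel) ({a<..b} \<times> A) = emeasure lborel {a<..b} * emeasure lborel A"
    using assms by (intro lborel.emeasure_pair_measure_Times) auto
  also have "\<dots> < \<infinity>"
    using assms(3) by (cases "a \<le> b") (auto simp: ennreal_mult_less_top)
  finally have "emeasure (lborel :: (real \<times> real) measure) ({a<..b} \<times> A) < \<infinity>" by (simp add: lborel_prod)
  with 1 show ?thesis using assms by (auto simp: noise_set_def)
qed

context noise_space
begin

lemma W_Fm:
  assumes "noise_set A" "A \<subseteq> past s"
  shows "W A \<in> borel_measurable (Fm s)"
proof (rule measurableI)
  fix B assume "B \<in> sets (borel :: real measure)"
  then have "W A -` B \<inter> space M \<in> F0 M W s"
    unfolding F0_def using assms by (intro sigma_sets.Basic) (auto simp: past_def)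
  then show "W A -` B \<inter> space (Fm s) \<in> sets (Fm s)" by (simp only: sets_Fm space_Fm)
qed auto

lemma integrable_bounded_mult:
  fixes X Z :: "'w \<Rightarrow> real"
  assumes "X \<in> borel_measurable M" "\<And>\<omega>. \<omega> \<in> space M \<Longrightarrow> \<bar>X \<omega>\<bar> \<le> C" "integrable M Z"
  shows "integrable M (\<lambda>\<omega>. X \<omega> * Z \<omega>)"
proof (rule Bochner_Integration.integrable_bound)
  show "integrable M (\<lambda>\<omega>. C * Z \<omega>)" using assms(3) by simp
  show "AE \<omega> in M. norm (X \<omega> * Z \<omega>) \<le> norm (C * Z \<omega>)"
    using order_trans[OF assms(2) abs_ge_self] by (intro AE_I2) (auto simp: abs_mult intro!: mult_right_mono)
qed (use assms in auto)

text \<open>The increment over the earlier rectangle is split at the starting time of the later one.\<close>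

lemma covariance_ordered:
  assumes X: "meas_wrt M (filt M W a) X" "\<And>\<omega>. \<omega> \<in> space M \<Longrightarrow> \<bar>X \<omega>\<bar> \<le> C"
    and Y: "meas_wrt M (filt M W a') Y" "\<And>\<omega>. \<omega> \<in> space M \<Longrightarrow> \<bar>Y \<omega>\<bar> \<le> C'"
    and A: "A \<in> sets lborel" "emeasure lborel A < \<infinity>" and A': "A' \<in> sets lborel" "emeasure lborel A' < \<infinity>"
    and a: "0 \<le> a" "a \<le> a'"
  shows "(\<integral>\<omega>. (X \<omega> * W ({a<..b} \<times> A) \<omega>) * (Y \<omega> * W ({a'<..b'} \<times> A') \<omega>) \<partial>M)
     = (\<integral>\<omega>. X \<omega> * Y \<omega> \<partial>M) * measure lborel (({a<..b} \<times> A) \<inter> ({a'<..b'} \<times> A'))"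
proof -
  let ?R = "{a<..b} \<times> A" and ?R' = "{a'<..b'} \<times> A'"
  \<comment> \<open>\<open>?R1\<close> is the part of the earlier rectangle up to time
    \<open>a'\<close>, \<open>?R2\<close> the part after it; either may be empty.\<close>
  let ?R1 = "{a<..min b a'} \<times> A" and ?R2 = "{max a a'<..b} \<times> A"
  have n: "noise_set ?R" "noise_set ?R1" "noise_set ?R'" "noise_set ?R2"
    using A A' a by (auto intro!: noise_set_rect)
  have fut: "?R' \<subseteq> future a'" "?R2 \<subseteq> future a'" by (auto simp: future_def)
  note [measurable] = n[THEN W_measurable]
  have XF: "X \<in> borel_measurable (Fm r)" if "a' < r" for r using X(1) that a by (auto simp: meas_wrt_filt)
  have YF: "Y \<in> borel_measurable (Fm r)" if "a' < r" for r using Y(1) that a by (auto simp: meas_wrt_filt)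
  have [measurable]: "X \<in> borel_measurable M" "Y \<in> borel_measurable M"
    using Fm_measurable[OF XF[of "a' + 1"]] Fm_measurable[OF YF[of "a' + 1"]] by auto
  have WF: "W ?R1 \<in> borel_measurable (Fm r)" if "a' < r" for r
    using that a by (intro W_Fm n) (auto simp: past_def)
  have ZF: "(\<lambda>\<omega>. X \<omega> * Y \<omega>) \<in> borel_measurable (Fm r)" if "a' < r" for r
    using XF[OF that] YF[OF that] by measurable
  have Zb: "\<bar>X \<omega> * Y \<omega>\<bar> \<le> C * C'" if "\<omega> \<in> space M" for \<omega>
    using X(2)[OF that] Y(2)[OF that] unfolding abs_mult by (intro mult_mono) (auto intro: order_trans)
  have W2: "integrable M (\<lambda>\<omega>. (W B \<omega>)\<^sup>2)" if "noise_set B" for B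
    using wsum_moments(2)[of UNIV "[(1, B)]"] that by simp
  have WW: "integrable M (\<lambda>\<omega>. W B \<omega> * W B' \<omega>)" if "noise_set B" "noise_set B'" for B B'
    using that by (intro integrable_mult_square W2 W_measurable)
  have "AE \<omega> in M. wsum [(1, ?R)] \<omega> = wsum [(1, ?R1), (1, ?R2)] \<omega>"
  proof (rule wsum_AE_eq)
    show "noise_list UNIV [(1, ?R)]" "noise_list UNIV [(1, ?R1), (1, ?R2)]" using n by auto
    show "wfun [(1, ?R)] p = wfun [(1, ?R1), (1, ?R2)] p" for p
      using a by (cases p) (auto simp: indicator_def)
  qed
  then have add: "AE \<omega> in M. W ?R \<omega> = W ?R1 \<omega> + W ?R2 \<omega>" by simp
  have "(\<integral>\<omega>. (X \<omega> * W ?R \<omega>) * (Y \<omega> * W ?R' \<omega>) \<partial>M)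
      = (\<integral>\<omega>. (X \<omega> * Y \<omega>) * (W ?R1 \<omega> * W ?R' \<omega>) + (X \<omega> * Y \<omega>) * (W ?R2 \<omega> * W ?R' \<omega>) \<partial>M)"
    by (rule integral_cong_AE) (use add in \<open>auto simp: algebra_simps\<close>)
  also have "\<dots> = (\<integral>\<omega>. (X \<omega> * Y \<omega>) * (W ?R1 \<omega> * W ?R' \<omega>) \<partial>M) + (\<integral>\<omega>. (X \<omega> * Y \<omega>) * (W ?R2 \<omega> * W ?R' \<omega>) \<partial>M)"
    by (intro Bochner_Integration.integral_add integrable_bounded_mult[OF _ Zb] WW n) measurable
  \<comment> \<open>All factors except \<open>W ?R'\<close> are measurable just after time
    \<open>a'\<close>, and \<open>?R'\<close> lies in the future of \<open>a'\<close>.\<close>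
  also have "(\<integral>\<omega>. (X \<omega> * Y \<omega>) * (W ?R1 \<omega> * W ?R' \<omega>) \<partial>M) = 0"
  proof -
    have "(\<integral>\<omega>. (X \<omega> * Y \<omega> * W ?R1 \<omega>) * wsum [(1, ?R')] \<omega> \<partial>M) = 0"
    proof (rule expectation_mult_future)
      show "(\<lambda>\<omega>. X \<omega> * Y \<omega> * W ?R1 \<omega>) \<in> borel_measurable (Fm r)" if "a' < r" for r
        using ZF[OF that] WF[OF that] by measurable
      have Zsq: "\<bar>(X \<omega> * Y \<omega>)\<^sup>2\<bar> \<le> (C * C')\<^sup>2" if "\<omega> \<in> space M" for \<omega>
        using order_trans[OF Zb[OF that] abs_ge_self] unfolding abs_power2 by (simp only: abs_le_square_iff[symmetric])
      have "integrable M (\<lambda>\<omega>. (X \<omega> * Y \<omega>)\<^sup>2 * (W ?R1 \<omega>)\<^sup>2)"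
        by (intro integrable_bounded_mult[OF _ Zsq] W2 n) measurable
      then show "integrable M (\<lambda>\<omega>. (X \<omega> * Y \<omega> * W ?R1 \<omega>)\<^sup>2)" by (simp add: power_mult_distrib)
      show "noise_list (future a') [(1, ?R')]" using n fut by auto
    qed
    then show ?thesis by (simp add: mult_ac)
  qed
  also have "(\<integral>\<omega>. (X \<omega> * Y \<omega>) * (W ?R2 \<omega> * W ?R' \<omega>) \<partial>M) = (\<integral>\<omega>. X \<omega> * Y \<omega> \<partial>M) * measure lborel (?R \<inter> ?R')"
  proof -
    \<comment> \<open>Polarisation: the product of the two increments is a quarter of a difference
      of squares, to which \<open>expectation_mult_future_square\<close> applies.\<close>
    let ?p = "[(1, ?R2), (1, ?R')]" and ?m = "[(1, ?R2), (-1, ?R')]"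
    have nl: "noise_list (future a') ?p" "noise_list (future a') ?m" using n fut by auto
    have sq: "(\<integral>\<omega>. (X \<omega> * Y \<omega>) * (wsum qs \<omega>)\<^sup>2 \<partial>M) = (\<integral>\<omega>. X \<omega> * Y \<omega> \<partial>M) * wvar qs"
      if "noise_list (future a') qs" for qs
      by (rule expectation_mult_future_square[OF ZF Zb that])
    have "(\<integral>\<omega>. (X \<omega> * Y \<omega>) * (W ?R2 \<omega> * W ?R' \<omega>) \<partial>M)
       = (\<integral>\<omega>. ((X \<omega> * Y \<omega>) * (wsum ?p \<omega>)\<^sup>2 - (X \<omega> * Y \<omega>) * (wsum ?m \<omega>)\<^sup>2) / 4 \<partial>M)"
      by (intro Bochner_Integration.integral_cong refl) (simp add: power2_eq_square field_simps)
    also have "\<dots> = ((\<integral>\<omega>. (X \<omega> * Y \<omega>) * (wsum ?p \<omega>)\<^sup>2 \<partial>M) - (\<integral>\<omega>. (X \<omega> * Y \<omega>) * (wsum ?m \<omega>)\<^sup>2 \<partial>M)) / 4"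
    proof -
      have "integrable M (\<lambda>\<omega>. (X \<omega> * Y \<omega>) * (wsum qs \<omega>)\<^sup>2)" if "noise_list (future a') qs" for qs
        by (intro integrable_bounded_mult[OF _ Zb] wsum_moments(2)[OF that]) measurable
      then show ?thesis
        by (simp only: integral_divide_zero Bochner_Integration.integral_diff nl)
    qed
    also have "\<dots> = (\<integral>\<omega>. X \<omega> * Y \<omega> \<partial>M) * ((wvar ?p - wvar ?m) / 4)"
      unfolding sq[OF nl(1)] sq[OF nl(2)] by (simp only: right_diff_distrib times_divide_eq_right)
    also have "(wvar ?p - wvar ?m) / 4 = (\<integral>p. ((wfun ?p p)\<^sup>2 - (wfun ?m p)\<^sup>2) / 4 \<partial>lborel)"
      unfolding wvar_def using integrable_wfun_square[OF nl(1)] integrable_wfun_square[OF nl(2)] by simp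
    \<comment> \<open>As \<open>?R'\<close> starts at \<open>a'\<close>, it meets \<open>?R\<close>
      and \<open>?R2\<close> in the same set.\<close>
    also have "\<dots> = (\<integral>p. indicator (?R \<inter> ?R') p \<partial>lborel)"
      using a by (intro Bochner_Integration.integral_cong refl) (auto simp: indicator_def power2_eq_square)
    also have "\<dots> = measure lborel (?R \<inter> ?R')" by simp
    finally show ?thesis .
  qed
  finally show ?thesis by simp
qed

lemma covariance:
  assumes X: "meas_wrt M (filt M W a) X" "\<And>\<omega>. \<omega> \<in> space M \<Longrightarrow> \<bar>X \<omega>\<bar> \<le> C"
    and Y: "meas_wrt M (filt M W a') Y" "\<And>\<omega>. \<omega> \<in> space M \<Longrightarrow> \<bar>Y \<omega>\<bar> \<le> C'"
    and A: "A \<in> sets lborel" "emeasure lborel A < \<infinity>" and A': "A' \<in> sets lborel" "emeasure lborel A' < \<infinity>"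
    and a: "0 \<le> a" "0 \<le> a'"
  shows "(\<integral>\<omega>. (X \<omega> * W ({a<..b} \<times> A) \<omega>) * (Y \<omega> * W ({a'<..b'} \<times> A') \<omega>) \<partial>M)
     = (\<integral>\<omega>. X \<omega> * Y \<omega> \<partial>M) * measure lborel (({a<..b} \<times> A) \<inter> ({a'<..b'} \<times> A'))"
proof (cases "a \<le> a'")
  case True
  then show ?thesis using covariance_ordered[OF X Y A A' a(1)] by simp
next
  case False
  then show ?thesis
    using covariance_ordered[OF Y X A' A a(2), of b' b] by (simp add: mult_ac Int_commute)
qed

text \<open>By \<open>covariance\<close> both sides equal the same double sum over pairs of
  rectangles, with the matrix \<open>c i j\<close> of mixed moments. The rectangles may overlap, so
  no disjoint refinement is required.\<close>

lemma simple_isometry: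
  assumes "simple_proc M W ps"
  shows "sp_int W ps \<in> borel_measurable M"
    and "(\<lambda>(p, \<omega>). sp_eval ps (fst p) (snd p) \<omega>) \<in> borel_measurable (lborel \<Otimes>\<^sub>M M)"
    and "(\<integral>\<^sup>+\<omega>. ennreal ((sp_int W ps \<omega>)\<^sup>2) \<partial>M)
       = (\<integral>\<^sup>+p. \<integral>\<^sup>+\<omega>. ennreal ((sp_eval ps (fst p) (snd p) \<omega>)\<^sup>2) \<partial>M \<partial>lborel)"
proof -
  define n where "n = length ps"
  define X where "X i = fst (ps ! i)" for i
  define b where "b i = fst (snd (ps ! i))" for i
  define R where "R i = {fst (snd (ps ! i))<..fst (snd (snd (ps ! i)))} \<times> snd (snd (snd (ps ! i)))" for i
  have el: "0 \<le> fst (snd (ps ! i)) \<and> snd (snd (snd (ps ! i))) \<in> sets lborel \<and> emeasure lborel (snd (snd (snd (ps ! i)))) < \<infinity> \<and>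
     meas_wrt M (filt M W (fst (snd (ps ! i)))) (X i) \<and> (\<exists>C. \<forall>\<omega>\<in>space M. \<bar>X i \<omega>\<bar> \<le> C)" if "i < n" for i
    using assms nth_mem[of i ps] that by (auto simp: simple_proc_def n_def X_def split_beta)
  have nR: "noise_set (R i)" if "i < n" for i
    unfolding R_def using el[OF that] by (intro noise_set_rect) auto
  obtain C where C: "\<bar>X i \<omega>\<bar> \<le> C i" if "i < n" "\<omega> \<in> space M" for i \<omega>
  proof -
    have "\<forall>i. \<exists>C. i < n \<longrightarrow> (\<forall>\<omega>\<in>space M. \<bar>X i \<omega>\<bar> \<le> C)" using el by blast
    from choice[OF this] show thesis using that by blast
  qed
  have Xm: "X i \<in> borel_measurable M" if "i < n" for i
  proof -
    have "X i \<in> borel_measurable (Fm (fst (snd (ps ! i)) + 1))"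
      using el[OF that] by (simp add: meas_wrt_filt)
    then show ?thesis by (rule Fm_measurable)
  qed
  have int: "sp_int W ps = (\<lambda>\<omega>. \<Sum>i<n. X i \<omega> * W (R i) \<omega>)"
    by (rule ext) (simp add: sp_int_def sum_list_sum_nth atLeast0LessThan split_beta n_def X_def R_def)
  have eval: "sp_eval ps (fst p) (snd p) \<omega> = (\<Sum>i<n. X i \<omega> * indicator (R i) p)" for p \<omega>
    by (simp add: sp_eval_def sum_list_sum_nth atLeast0LessThan split_beta n_def X_def R_def)
  show "sp_int W ps \<in> borel_measurable M"
    unfolding int by (intro borel_measurable_sum borel_measurable_times Xm W_measurable nR) auto
  have Rm: "R i \<in> sets lborel" if "i < n" for i using nR[OF that] by (simp add: noise_set_def)
  show "(\<lambda>(p, \<omega>). sp_eval ps (fst p) (snd p) \<omega>) \<in> borel_measurable (lborel \<Otimes>\<^sub>M M)"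
    unfolding eval split_beta
  proof (intro borel_measurable_sum borel_measurable_times)
    fix i assume i: "i \<in> {..<n}"
    show "(\<lambda>q. X i (snd q)) \<in> borel_measurable (lborel \<Otimes>\<^sub>M M)" using Xm i by (intro measurable_compose[OF measurable_snd]) auto
    show "(\<lambda>q. indicator (R i) (fst q)) \<in> borel_measurable (lborel \<Otimes>\<^sub>M M)"
      using Rm i by (intro measurable_compose[OF measurable_fst] borel_measurable_indicator) auto
  qed
  define c where "c i j = (\<integral>\<omega>. X i \<omega> * X j \<omega> \<partial>M)" for i j
  have XX: "\<bar>X i \<omega> * X j \<omega>\<bar> \<le> C i * C j" if "i < n" "j < n" "\<omega> \<in> space M" for i j \<omega>
    using C[OF that(1,3)] C[OF that(2,3)] unfolding abs_mult by (intro mult_mono) (auto intro: order_trans)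
  have iXX: "integrable M (\<lambda>\<omega>. X i \<omega> * X j \<omega>)" if "i < n" "j < n" for i j
    using XX[OF that] Xm that by (intro integrable_const_bound[where B="C i * C j"]) auto
  have W2: "integrable M (\<lambda>\<omega>. (W B \<omega>)\<^sup>2)" if "noise_set B" for B
    using wsum_moments(2)[of UNIV "[(1, B)]"] that by simp
  have iW: "integrable M (\<lambda>\<omega>. (X i \<omega> * W (R i) \<omega>) * (X j \<omega> * W (R j) \<omega>))" if "i < n" "j < n" for i j
  proof -
    have "integrable M (\<lambda>\<omega>. (X i \<omega> * X j \<omega>) * (W (R i) \<omega> * W (R j) \<omega>))"
      using that Xm by (intro integrable_bounded_mult[OF _ XX[OF that]] integrable_mult_square W2 W_measurable nR borel_measurable_times) auto
    then show ?thesis by (simp add: mult_ac)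
  qed
  have cov: "(\<integral>\<omega>. (X i \<omega> * W (R i) \<omega>) * (X j \<omega> * W (R j) \<omega>) \<partial>M) = c i j * measure lborel (R i \<inter> R j)" if "i < n" "j < n" for i j
    unfolding R_def c_def using el[OF that(1)] el[OF that(2)] C[OF that(1)] C[OF that(2)]
    by (intro covariance[where C="C i" and C'="C j"]) auto
  have "(\<integral>\<^sup>+\<omega>. ennreal ((sp_int W ps \<omega>)\<^sup>2) \<partial>M) = (\<integral>\<^sup>+\<omega>. ennreal (\<Sum>i<n. \<Sum>j<n. (X i \<omega> * W (R i) \<omega>) * (X j \<omega> * W (R j) \<omega>)) \<partial>M)"
    by (simp only: int power2_eq_square sum_product)
  also have "\<dots> = ennreal (\<integral>\<omega>. (\<Sum>i<n. \<Sum>j<n. (X i \<omega> * W (R i) \<omega>) * (X j \<omega> * W (R j) \<omega>)) \<partial>M)"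
  proof (rule nn_integral_eq_integral)
    show "integrable M (\<lambda>\<omega>. \<Sum>i<n. \<Sum>j<n. (X i \<omega> * W (R i) \<omega>) * (X j \<omega> * W (R j) \<omega>))"
      by (intro Bochner_Integration.integrable_sum iW) auto
    show "AE \<omega> in M. 0 \<le> (\<Sum>i<n. \<Sum>j<n. (X i \<omega> * W (R i) \<omega>) * (X j \<omega> * W (R j) \<omega>))"
      by (simp add: sum_product[symmetric])
  qed
  also have "(\<integral>\<omega>. (\<Sum>i<n. \<Sum>j<n. (X i \<omega> * W (R i) \<omega>) * (X j \<omega> * W (R j) \<omega>)) \<partial>M)
      = (\<Sum>i<n. \<integral>\<omega>. (\<Sum>j<n. (X i \<omega> * W (R i) \<omega>) * (X j \<omega> * W (R j) \<omega>)) \<partial>M)"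
    by (rule Bochner_Integration.integral_sum) (auto intro!: Bochner_Integration.integrable_sum iW)
  also have "\<dots> = (\<Sum>i<n. \<Sum>j<n. c i j * measure lborel (R i \<inter> R j))"
  proof (rule sum.cong[OF refl])
    fix i assume i: "i \<in> {..<n}"
    have "(\<integral>\<omega>. (\<Sum>j<n. (X i \<omega> * W (R i) \<omega>) * (X j \<omega> * W (R j) \<omega>)) \<partial>M)
        = (\<Sum>j<n. \<integral>\<omega>. (X i \<omega> * W (R i) \<omega>) * (X j \<omega> * W (R j) \<omega>) \<partial>M)"
      using i by (intro Bochner_Integration.integral_sum iW) auto
    also have "\<dots> = (\<Sum>j<n. c i j * measure lborel (R i \<inter> R j))"
      using i by (intro sum.cong refl cov) auto
    finally show "(\<integral>\<omega>. (\<Sum>j<n. (X i \<omega> * W (R i) \<omega>) * (X j \<omega> * W (R j) \<omega>)) \<partial>M) = (\<Sum>j<n. c i j * measure lborel (R i \<inter> R j))" .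
  qed
  finally have L: "(\<integral>\<^sup>+\<omega>. ennreal ((sp_int W ps \<omega>)\<^sup>2) \<partial>M) = ennreal (\<Sum>i<n. \<Sum>j<n. c i j * measure lborel (R i \<inter> R j))" .
  define q where "q p = (\<Sum>i<n. \<Sum>j<n. c i j * indicator (R i \<inter> R j) p)" for p
  have inner: "(\<integral>\<^sup>+\<omega>. ennreal ((sp_eval ps (fst p) (snd p) \<omega>)\<^sup>2) \<partial>M) = ennreal (q p)" and q0: "0 \<le> q p" for p
  proof -
    have sq: "(sp_eval ps (fst p) (snd p) \<omega>)\<^sup>2 = (\<Sum>i<n. \<Sum>j<n. indicator (R i \<inter> R j) p * (X i \<omega> * X j \<omega>))" for \<omega>
      unfolding eval power2_eq_square sum_product by (intro sum.cong refl) (simp only: indicator_inter_arith mult_ac)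
    have i: "integrable M (\<lambda>\<omega>. \<Sum>j<n. indicator (R i \<inter> R j) p * (X i \<omega> * X j \<omega>))" if "i < n" for i
      using that by (intro Bochner_Integration.integrable_sum integrable_mult_right iXX) auto
    have "(\<integral>\<omega>. (sp_eval ps (fst p) (snd p) \<omega>)\<^sup>2 \<partial>M) = (\<Sum>i<n. \<integral>\<omega>. (\<Sum>j<n. indicator (R i \<inter> R j) p * (X i \<omega> * X j \<omega>)) \<partial>M)"
      unfolding sq using i by (intro Bochner_Integration.integral_sum) auto
    also have "\<dots> = q p"
      unfolding q_def
    proof (rule sum.cong[OF refl])
      fix i assume i: "i \<in> {..<n}"
      have "(\<integral>\<omega>. (\<Sum>j<n. indicator (R i \<inter> R j) p * (X i \<omega> * X j \<omega>)) \<partial>M) = (\<Sum>j<n. \<integral>\<omega>. indicator (R i \<inter> R j) p * (X i \<omega> * X j \<omega>) \<partial>M)"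
        using i by (intro Bochner_Integration.integral_sum integrable_mult_right iXX) auto
      then show "(\<integral>\<omega>. (\<Sum>j<n. indicator (R i \<inter> R j) p * (X i \<omega> * X j \<omega>)) \<partial>M) = (\<Sum>j<n. c i j * indicator (R i \<inter> R j) p)"
        by (simp only: integral_mult_right_zero) (simp only: c_def mult.commute)
    qed
    finally have e: "(\<integral>\<omega>. (sp_eval ps (fst p) (snd p) \<omega>)\<^sup>2 \<partial>M) = q p" .
    have isq: "integrable M (\<lambda>\<omega>. (sp_eval ps (fst p) (snd p) \<omega>)\<^sup>2)"
      unfolding sq by (rule Bochner_Integration.integrable_sum, rule i) simp
    then show "(\<integral>\<^sup>+\<omega>. ennreal ((sp_eval ps (fst p) (snd p) \<omega>)\<^sup>2) \<partial>M) = ennreal (q p)"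
      unfolding e[symmetric] by (intro nn_integral_eq_integral) auto
    show "0 \<le> q p" unfolding e[symmetric] by simp
  qed
  have iR: "integrable lborel (indicator (R i \<inter> R j) :: real \<times> real \<Rightarrow> real)" if "i < n" "j < n" for i j
    using noise_set_Int[OF nR[OF that(1)], of "R j"] Rm[OF that(2)]
    by (intro integrable_real_indicator) (auto simp: noise_set_def)
  have "(\<integral>\<^sup>+p. \<integral>\<^sup>+\<omega>. ennreal ((sp_eval ps (fst p) (snd p) \<omega>)\<^sup>2) \<partial>M \<partial>lborel) = ennreal (\<integral>p. q p \<partial>lborel)"
    unfolding inner
  proof (rule nn_integral_eq_integral)
    show "integrable lborel q"
      unfolding q_def[abs_def] by (intro Bochner_Integration.integrable_sum integrable_mult_right iR) simp_all
  qed (use q0 in simp)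
  also have "(\<integral>p. q p \<partial>lborel) = (\<Sum>i<n. \<integral>p. (\<Sum>j<n. c i j * indicator (R i \<inter> R j) p) \<partial>lborel)"
    unfolding q_def
    by (rule Bochner_Integration.integral_sum)
      (intro Bochner_Integration.integrable_sum integrable_mult_right iR, simp_all)
  also have "\<dots> = (\<Sum>i<n. \<Sum>j<n. c i j * measure lborel (R i \<inter> R j))"
  proof (rule sum.cong[OF refl])
    fix i assume i: "i \<in> {..<n}"
    have "(\<integral>p. (\<Sum>j<n. c i j * indicator (R i \<inter> R j) p) \<partial>lborel) = (\<Sum>j<n. \<integral>p. c i j * indicator (R i \<inter> R j) p \<partial>lborel)"
      using i by (intro Bochner_Integration.integral_sum integrable_mult_right iR) auto
    then show "(\<integral>p. (\<Sum>j<n. c i j * indicator (R i \<inter> R j) p) \<partial>lborel) = (\<Sum>j<n. c i j * measure lborel (R i \<inter> R j))"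
      by (simp only: integral_mult_right_zero) simp
  qed
  finally show "(\<integral>\<^sup>+\<omega>. ennreal ((sp_int W ps \<omega>)\<^sup>2) \<partial>M)
       = (\<integral>\<^sup>+p. \<integral>\<^sup>+\<omega>. ennreal ((sp_eval ps (fst p) (snd p) \<omega>)\<^sup>2) \<partial>M \<partial>lborel)"
    unfolding L ..
qed

end

section \<open>From simple processes to the Walsh integral\<close>

lemma ennreal_le_of_le_scaled:
  fixes x y :: ennreal
  assumes "\<And>\<epsilon>::real. 0 < \<epsilon> \<Longrightarrow> x \<le> ennreal ((1 + \<epsilon>)\<^sup>2) * y"
  shows "x \<le> y"
proof (cases y)
  case (real r)
  have le: "x \<le> ennreal ((1 + 1 / real (Suc n))\<^sup>2 * r)" for n
    using assms[of "1 / real (Suc n)"] real by (simp add: ennreal_mult)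
  have "(\<lambda>n. (1 + 1 / real (Suc n))\<^sup>2 * r) \<longlonglongrightarrow> (1 + 0)\<^sup>2 * r"
    using LIMSEQ_inverse_real_of_nat by (intro tendsto_intros) (simp add: inverse_eq_divide)
  then have "(\<lambda>n. ennreal ((1 + 1 / real (Suc n))\<^sup>2 * r)) \<longlonglongrightarrow> ennreal r"
    by (intro tendsto_ennrealI) simp
  then have "x \<le> ennreal r" using le by (intro LIMSEQ_le_const[of _ "ennreal r"] exI[of _ 0] allI impI)
  then show ?thesis using real by simp
qed simp

text \<open>Weighted Young inequality. It holds for extended integrals without any finiteness, so
  \<open>L2\<close> norms can be compared before they are known to be finite.\<close>

lemma nn_integral_square_perturb:
  fixes u v :: "'a \<Rightarrow> real"
  assumes [measurable]: "u \<in> borel_measurable M" "v \<in> borel_measurable M" and \<epsilon>: "0 < \<epsilon>"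
  shows "(\<integral>\<^sup>+x. ennreal ((u x)\<^sup>2) \<partial>M)
    \<le> ennreal (1 + \<epsilon>) * (\<integral>\<^sup>+x. ennreal ((v x)\<^sup>2) \<partial>M) + ennreal (1 + 1 / \<epsilon>) * (\<integral>\<^sup>+x. ennreal ((v x - u x)\<^sup>2) \<partial>M)"
proof -
  have "(u x)\<^sup>2 \<le> (1 + \<epsilon>) * (v x)\<^sup>2 + (1 + 1 / \<epsilon>) * (v x - u x)\<^sup>2" for x
  proof -
    have "0 \<le> (\<epsilon> * v x + (v x - u x))\<^sup>2 / \<epsilon>" using \<epsilon> by simp
    also have "\<dots> = (1 + \<epsilon>) * (v x)\<^sup>2 + (1 + 1 / \<epsilon>) * (v x - u x)\<^sup>2 - (u x)\<^sup>2"
      using \<epsilon> by (simp add: power2_eq_square field_simps)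
    finally show ?thesis by simp
  qed
  then have "ennreal ((u x)\<^sup>2) \<le> ennreal (1 + \<epsilon>) * ennreal ((v x)\<^sup>2) + ennreal (1 + 1 / \<epsilon>) * ennreal ((v x - u x)\<^sup>2)" for x
    using \<epsilon> by (auto simp flip: ennreal_mult ennreal_plus intro!: ennreal_leI)
  then have "(\<integral>\<^sup>+x. ennreal ((u x)\<^sup>2) \<partial>M)
    \<le> (\<integral>\<^sup>+x. ennreal (1 + \<epsilon>) * ennreal ((v x)\<^sup>2) + ennreal (1 + 1 / \<epsilon>) * ennreal ((v x - u x)\<^sup>2) \<partial>M)"
    by (rule nn_integral_mono)
  then show ?thesis by (simp add: nn_integral_add nn_integral_cmult)
qed

text \<open>The hypotheses are symmetric in the two sides, so this one inequality, applied in both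
  directions, gives equality of the limiting norms.\<close>

lemma L2_limits_le:
  fixes f :: "nat \<Rightarrow> 'a \<Rightarrow> real" and g :: "nat \<Rightarrow> 'b \<Rightarrow> real"
  assumes m: "\<And>n. f n \<in> borel_measurable M" "F \<in> borel_measurable M" "\<And>n. g n \<in> borel_measurable N" "H \<in> borel_measurable N"
    and f: "(\<lambda>n. \<integral>\<^sup>+x. ennreal ((f n x - F x)\<^sup>2) \<partial>M) \<longlonglongrightarrow> 0"
    and g: "(\<lambda>n. \<integral>\<^sup>+x. ennreal ((g n x - H x)\<^sup>2) \<partial>N) \<longlonglongrightarrow> 0"
    and eq: "\<And>n. (\<integral>\<^sup>+x. ennreal ((f n x)\<^sup>2) \<partial>M) = (\<integral>\<^sup>+x. ennreal ((g n x)\<^sup>2) \<partial>N)"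
  shows "(\<integral>\<^sup>+x. ennreal ((F x)\<^sup>2) \<partial>M) \<le> (\<integral>\<^sup>+x. ennreal ((H x)\<^sup>2) \<partial>N)"
proof (rule ennreal_le_of_le_scaled)
  fix \<epsilon> :: real assume \<epsilon>: "0 < \<epsilon>"
  let ?k = "ennreal (1 + \<epsilon>)" and ?l = "ennreal (1 + 1 / \<epsilon>)"
  let ?e = "\<lambda>n. \<integral>\<^sup>+x. ennreal ((f n x - F x)\<^sup>2) \<partial>M" and ?d = "\<lambda>n. \<integral>\<^sup>+x. ennreal ((g n x - H x)\<^sup>2) \<partial>N"
  have "(\<integral>\<^sup>+x. ennreal ((F x)\<^sup>2) \<partial>M) \<le> ?k * (?k * (\<integral>\<^sup>+x. ennreal ((H x)\<^sup>2) \<partial>N) + ?l * ?d n) + ?l * ?e n" for n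
  proof -
    have "(\<integral>\<^sup>+x. ennreal ((F x)\<^sup>2) \<partial>M) \<le> ?k * (\<integral>\<^sup>+x. ennreal ((f n x)\<^sup>2) \<partial>M) + ?l * ?e n"
      by (rule nn_integral_square_perturb) (use m \<epsilon> in auto)
    also have "(\<integral>\<^sup>+x. ennreal ((f n x)\<^sup>2) \<partial>M) \<le> ?k * (\<integral>\<^sup>+x. ennreal ((H x)\<^sup>2) \<partial>N) + ?l * (\<integral>\<^sup>+x. ennreal ((H x - g n x)\<^sup>2) \<partial>N)"
      unfolding eq by (rule nn_integral_square_perturb) (use m \<epsilon> in auto)
    finally show ?thesis by (simp add: power2_commute[of "H _"] mult_left_mono add_right_mono)
  qed
  moreover have "(\<lambda>n. ?k * (?k * (\<integral>\<^sup>+x. ennreal ((H x)\<^sup>2) \<partial>N) + ?l * ?d n) + ?l * ?e n)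
    \<longlonglongrightarrow> ?k * (?k * (\<integral>\<^sup>+x. ennreal ((H x)\<^sup>2) \<partial>N) + ?l * 0) + ?l * 0"
    by (intro tendsto_add tendsto_const ennreal_tendsto_cmult f g) auto
  ultimately have "(\<integral>\<^sup>+x. ennreal ((F x)\<^sup>2) \<partial>M) \<le> ?k * (?k * (\<integral>\<^sup>+x. ennreal ((H x)\<^sup>2) \<partial>N) + ?l * 0) + ?l * 0"
    by (intro LIMSEQ_le_const) auto
  then show "(\<integral>\<^sup>+x. ennreal ((F x)\<^sup>2) \<partial>M) \<le> ennreal ((1 + \<epsilon>)\<^sup>2) * (\<integral>\<^sup>+x. ennreal ((H x)\<^sup>2) \<partial>N)"
    using \<epsilon> by (simp add: power2_eq_square ennreal_mult mult.assoc)
qed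

context noise_space
begin

lemma walsh_isometry:
  assumes wI: "walsh_integral M W f I"
    and f: "(\<lambda>(p, \<omega>). f (fst p) (snd p) \<omega>) \<in> borel_measurable (lborel \<Otimes>\<^sub>M M)"
  shows "(\<integral>\<^sup>+\<omega>. ennreal ((I \<omega>)\<^sup>2) \<partial>M) = (\<integral>\<^sup>+q. ennreal ((f (fst (fst q)) (snd (fst q)) (snd q))\<^sup>2) \<partial>(lborel \<Otimes>\<^sub>M M))"
proof -
  obtain pss where I: "I \<in> borel_measurable M" and s: "\<And>n. simple_proc M W (pss n)"
    and e: "(\<lambda>n. \<integral>\<^sup>+ p. \<integral>\<^sup>+ \<omega>. ennreal ((sp_eval (pss n) (fst p) (snd p) \<omega> - f (fst p) (snd p) \<omega>)\<^sup>2) \<partial>M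
              \<partial>(lborel :: (real \<times> real) measure)) \<longlonglongrightarrow> 0"
    and i: "(\<lambda>n. \<integral>\<^sup>+ \<omega>. ennreal ((sp_int W (pss n) \<omega> - I \<omega>)\<^sup>2) \<partial>M) \<longlonglongrightarrow> 0"
    using wI unfolding walsh_integral_def by blast
  let ?N = "(lborel :: (real \<times> real) measure) \<Otimes>\<^sub>M M"
  let ?f = "\<lambda>q. f (fst (fst q)) (snd (fst q)) (snd q)"
  let ?g = "\<lambda>n q. sp_eval (pss n) (fst (fst q)) (snd (fst q)) (snd q)"
  have fm: "?f \<in> borel_measurable ?N" using f by (simp add: split_beta)
  have gm: "?g n \<in> borel_measurable ?N" for n using simple_isometry(2)[OF s] by (simp add: split_beta)
  \<comment> \<open>Joint measurability turns the iterated integral of the definition into one over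
    the product, where \<open>L2_limits_le\<close> applies.\<close>
  have e': "(\<lambda>n. \<integral>\<^sup>+q. ennreal ((?g n q - ?f q)\<^sup>2) \<partial>?N) \<longlonglongrightarrow> 0"
    using e nn_integral_fst[of "\<lambda>q. ennreal ((?g n q - ?f q)\<^sup>2)" lborel for n] fm gm by simp
  have eq: "(\<integral>\<^sup>+\<omega>. ennreal ((sp_int W (pss n) \<omega>)\<^sup>2) \<partial>M) = (\<integral>\<^sup>+q. ennreal ((?g n q)\<^sup>2) \<partial>?N)" for n
    using simple_isometry(3)[OF s] nn_integral_fst[of "\<lambda>q. ennreal ((?g n q)\<^sup>2)" lborel] gm by simp
  show ?thesis
    by (intro antisym L2_limits_le[OF simple_isometry(1)[OF s] I gm fm i e' eq]
        L2_limits_le[OF gm fm simple_isometry(1)[OF s] I e' i eq[symmetric]])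
qed

lemma sp_int_append: "sp_int W (ps @ qs) \<omega> = sp_int W ps \<omega> + sp_int W qs \<omega>"
  by (simp add: sp_int_def)

lemma sp_eval_append: "sp_eval (ps @ qs) s y \<omega> = sp_eval ps s y \<omega> + sp_eval qs s y \<omega>"
  by (simp add: sp_eval_def)

definition sp_scale :: "real \<Rightarrow> (('w \<Rightarrow> real) \<times> real \<times> real \<times> real set) list \<Rightarrow> (('w \<Rightarrow> real) \<times> real \<times> real \<times> real set) list" where
  "sp_scale c ps = map (\<lambda>(X, a, b, A). (\<lambda>\<omega>. c * X \<omega>, a, b, A)) ps"

lemma sp_int_scale: "sp_int W (sp_scale c ps) \<omega> = c * sp_int W ps \<omega>"
  by (induction ps) (auto simp: sp_int_def sp_scale_def algebra_simps)

lemma sp_eval_scale: "sp_eval (sp_scale c ps) s y \<omega> = c * sp_eval ps s y \<omega>"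
  by (induction ps) (auto simp: sp_eval_def sp_scale_def algebra_simps)

lemma simple_proc_scale:
  assumes "simple_proc M W ps"
  shows "simple_proc M W (sp_scale c ps)"
proof -
  have "meas_wrt M (filt M W a) (\<lambda>\<omega>. c * X \<omega>)" if "meas_wrt M (filt M W a) X" for a X
    using that unfolding meas_wrt_filt by auto
  moreover have "\<exists>C. \<forall>\<omega>\<in>space M. \<bar>c * X \<omega>\<bar> \<le> C" if b: "\<exists>C. \<forall>\<omega>\<in>space M. \<bar>X \<omega>\<bar> \<le> C" for X
  proof -
    obtain C where "\<forall>\<omega>\<in>space M. \<bar>X \<omega>\<bar> \<le> C" using b by blast
    then show ?thesis by (intro exI[of _ "\<bar>c\<bar> * C"]) (auto simp: abs_mult intro!: mult_left_mono)
  qed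
  ultimately show ?thesis
    using assms unfolding simple_proc_def sp_scale_def by fastforce
qed

lemma nn_integral_square_add_le:
  fixes u v :: "'a \<Rightarrow> real"
  assumes [measurable]: "u \<in> borel_measurable N" "v \<in> borel_measurable N"
  shows "(\<integral>\<^sup>+x. ennreal ((u x + c * v x)\<^sup>2) \<partial>N)
    \<le> 2 * (\<integral>\<^sup>+x. ennreal ((u x)\<^sup>2) \<partial>N) + ennreal (2 * c\<^sup>2) * (\<integral>\<^sup>+x. ennreal ((v x)\<^sup>2) \<partial>N)"
proof -
  have "(u x + c * v x)\<^sup>2 \<le> 2 * (u x)\<^sup>2 + 2 * c\<^sup>2 * (v x)\<^sup>2" for x
    using zero_le_power2[of "u x - c * v x"] by (simp add: power2_eq_square algebra_simps)
  then have "ennreal ((u x + c * v x)\<^sup>2) \<le> ennreal 2 * ennreal ((u x)\<^sup>2) + ennreal (2 * c\<^sup>2) * ennreal ((v x)\<^sup>2)" for x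
    by (subst ennreal_mult[symmetric], simp, simp)+ (subst ennreal_plus[symmetric], simp, simp, rule ennreal_leI)
  then have "(\<integral>\<^sup>+x. ennreal ((u x + c * v x)\<^sup>2) \<partial>N)
    \<le> (\<integral>\<^sup>+x. ennreal 2 * ennreal ((u x)\<^sup>2) + ennreal (2 * c\<^sup>2) * ennreal ((v x)\<^sup>2) \<partial>N)"
    by (rule nn_integral_mono)
  then show ?thesis by (simp add: nn_integral_add nn_integral_cmult)
qed

text \<open>Concatenating the approximating lists adds integrands and integrals alike. Linearity
  serves to polarise the isometry.\<close>

lemma walsh_integral_linear:
  assumes wI: "walsh_integral M W f I" and wJ: "walsh_integral M W g J"
    and f: "(\<lambda>(p, \<omega>). f (fst p) (snd p) \<omega>) \<in> borel_measurable (lborel \<Otimes>\<^sub>M M)"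
    and g: "(\<lambda>(p, \<omega>). g (fst p) (snd p) \<omega>) \<in> borel_measurable (lborel \<Otimes>\<^sub>M M)"
  shows "walsh_integral M W (\<lambda>s y \<omega>. f s y \<omega> + c * g s y \<omega>) (\<lambda>\<omega>. I \<omega> + c * J \<omega>)"
proof -
  obtain pss where I[measurable]: "I \<in> borel_measurable M" and s: "\<And>n. simple_proc M W (pss n)"
    and e: "(\<lambda>n. \<integral>\<^sup>+ p. \<integral>\<^sup>+ \<omega>. ennreal ((sp_eval (pss n) (fst p) (snd p) \<omega> - f (fst p) (snd p) \<omega>)\<^sup>2) \<partial>M
              \<partial>(lborel :: (real \<times> real) measure)) \<longlonglongrightarrow> 0"
    and i: "(\<lambda>n. \<integral>\<^sup>+ \<omega>. ennreal ((sp_int W (pss n) \<omega> - I \<omega>)\<^sup>2) \<partial>M) \<longlonglongrightarrow> 0"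
    using wI unfolding walsh_integral_def by blast
  obtain qss where J[measurable]: "J \<in> borel_measurable M" and s': "\<And>n. simple_proc M W (qss n)"
    and e': "(\<lambda>n. \<integral>\<^sup>+ p. \<integral>\<^sup>+ \<omega>. ennreal ((sp_eval (qss n) (fst p) (snd p) \<omega> - g (fst p) (snd p) \<omega>)\<^sup>2) \<partial>M
              \<partial>(lborel :: (real \<times> real) measure)) \<longlonglongrightarrow> 0"
    and i': "(\<lambda>n. \<integral>\<^sup>+ \<omega>. ennreal ((sp_int W (qss n) \<omega> - J \<omega>)\<^sup>2) \<partial>M) \<longlonglongrightarrow> 0"
    using wJ unfolding walsh_integral_def by blast
  let ?N = "(lborel :: (real \<times> real) measure) \<Otimes>\<^sub>M M"
  let ?f = "\<lambda>q. f (fst (fst q)) (snd (fst q)) (snd q)" and ?g = "\<lambda>q. g (fst (fst q)) (snd (fst q)) (snd q)"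
  let ?e = "\<lambda>n q. sp_eval (pss n) (fst (fst q)) (snd (fst q)) (snd q)"
  let ?e' = "\<lambda>n q. sp_eval (qss n) (fst (fst q)) (snd (fst q)) (snd q)"
  let ?r = "\<lambda>n. pss n @ sp_scale c (qss n)"
  have m: "?f \<in> borel_measurable ?N" "?g \<in> borel_measurable ?N" "?e n \<in> borel_measurable ?N" "?e' n \<in> borel_measurable ?N" for n
    using f g simple_isometry(2)[OF s] simple_isometry(2)[OF s'] by (simp_all add: split_beta)
  note [measurable] = m simple_isometry(1)[OF s] simple_isometry(1)[OF s']
  have E: "(\<lambda>n. \<integral>\<^sup>+q. ennreal ((?e n q - ?f q)\<^sup>2) \<partial>?N) \<longlonglongrightarrow> 0"
    using e nn_integral_fst[of "\<lambda>q. ennreal ((?e n q - ?f q)\<^sup>2)" lborel for n] by simp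
  have E': "(\<lambda>n. \<integral>\<^sup>+q. ennreal ((?e' n q - ?g q)\<^sup>2) \<partial>?N) \<longlonglongrightarrow> 0"
    using e' nn_integral_fst[of "\<lambda>q. ennreal ((?e' n q - ?g q)\<^sup>2)" lborel for n] by simp
  have lim: "(\<lambda>n. 2 * x n + ennreal (2 * c\<^sup>2) * y n) \<longlonglongrightarrow> 0" if "x \<longlonglongrightarrow> 0" "y \<longlonglongrightarrow> 0" for x y :: "nat \<Rightarrow> ennreal"
  proof -
    have "(\<lambda>n. 2 * x n + ennreal (2 * c\<^sup>2) * y n) \<longlonglongrightarrow> 2 * 0 + ennreal (2 * c\<^sup>2) * 0"
      by (intro tendsto_add ennreal_tendsto_cmult that) auto
    then show ?thesis by simp
  qed
  have le1: "(\<integral>\<^sup>+ p. \<integral>\<^sup>+ \<omega>. ennreal ((sp_eval (?r n) (fst p) (snd p) \<omega> - (f (fst p) (snd p) \<omega> + c * g (fst p) (snd p) \<omega>))\<^sup>2) \<partial>M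
        \<partial>(lborel :: (real \<times> real) measure))
      \<le> 2 * (\<integral>\<^sup>+q. ennreal ((?e n q - ?f q)\<^sup>2) \<partial>?N) + ennreal (2 * c\<^sup>2) * (\<integral>\<^sup>+q. ennreal ((?e' n q - ?g q)\<^sup>2) \<partial>?N)" for n
  proof -
    have "(\<integral>\<^sup>+ p. \<integral>\<^sup>+ \<omega>. ennreal ((sp_eval (?r n) (fst p) (snd p) \<omega> - (f (fst p) (snd p) \<omega> + c * g (fst p) (snd p) \<omega>))\<^sup>2) \<partial>M
        \<partial>(lborel :: (real \<times> real) measure))
      = (\<integral>\<^sup>+ p. \<integral>\<^sup>+ \<omega>. ennreal (((?e n (p, \<omega>) - ?f (p, \<omega>)) + c * (?e' n (p, \<omega>) - ?g (p, \<omega>)))\<^sup>2) \<partial>M \<partial>(lborel :: (real \<times> real) measure))"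
      by (simp add: sp_eval_append sp_eval_scale algebra_simps)
    also have "\<dots> = (\<integral>\<^sup>+q. ennreal (((?e n q - ?f q) + c * (?e' n q - ?g q))\<^sup>2) \<partial>?N)"
      by (rule nn_integral_fst) measurable
    also have "\<dots> \<le> 2 * (\<integral>\<^sup>+q. ennreal ((?e n q - ?f q)\<^sup>2) \<partial>?N) + ennreal (2 * c\<^sup>2) * (\<integral>\<^sup>+q. ennreal ((?e' n q - ?g q)\<^sup>2) \<partial>?N)"
      by (rule nn_integral_square_add_le) measurable
    finally show ?thesis .
  qed
  have le2: "(\<integral>\<^sup>+ \<omega>. ennreal ((sp_int W (?r n) \<omega> - (I \<omega> + c * J \<omega>))\<^sup>2) \<partial>M)
      \<le> 2 * (\<integral>\<^sup>+ \<omega>. ennreal ((sp_int W (pss n) \<omega> - I \<omega>)\<^sup>2) \<partial>M) + ennreal (2 * c\<^sup>2) * (\<integral>\<^sup>+ \<omega>. ennreal ((sp_int W (qss n) \<omega> - J \<omega>)\<^sup>2) \<partial>M)" for n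
  proof -
    have "(\<integral>\<^sup>+ \<omega>. ennreal ((sp_int W (?r n) \<omega> - (I \<omega> + c * J \<omega>))\<^sup>2) \<partial>M)
       = (\<integral>\<^sup>+ \<omega>. ennreal (((sp_int W (pss n) \<omega> - I \<omega>) + c * (sp_int W (qss n) \<omega> - J \<omega>))\<^sup>2) \<partial>M)"
      by (simp add: sp_int_append sp_int_scale algebra_simps)
    also have "\<dots> \<le> 2 * (\<integral>\<^sup>+ \<omega>. ennreal ((sp_int W (pss n) \<omega> - I \<omega>)\<^sup>2) \<partial>M) + ennreal (2 * c\<^sup>2) * (\<integral>\<^sup>+ \<omega>. ennreal ((sp_int W (qss n) \<omega> - J \<omega>)\<^sup>2) \<partial>M)"
      by (rule nn_integral_square_add_le) measurable
    finally show ?thesis .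
  qed
  show ?thesis
    unfolding walsh_integral_def
  proof (intro conjI exI[of _ ?r] allI)
    show "(\<lambda>\<omega>. I \<omega> + c * J \<omega>) \<in> borel_measurable M" by measurable
    show "simple_proc M W (?r n)" for n
      using s[of n] simple_proc_scale[OF s'[of n], of c] by (auto simp: simple_proc_def)
    show "(\<lambda>n. \<integral>\<^sup>+ p. \<integral>\<^sup>+ \<omega>. ennreal ((sp_eval (?r n) (fst p) (snd p) \<omega> - (f (fst p) (snd p) \<omega> + c * g (fst p) (snd p) \<omega>))\<^sup>2) \<partial>M
        \<partial>(lborel :: (real \<times> real) measure)) \<longlonglongrightarrow> 0"
      by (rule tendsto_sandwich[OF _ _ tendsto_const lim[OF E E']]) (use le1 in auto)
    show "(\<lambda>n. \<integral>\<^sup>+ \<omega>. ennreal ((sp_int W (?r n) \<omega> - (I \<omega> + c * J \<omega>))\<^sup>2) \<partial>M) \<longlonglongrightarrow> 0"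
      by (rule tendsto_sandwich[OF _ _ tendsto_const lim[OF i i']]) (use le2 in auto)
  qed
qed

text \<open>Polarisation of the isometry, applied to \<open>f + g\<close> and
  \<open>f - g\<close>.\<close>

lemma walsh_covariance:
  fixes f g :: "real \<Rightarrow> real \<Rightarrow> 'w \<Rightarrow> real"
  defines "f' \<equiv> \<lambda>q. f (fst (fst q)) (snd (fst q)) (snd q)" and "g' \<equiv> \<lambda>q. g (fst (fst q)) (snd (fst q)) (snd q)"
  assumes wI: "walsh_integral M W f I" and wJ: "walsh_integral M W g J"
    and f: "(\<lambda>(p, \<omega>). f (fst p) (snd p) \<omega>) \<in> borel_measurable (lborel \<Otimes>\<^sub>M M)"
    and g: "(\<lambda>(p, \<omega>). g (fst p) (snd p) \<omega>) \<in> borel_measurable (lborel \<Otimes>\<^sub>M M)"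
    and if2: "integrable (lborel \<Otimes>\<^sub>M M) (\<lambda>q. (f' q)\<^sup>2)" and ig2: "integrable (lborel \<Otimes>\<^sub>M M) (\<lambda>q. (g' q)\<^sup>2)"
  shows "integrable M (\<lambda>\<omega>. (I \<omega>)\<^sup>2)" and "(\<integral>\<omega>. I \<omega> * J \<omega> \<partial>M) = (\<integral>q. f' q * g' q \<partial>(lborel \<Otimes>\<^sub>M M))"
proof -
  have [measurable]: "I \<in> borel_measurable M" "J \<in> borel_measurable M"
    using wI wJ by (auto simp: walsh_integral_def)
  have fm: "f' \<in> borel_measurable (lborel \<Otimes>\<^sub>M M)" "g' \<in> borel_measurable (lborel \<Otimes>\<^sub>M M)"
    using f g by (simp_all add: f'_def g'_def split_beta)
  have iso: "integrable M (\<lambda>\<omega>. (Z \<omega>)\<^sup>2) \<and> (\<integral>\<omega>. (Z \<omega>)\<^sup>2 \<partial>M) = (\<integral>q. (h (fst (fst q)) (snd (fst q)) (snd q))\<^sup>2 \<partial>(lborel \<Otimes>\<^sub>M M))"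
    if wZ: "walsh_integral M W h Z" and hm: "(\<lambda>(p, \<omega>). h (fst p) (snd p) \<omega>) \<in> borel_measurable (lborel \<Otimes>\<^sub>M M)"
      and hi: "integrable (lborel \<Otimes>\<^sub>M M) (\<lambda>q. (h (fst (fst q)) (snd (fst q)) (snd q))\<^sup>2)" for h :: "real \<Rightarrow> real \<Rightarrow> 'w \<Rightarrow> real" and Z
  proof -
    have [measurable]: "Z \<in> borel_measurable M" using wZ by (auto simp: walsh_integral_def)
    have e: "(\<integral>\<^sup>+\<omega>. ennreal ((Z \<omega>)\<^sup>2) \<partial>M) = ennreal (\<integral>q. (h (fst (fst q)) (snd (fst q)) (snd q))\<^sup>2 \<partial>(lborel \<Otimes>\<^sub>M M))"
      unfolding walsh_isometry[OF wZ hm] by (rule nn_integral_eq_integral[OF hi]) simp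
    then have i: "integrable M (\<lambda>\<omega>. (Z \<omega>)\<^sup>2)" by (intro integrableI_nonneg) auto
    with e show ?thesis by (subst (asm) nn_integral_eq_integral) auto
  qed
  show "integrable M (\<lambda>\<omega>. (I \<omega>)\<^sup>2)" using iso[OF wI f] if2 by (simp add: f'_def)
  have ifg: "integrable (lborel \<Otimes>\<^sub>M M) (\<lambda>q. f' q * g' q)" by (rule integrable_mult_square[OF fm if2 ig2])
  have sq: "(\<integral>\<omega>. (I \<omega> + c * J \<omega>)\<^sup>2 \<partial>M) = (\<integral>q. (f' q + c * g' q)\<^sup>2 \<partial>(lborel \<Otimes>\<^sub>M M))"
    and iIJ: "integrable M (\<lambda>\<omega>. (I \<omega> + c * J \<omega>)\<^sup>2)" and ifc: "integrable (lborel \<Otimes>\<^sub>M M) (\<lambda>q. (f' q + c * g' q)\<^sup>2)" for c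
  proof -
    have "(f' q + c * g' q)\<^sup>2 = (f' q)\<^sup>2 + 2 * c * (f' q * g' q) + c\<^sup>2 * (g' q)\<^sup>2" for q
      by (simp add: power2_eq_square algebra_simps)
    then show i: "integrable (lborel \<Otimes>\<^sub>M M) (\<lambda>q. (f' q + c * g' q)\<^sup>2)"
      using if2 ig2 ifg by simp
    have m: "(\<lambda>(p, \<omega>). f (fst p) (snd p) \<omega> + c * g (fst p) (snd p) \<omega>) \<in> borel_measurable (lborel \<Otimes>\<^sub>M M)"
      using f g by (simp add: split_beta)
    show "(\<integral>\<omega>. (I \<omega> + c * J \<omega>)\<^sup>2 \<partial>M) = (\<integral>q. (f' q + c * g' q)\<^sup>2 \<partial>(lborel \<Otimes>\<^sub>M M))"
      "integrable M (\<lambda>\<omega>. (I \<omega> + c * J \<omega>)\<^sup>2)"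
      using iso[OF walsh_integral_linear[OF wI wJ f g, of c] m] i by (simp_all add: f'_def g'_def)
  qed
  have "(\<integral>\<omega>. I \<omega> * J \<omega> \<partial>M) = (\<integral>\<omega>. ((I \<omega> + 1 * J \<omega>)\<^sup>2 - (I \<omega> + (-1) * J \<omega>)\<^sup>2) / 4 \<partial>M)"
    by (intro Bochner_Integration.integral_cong refl) (simp add: power2_eq_square field_simps)
  also have "\<dots> = ((\<integral>\<omega>. (I \<omega> + 1 * J \<omega>)\<^sup>2 \<partial>M) - (\<integral>\<omega>. (I \<omega> + (-1) * J \<omega>)\<^sup>2 \<partial>M)) / 4"
    by (simp only: integral_divide_zero Bochner_Integration.integral_diff[OF iIJ iIJ])
  also have "\<dots> = ((\<integral>q. (f' q + 1 * g' q)\<^sup>2 \<partial>(lborel \<Otimes>\<^sub>M M)) - (\<integral>q. (f' q + (-1) * g' q)\<^sup>2 \<partial>(lborel \<Otimes>\<^sub>M M))) / 4"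
    by (simp only: sq)
  also have "\<dots> = (\<integral>q. ((f' q + 1 * g' q)\<^sup>2 - (f' q + (-1) * g' q)\<^sup>2) / 4 \<partial>(lborel \<Otimes>\<^sub>M M))"
    by (simp only: integral_divide_zero Bochner_Integration.integral_diff[OF ifc ifc])
  also have "\<dots> = (\<integral>q. f' q * g' q \<partial>(lborel \<Otimes>\<^sub>M M))"
    by (intro Bochner_Integration.integral_cong refl) (simp add: power2_eq_square field_simps)
  finally show "(\<integral>\<omega>. I \<omega> * J \<omega> \<partial>M) = (\<integral>q. f' q * g' q \<partial>(lborel \<Otimes>\<^sub>M M))" .
qed

end

section \<open>Convergence to the initial measure\<close>

lemma nn_integral_lborel_mult:
  fixes f g :: "real \<Rightarrow> ennreal"
  assumes [measurable]: "f \<in> borel_measurable borel" "g \<in> borel_measurable borel"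
  shows "(\<integral>\<^sup>+p. f (fst p) * g (snd p) * c \<partial>lborel) = (\<integral>\<^sup>+x. f x \<partial>lborel) * (\<integral>\<^sup>+x. g x \<partial>lborel) * c"
proof -
  have "(\<integral>\<^sup>+p. f (fst p) * g (snd p) * c \<partial>lborel) = (\<integral>\<^sup>+p. f (fst p) * g (snd p) * c \<partial>(lborel \<Otimes>\<^sub>M lborel))"
    by (simp add: lborel_prod)
  also have "\<dots> = (\<integral>\<^sup>+x. \<integral>\<^sup>+y. f x * g y * c \<partial>lborel \<partial>lborel)"
    by (subst lborel.nn_integral_fst[symmetric]) simp_all
  also have "\<dots> = (\<integral>\<^sup>+x. f x \<partial>lborel) * (\<integral>\<^sup>+x. g x \<partial>lborel) * c"
    by (simp add: nn_integral_cmult nn_integral_multc)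
  finally show ?thesis .
qed

lemma integral_lborel_mult:
  fixes f :: "real \<Rightarrow> real"
  assumes f: "integrable lborel f"
  shows "(\<integral>p. f (fst p) * f (snd p) \<partial>lborel) = (\<integral>x. f x \<partial>lborel)\<^sup>2"
proof -
  have "(\<integral>p. f (fst p) * f (snd p) \<partial>lborel) = (\<integral>p. (case p of (x, y) \<Rightarrow> f x * f y) \<partial>(lborel \<Otimes>\<^sub>M lborel))"
    by (simp add: lborel_prod split_beta)
  also have "\<dots> = (\<integral>x. \<integral>y. f x * f y \<partial>lborel \<partial>lborel)"
    using lborel_pair.integral_fst'[OF lborel_pair.integrable_prod_mult[OF f f]] by simp
  also have "\<dots> = (\<integral>x. f x \<partial>lborel)\<^sup>2" by (simp add: power2_eq_square)
  finally show ?thesis .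
qed

section \<open>The noise part of a solution and its spatial averages\<close>

locale mild_solution = stable_params a \<delta> + noise_space M W
  for a \<delta> :: real and M :: "'w measure" and W :: "(real \<times> real) set \<Rightarrow> 'w \<Rightarrow> real" +
  fixes \<rho> :: "real \<Rightarrow> real" and mp mn :: "real measure" and u I :: "real \<Rightarrow> real \<Rightarrow> 'w \<Rightarrow> real"
  assumes rho: "continuous_on UNIV \<rho>"
    and tempered: "G_tempered mp" "G_tempered mn"
    and u_measurable: "(\<lambda>(p, \<omega>). u (fst p) (snd p) \<omega>)
        \<in> borel_measurable (restrict_space (lborel :: (real \<times> real) measure) ({0<..} \<times> UNIV) \<Otimes>\<^sub>M M)"
    and finite_energy: "0 < t \<Longrightarrow> (\<integral>\<^sup>+ p. \<integral>\<^sup>+ \<omega>. ennreal (indicator ({0<..<t} \<times> UNIV) p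
            * (G (t - fst p) (x - snd p))\<^sup>2 * (\<rho> (u (fst p) (snd p) \<omega>))\<^sup>2) \<partial>M
          \<partial>(lborel :: (real \<times> real) measure)) < \<infinity>"
    and walsh: "0 < t \<Longrightarrow> walsh_integral M W
             (\<lambda>s y \<omega>. indicator {0<..<t} s * G (t - s) (x - y) * \<rho> (u s y \<omega>)) (I t x)"
    and I_continuous: "0 < t \<Longrightarrow> ((\<lambda>p. \<integral>\<^sup>+ \<omega>. ennreal ((I (fst p) (snd p) \<omega> - I t x \<omega>)\<^sup>2) \<partial>M) \<longlongrightarrow> 0)
             (at (t, x) within {0<..} \<times> UNIV)"
    and u_eq: "0 < t \<Longrightarrow> AE \<omega> in M. u t x \<omega> = J0 a \<delta> mp mn t x + I t x \<omega>"
begin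

text \<open>Measurability of \<open>u\<close> is given at positive times; the indicator extends the
  coefficient by 0. Together with \<open>kern\<close> it splits the Walsh integrand into a random
  factor free of \<open>(t, x)\<close> and a deterministic one.\<close>

definition coeff :: "(real \<times> real) \<times> 'w \<Rightarrow> real" where
  "coeff q = indicator ({0<..} \<times> UNIV) (fst q) * \<rho> (u (fst (fst q)) (snd (fst q)) (snd q))"

definition kern :: "real \<Rightarrow> real \<Rightarrow> real \<times> real \<Rightarrow> real" where
  "kern t x p = indicator {0<..<t} (fst p) * G (t - fst p) (x - snd p)"

lemma kern_nonneg: "0 \<le> kern t x p"
  using G_nonneg[of "t - fst p"] by (auto simp: kern_def indicator_def)

text \<open>Scaling expresses the kernel at every time through \<open>G 1\<close>, so joint
  measurability in time and space reduces to that of one continuous function.\<close>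

lemma kern_measurable [measurable]: "(\<lambda>(x, p). kern t x p) \<in> borel_measurable (borel \<Otimes>\<^sub>M borel)"
proof -
  have [measurable]: "G 1 \<in> borel_measurable borel" by (rule G_measurable) simp
  have "kern t x p = indicator {0<..<t} (fst p) * ((t - fst p) powr (- 1 / a) * G 1 ((t - fst p) powr (- 1 / a) * (x - snd p)))" for x p
    using G_scale[of "t - fst p"] by (auto simp: kern_def indicator_def)
  then show ?thesis
    unfolding borel_prod[symmetric] by simp
qed

lemma coeff_measurable [measurable]: "coeff \<in> borel_measurable (lborel \<Otimes>\<^sub>M M)"
proof -
  let ?S = "({0<..} \<times> UNIV) :: (real \<times> real) set"
  let ?N = "(lborel :: (real \<times> real) measure) \<Otimes>\<^sub>M M"
  have S: "?S \<in> sets borel" by (intro borel_Times) auto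
  have [measurable]: "\<rho> \<in> borel_measurable borel" by (rule borel_measurable_continuous_onI[OF rho])
  have "(\<lambda>q. (fst q, snd q)) \<in> measurable (restrict_space ?N (?S \<times> space M)) (restrict_space lborel ?S \<Otimes>\<^sub>M M)"
  proof (rule measurable_Pair)
    show "fst \<in> measurable (restrict_space ?N (?S \<times> space M)) (restrict_space lborel ?S)"
      by (rule measurable_restrict_space2) (auto simp: space_restrict_space intro: measurable_restrict_space1)
    show "snd \<in> measurable (restrict_space ?N (?S \<times> space M)) M"
      by (rule measurable_restrict_space1) simp
  qed
  from measurable_compose[OF measurable_compose[OF this u_measurable] \<open>\<rho> \<in> borel_measurable borel\<close>]
  have "(\<lambda>q. \<rho> (u (fst (fst q)) (snd (fst q)) (snd q))) \<in> borel_measurable (restrict_space ?N (?S \<times> space M))"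
    by (simp add: split_beta)
  moreover have "?S \<times> space M \<inter> space ?N \<in> sets ?N" using S by auto
  ultimately have m: "(\<lambda>q. indicator (?S \<times> space M) q *\<^sub>R \<rho> (u (fst (fst q)) (snd (fst q)) (snd q))) \<in> borel_measurable ?N"
    by (simp only: borel_measurable_restrict_space_iff)
  have "coeff q = indicator (?S \<times> space M) q *\<^sub>R \<rho> (u (fst (fst q)) (snd (fst q)) (snd q))" if "q \<in> space ?N" for q
    using that by (cases q) (auto simp: coeff_def indicator_def space_pair_measure)
  then show ?thesis using m by (subst measurable_cong)
qed

lemma integrand_eq: "indicator {0<..<t} (fst (fst q)) * G (t - fst (fst q)) (x - snd (fst q)) * \<rho> (u (fst (fst q)) (snd (fst q)) (snd q))
    = kern t x (fst q) * coeff q"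
  by (cases q; cases "fst q") (auto simp: kern_def coeff_def indicator_def)

lemma kern_measurable1 [measurable]: "kern t x \<in> borel_measurable borel"
  using measurable_compose[OF measurable_Pair1'[of x borel borel] kern_measurable[of t]] by simp

lemma integrand_square_integrable:
  assumes "0 < t"
  shows "integrable (lborel \<Otimes>\<^sub>M M) (\<lambda>q. (kern t x (fst q) * coeff q)\<^sup>2)"
proof (rule integrableI_nonneg)
  have e: "ennreal ((kern t x p * coeff (p, \<omega>))\<^sup>2) = ennreal (indicator ({0<..<t} \<times> UNIV) p
            * (G (t - fst p) (x - snd p))\<^sup>2 * (\<rho> (u (fst p) (snd p) \<omega>))\<^sup>2)" for p \<omega>
    by (cases p) (auto simp: kern_def coeff_def indicator_def power_mult_distrib)
  have "(\<integral>\<^sup>+q. ennreal ((kern t x (fst q) * coeff q)\<^sup>2) \<partial>(lborel \<Otimes>\<^sub>M M)) = (\<integral>\<^sup>+p. \<integral>\<^sup>+\<omega>. ennreal ((kern t x p * coeff (p, \<omega>))\<^sup>2) \<partial>M \<partial>lborel)"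
    by (subst nn_integral_fst[symmetric]) simp_all
  then show "(\<integral>\<^sup>+q. ennreal ((kern t x (fst q) * coeff q)\<^sup>2) \<partial>(lborel \<Otimes>\<^sub>M M)) < \<infinity>"
    using finite_energy[OF assms, of x] by (simp only: e)
qed auto

lemma I_covariance:
  assumes t: "0 < t"
  shows "integrable M (\<lambda>\<omega>. (I t x \<omega>)\<^sup>2)"
    and "(\<integral>\<omega>. I t x \<omega> * I t x' \<omega> \<partial>M) = (\<integral>q. (kern t x (fst q) * coeff q) * (kern t x' (fst q) * coeff q) \<partial>(lborel \<Otimes>\<^sub>M M))"
proof -
  have m: "(\<lambda>(p, \<omega>). indicator {0<..<t} (fst p) * G (t - fst p) (x - snd p) * \<rho> (u (fst p) (snd p) \<omega>)) \<in> borel_measurable (lborel \<Otimes>\<^sub>M M)" for x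
    unfolding split_beta integrand_eq by measurable
  note c = walsh_covariance[OF walsh[OF t, of x] walsh[OF t, of x'] m m, unfolded integrand_eq,
      OF integrand_square_integrable[OF t] integrand_square_integrable[OF t]]
  show "integrable M (\<lambda>\<omega>. (I t x \<omega>)\<^sup>2)"
    "(\<integral>\<omega>. I t x \<omega> * I t x' \<omega> \<partial>M) = (\<integral>q. (kern t x (fst q) * coeff q) * (kern t x' (fst q) * coeff q) \<partial>(lborel \<Otimes>\<^sub>M M))"
    using c by auto
qed

lemma I_measurable: "0 < t \<Longrightarrow> I t x \<in> borel_measurable M"
  using walsh by (auto simp: walsh_integral_def)

text \<open>Continuity into \<open>L2\<close> bounds the second moment near each point, and finitely
  many neighbourhoods cover \<open>{- K..K}\<close>. The bound justifies Fubini for the averages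
  over \<open>x\<close>.\<close>

lemma I_locally_bounded:
  assumes t: "0 < t"
  obtains D where "\<And>x. \<bar>x\<bar> \<le> K \<Longrightarrow> (\<integral>\<^sup>+\<omega>. ennreal ((I t x \<omega>)\<^sup>2) \<partial>M) \<le> ennreal D"
proof -
  let ?m = "\<lambda>x. \<integral>\<^sup>+\<omega>. ennreal ((I t x \<omega>)\<^sup>2) \<partial>M"
  note [measurable] = I_measurable[OF t]
  have fin: "?m x < \<infinity>" for x
    using I_covariance(1)[OF t, of x] by (simp add: nn_integral_eq_integral ennreal_less_top)
  have "\<exists>U. open U \<and> x \<in> U \<and> (\<forall>y\<in>U. ?m y \<le> 2 * ?m x + 2)" for x
  proof -
    have "\<forall>\<^sub>F p in at (t, x) within {0<..} \<times> UNIV. (\<integral>\<^sup>+ \<omega>. ennreal ((I (fst p) (snd p) \<omega> - I t x \<omega>)\<^sup>2) \<partial>M) < 1"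
      by (rule order_tendstoD(2)[OF I_continuous[OF t]]) simp
    then obtain d where d: "0 < d" and "\<And>p. p \<in> {0<..} \<times> UNIV \<Longrightarrow> p \<noteq> (t, x) \<Longrightarrow> dist p (t, x) < d \<Longrightarrow>
        (\<integral>\<^sup>+ \<omega>. ennreal ((I (fst p) (snd p) \<omega> - I t x \<omega>)\<^sup>2) \<partial>M) < 1"
      unfolding eventually_at by auto
    from this(2)[of "(t, y)" for y] have near: "(\<integral>\<^sup>+ \<omega>. ennreal ((I t y \<omega> - I t x \<omega>)\<^sup>2) \<partial>M) < 1"
      if "y \<noteq> x" "dist y x < d" for y
      using that t by (simp add: dist_Pair_Pair)
    have "?m y \<le> 2 * ?m x + 2" if y: "y \<in> ball x d" for y
    proof -
      have le1: "(\<integral>\<^sup>+ \<omega>. ennreal ((I t y \<omega> - I t x \<omega>)\<^sup>2) \<partial>M) \<le> 1"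
        using near[of y] y by (cases "y = x") (auto simp: dist_commute)
      have "?m y = (\<integral>\<^sup>+ \<omega>. ennreal ((I t x \<omega> + 1 * (I t y \<omega> - I t x \<omega>))\<^sup>2) \<partial>M)" by simp
      also have "\<dots> \<le> 2 * ?m x + ennreal (2 * 1\<^sup>2) * (\<integral>\<^sup>+ \<omega>. ennreal ((I t y \<omega> - I t x \<omega>)\<^sup>2) \<partial>M)"
        by (rule nn_integral_square_add_le) measurable
      also have "\<dots> \<le> 2 * ?m x + ennreal (2 * 1\<^sup>2) * 1"
        by (intro add_left_mono mult_left_mono le1) simp
      finally show ?thesis by simp
    qed
    then show ?thesis using d by (intro exI[of _ "ball x d"]) auto
  qed
  then obtain U where U: "\<And>x. open (U x)" "\<And>x. x \<in> U x" "\<And>x y. y \<in> U x \<Longrightarrow> ?m y \<le> 2 * ?m x + 2"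
    by metis
  obtain X where X: "finite X" "{- K..K} \<subseteq> (\<Union>x\<in>X. U x)"
    by (rule compactE_image[of "{- K..K}" "{- K..K}" U]) (use U in auto)
  let ?E = "\<Sum>x\<in>X. 2 * ?m x + 2"
  have "?E < \<infinity>"
    using fin X(1) by (auto simp: ennreal_mult_less_top ennreal_add_less_top)
  moreover have "?m y \<le> ?E" if y: "\<bar>y\<bar> \<le> K" for y
  proof -
    have "y \<in> {- K..K}" using y by auto
    then obtain x where x: "x \<in> X" "y \<in> U x" using X(2) by blast
    then have "?m y \<le> 2 * ?m x + 2" using U by auto
    also have "\<dots> \<le> ?E" using X x by (intro member_le_sum) auto
    finally show ?thesis .
  qed
  ultimately show thesis using that[of "enn2real ?E"] by (simp add: less_top)
qed

lemma u_time_measurable: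
  assumes t: "0 < t"
  shows "(\<lambda>(x, \<omega>). u t x \<omega>) \<in> borel_measurable (lborel \<Otimes>\<^sub>M M)"
proof -
  let ?R = "restrict_space (lborel :: (real \<times> real) measure) ({0<..} \<times> UNIV)"
  have "(\<lambda>q. (t, fst q)) \<in> measurable (lborel \<Otimes>\<^sub>M M) ?R"
    using t by (intro measurable_restrict_space2) (auto simp: borel_prod[symmetric] measurable_lborel1)
  then have "(\<lambda>q. ((t, fst q), snd q)) \<in> measurable (lborel \<Otimes>\<^sub>M M) (?R \<Otimes>\<^sub>M M)"
    by (rule measurable_Pair) simp
  from measurable_compose[OF this u_measurable] show ?thesis by (simp add: split_beta)
qed

lemma J0_measurable:
  assumes t: "0 < t"
  shows "J0 a \<delta> mp mn t \<in> borel_measurable lborel"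
proof -
  have "(\<lambda>x. \<integral>y. G t (x - y) \<partial>\<mu>) \<in> borel_measurable lborel" if "G_tempered \<mu>" for \<mu>
  proof -
    have "sets \<mu> = sets borel" "sigma_finite_measure \<mu>" using that by (auto simp: G_tempered_def)
    then show ?thesis
      using G_diff_measurable[OF t, of \<mu>] by (intro sigma_finite_measure.borel_measurable_lebesgue_integral)
  qed
  from this[OF tempered(1)] this[OF tempered(2)] show ?thesis
    unfolding J0_def[abs_def] sint_def by measurable
qed

text \<open>A version of the noise part with joint measurability in \<open>(x, \<omega>)\<close>,
  inherited from \<open>u\<close>. It agrees with \<open>I t x\<close> almost surely for each
  \<open>x\<close>, which is enough for all moments.\<close>

definition Z :: "real \<Rightarrow> real \<Rightarrow> 'w \<Rightarrow> real" where
  "Z t x \<omega> = u t x \<omega> - J0 a \<delta> mp mn t x"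

lemma Z_measurable: "0 < t \<Longrightarrow> (\<lambda>(x, \<omega>). Z t x \<omega>) \<in> borel_measurable (lborel \<Otimes>\<^sub>M M)"
  unfolding Z_def using u_time_measurable[of t] J0_measurable[of t] by (simp add: split_beta)

lemma Z_AE: "0 < t \<Longrightarrow> AE \<omega> in M. Z t x \<omega> = I t x \<omega>"
  using u_eq[of t x] by (auto simp: Z_def)

lemma Z_measurable1: "0 < t \<Longrightarrow> Z t x \<in> borel_measurable M"
  using measurable_compose[OF measurable_Pair1'[of x lborel M] Z_measurable[of t]] by simp

text \<open>The squared average is a double integral over two space points; taking the mean inside
  produces the covariances of \<open>I\<close>, that is, products of kernels. Absolute values are
  inserted before the last exchange, so that Tonelli applies without an integrability check; an
  upper bound is all that is required.\<close>

lemma smeared_second_moment: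
  fixes \<phi> :: "real \<Rightarrow> real"
  assumes t: "0 < t" and \<phi>: "continuous_on UNIV \<phi>" and supp: "\<And>x. \<bar>x\<bar> > K \<Longrightarrow> \<phi> x = 0"
  shows "AE \<omega> in M. integrable lborel (\<lambda>x. \<phi> x * Z t x \<omega>)"
    and "(\<integral>\<^sup>+\<omega>. ennreal ((\<integral>x. \<phi> x * Z t x \<omega> \<partial>lborel)\<^sup>2) \<partial>M)
      \<le> (\<integral>\<^sup>+q. (\<integral>\<^sup>+x. ennreal (\<bar>\<phi> x\<bar> * kern t x (fst q)) \<partial>lborel)\<^sup>2 * ennreal ((coeff q)\<^sup>2) \<partial>(lborel \<Otimes>\<^sub>M M))"
proof -
  let ?N = "(lborel :: (real \<times> real) measure) \<Otimes>\<^sub>M M"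
  interpret P1: pair_sigma_finite "lborel :: real measure" M ..
  interpret P2: pair_sigma_finite "lborel :: (real \<times> real) measure" M ..
  interpret P3: pair_sigma_finite "lborel :: (real \<times> real) measure" ?N ..
  have [measurable]: "\<phi> \<in> borel_measurable borel" by (rule borel_measurable_continuous_onI[OF \<phi>])
  have [measurable]: "(\<lambda>q. Z t (fst q) (snd q)) \<in> borel_measurable (lborel \<Otimes>\<^sub>M M)"
    using Z_measurable[OF t] by (simp add: split_beta)
  note [measurable] = Z_measurable1[OF t] I_measurable[OF t]
  have i\<phi>: "integrable lborel \<phi>"
  proof -
    have "set_integrable lborel {- K..K} \<phi>"
      using \<phi> by (intro borel_integrable_atLeastAtMost') (rule continuous_on_subset, auto)
    moreover have "(\<lambda>x. indicator {- K..K} x *\<^sub>R \<phi> x) = \<phi>"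
    proof
      fix x
      show "indicator {- K..K} x *\<^sub>R \<phi> x = \<phi> x"
        using supp[of x] by (cases "\<bar>x\<bar> \<le> K") (auto simp: indicator_def)
    qed
    ultimately show ?thesis by (simp add: set_integrable_def)
  qed
  obtain D where D: "\<And>x. \<bar>x\<bar> \<le> K \<Longrightarrow> (\<integral>\<^sup>+\<omega>. ennreal ((I t x \<omega>)\<^sup>2) \<partial>M) \<le> ennreal D"
    by (rule I_locally_bounded[OF t, of K], rule that)
  have ZD: "(\<integral>\<^sup>+\<omega>. ennreal ((Z t x \<omega>)\<^sup>2) \<partial>M) \<le> ennreal D" if "\<phi> x \<noteq> 0" for x
  proof -
    have "(\<integral>\<^sup>+\<omega>. ennreal ((Z t x \<omega>)\<^sup>2) \<partial>M) = (\<integral>\<^sup>+\<omega>. ennreal ((I t x \<omega>)\<^sup>2) \<partial>M)"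
      by (rule nn_integral_cong_AE) (use Z_AE[OF t, of x] in auto)
    then show ?thesis using D[of x] supp[of x] that by (auto simp: not_le[symmetric])
  qed
  have cov: "(\<integral>\<omega>. Z t x \<omega> * Z t x' \<omega> \<partial>M) = (\<integral>q. (kern t x (fst q) * coeff q) * (kern t x' (fst q) * coeff q) \<partial>?N)" for x x'
    unfolding I_covariance(2)[OF t, symmetric]
    by (rule integral_cong_AE) (use Z_AE[OF t, of x] Z_AE[OF t, of x'] in auto)
  \<comment> \<open>\<open>|z| <= 1 + z^2\<close> turns the local second moment bound into the
    integrability that Fubini asks for.\<close>
  have int1: "integrable (lborel \<Otimes>\<^sub>M M) (\<lambda>q. \<phi> (fst q) * Z t (fst q) (snd q))"
  proof (rule integrableI_bounded)
    have "(\<integral>\<^sup>+q. ennreal (norm (\<phi> (fst q) * Z t (fst q) (snd q))) \<partial>(lborel \<Otimes>\<^sub>M M))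
        = (\<integral>\<^sup>+x. \<integral>\<^sup>+\<omega>. ennreal \<bar>\<phi> x * Z t x \<omega>\<bar> \<partial>M \<partial>lborel)"
      by (subst nn_integral_fst[symmetric]) simp_all
    also have "\<dots> \<le> (\<integral>\<^sup>+x. ennreal \<bar>\<phi> x\<bar> * (1 + ennreal D) \<partial>lborel)"
    proof (rule nn_integral_mono)
      fix x
      have "(\<integral>\<^sup>+\<omega>. ennreal \<bar>\<phi> x * Z t x \<omega>\<bar> \<partial>M) = ennreal \<bar>\<phi> x\<bar> * (\<integral>\<^sup>+\<omega>. ennreal \<bar>Z t x \<omega>\<bar> \<partial>M)"
        by (simp add: abs_mult ennreal_mult nn_integral_cmult)
      also have "\<dots> \<le> ennreal \<bar>\<phi> x\<bar> * (1 + ennreal D)"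
      proof (cases "\<phi> x = 0")
        case False
        have "(\<integral>\<^sup>+\<omega>. ennreal \<bar>Z t x \<omega>\<bar> \<partial>M) \<le> (\<integral>\<^sup>+\<omega>. 1 + ennreal ((Z t x \<omega>)\<^sup>2) \<partial>M)"
        proof (rule nn_integral_mono)
          fix \<omega>
          have "\<bar>z\<bar> \<le> 1 + z\<^sup>2" for z :: real
            using zero_le_power2[of "\<bar>z\<bar> - 1"] by (simp add: power2_eq_square algebra_simps)
          then have "ennreal \<bar>Z t x \<omega>\<bar> \<le> ennreal (1 + (Z t x \<omega>)\<^sup>2)" by (intro ennreal_leI)
          then show "ennreal \<bar>Z t x \<omega>\<bar> \<le> 1 + ennreal ((Z t x \<omega>)\<^sup>2)" by simp
        qed
        also have "\<dots> \<le> 1 + ennreal D"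
          using ZD[OF False] by (simp add: nn_integral_add emeasure_space_1 add_left_mono)
        finally show ?thesis by (intro mult_left_mono) auto
      qed simp
      finally show "(\<integral>\<^sup>+\<omega>. ennreal \<bar>\<phi> x * Z t x \<omega>\<bar> \<partial>M) \<le> ennreal \<bar>\<phi> x\<bar> * (1 + ennreal D)" .
    qed
    also have "\<dots> = (\<integral>\<^sup>+x. ennreal \<bar>\<phi> x\<bar> \<partial>lborel) * (1 + ennreal D)" by (rule nn_integral_multc) simp
    also have "\<dots> < \<infinity>"
      using i\<phi> by (auto simp: integrable_iff_bounded ennreal_mult_less_top)
    finally show "(\<integral>\<^sup>+q. ennreal (norm (\<phi> (fst q) * Z t (fst q) (snd q))) \<partial>(lborel \<Otimes>\<^sub>M M)) < \<infinity>" .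
  qed measurable
  then have "integrable (lborel \<Otimes>\<^sub>M M) (\<lambda>(x, \<omega>). \<phi> x * Z t x \<omega>)" by (simp add: split_beta')
  then show AE_int: "AE \<omega> in M. integrable lborel (\<lambda>x. \<phi> x * Z t x \<omega>)"
    by (rule P1.AE_integrable_snd)
  let ?\<Psi> = "\<lambda>p \<omega>. (\<phi> (fst p) * Z t (fst p) \<omega>) * (\<phi> (snd p) * Z t (snd p) \<omega>)"
  have [measurable]: "fst \<in> measurable (lborel :: (real \<times> real) measure) lborel" "snd \<in> measurable (lborel :: (real \<times> real) measure) lborel"
    by (simp_all add: borel_prod[symmetric])
  have [measurable]: "(\<lambda>q. Z t (fst (fst q)) (snd q)) \<in> borel_measurable ?N"
  proof -
    have "(\<lambda>q. (fst (fst q), snd q)) \<in> measurable ?N (lborel \<Otimes>\<^sub>M M)" by measurable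
    from measurable_compose[OF this Z_measurable[OF t]] show ?thesis by simp
  qed
  have [measurable]: "(\<lambda>q. Z t (snd (fst q)) (snd q)) \<in> borel_measurable ?N"
  proof -
    have "(\<lambda>q. (snd (fst q), snd q)) \<in> measurable ?N (lborel \<Otimes>\<^sub>M M)" by measurable
    from measurable_compose[OF this Z_measurable[OF t]] show ?thesis by simp
  qed
  have [measurable]: "(\<lambda>q. \<phi> (fst (fst q))) \<in> borel_measurable ?N" "(\<lambda>q. \<phi> (snd (fst q))) \<in> borel_measurable ?N"
    by (rule measurable_compose[OF measurable_compose[OF measurable_fst] \<open>\<phi> \<in> borel_measurable borel\<close>], simp add: borel_prod[symmetric])+
  have \<Psi>m [measurable]: "(\<lambda>q. ?\<Psi> (fst q) (snd q)) \<in> borel_measurable ?N"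
    by (intro borel_measurable_times) fact+
  have \<phi>fin: "(\<integral>\<^sup>+x. ennreal \<bar>\<phi> x\<bar> \<partial>lborel) < \<infinity>"
    using i\<phi> by (auto simp: integrable_iff_bounded)
  \<comment> \<open>The analogue for two space points, by
    \<open>|z * w| <= z^2 + w^2\<close>.\<close>
  have int2: "integrable ?N (\<lambda>q. ?\<Psi> (fst q) (snd q))"
  proof (rule integrableI_bounded)
    have "(\<integral>\<^sup>+q. ennreal (norm (?\<Psi> (fst q) (snd q))) \<partial>?N) = (\<integral>\<^sup>+p. \<integral>\<^sup>+\<omega>. ennreal \<bar>?\<Psi> p \<omega>\<bar> \<partial>M \<partial>lborel)"
      using nn_integral_fst[OF measurable_compose[OF \<Psi>m, of "\<lambda>z. ennreal \<bar>z\<bar>"]] by simp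
    also have "\<dots> \<le> (\<integral>\<^sup>+p. ennreal \<bar>\<phi> (fst p)\<bar> * ennreal \<bar>\<phi> (snd p)\<bar> * (ennreal D + ennreal D) \<partial>lborel)"
    proof (rule nn_integral_mono)
      fix p :: "real \<times> real"
      show "(\<integral>\<^sup>+\<omega>. ennreal \<bar>?\<Psi> p \<omega>\<bar> \<partial>M) \<le> ennreal \<bar>\<phi> (fst p)\<bar> * ennreal \<bar>\<phi> (snd p)\<bar> * (ennreal D + ennreal D)"
      proof (cases "\<phi> (fst p) = 0 \<or> \<phi> (snd p) = 0")
        case False
        have "(\<integral>\<^sup>+\<omega>. ennreal \<bar>?\<Psi> p \<omega>\<bar> \<partial>M) \<le> (\<integral>\<^sup>+\<omega>. ennreal \<bar>\<phi> (fst p)\<bar> * ennreal \<bar>\<phi> (snd p)\<bar> * (ennreal ((Z t (fst p) \<omega>)\<^sup>2) + ennreal ((Z t (snd p) \<omega>)\<^sup>2)) \<partial>M)"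
        proof (rule nn_integral_mono)
          fix \<omega>
          have "\<bar>z * w\<bar> \<le> z\<^sup>2 + w\<^sup>2" for z w :: real
          proof -
            have "2 * (\<bar>z\<bar> * \<bar>w\<bar>) \<le> z\<^sup>2 + w\<^sup>2"
              using sum_squares_bound[of "\<bar>z\<bar>" "\<bar>w\<bar>"] by (simp add: mult.assoc)
            moreover have "0 \<le> \<bar>z\<bar> * \<bar>w\<bar>" by simp
            ultimately show ?thesis unfolding abs_mult by linarith
          qed
          then have "(\<bar>\<phi> (fst p)\<bar> * \<bar>\<phi> (snd p)\<bar>) * \<bar>Z t (fst p) \<omega> * Z t (snd p) \<omega>\<bar>
              \<le> (\<bar>\<phi> (fst p)\<bar> * \<bar>\<phi> (snd p)\<bar>) * ((Z t (fst p) \<omega>)\<^sup>2 + (Z t (snd p) \<omega>)\<^sup>2)"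
            by (intro mult_left_mono) auto
          then have "ennreal \<bar>?\<Psi> p \<omega>\<bar> \<le> ennreal ((\<bar>\<phi> (fst p)\<bar> * \<bar>\<phi> (snd p)\<bar>) * ((Z t (fst p) \<omega>)\<^sup>2 + (Z t (snd p) \<omega>)\<^sup>2))"
            by (intro ennreal_leI) (simp add: abs_mult mult_ac)
          then show "ennreal \<bar>?\<Psi> p \<omega>\<bar> \<le> ennreal \<bar>\<phi> (fst p)\<bar> * ennreal \<bar>\<phi> (snd p)\<bar> * (ennreal ((Z t (fst p) \<omega>)\<^sup>2) + ennreal ((Z t (snd p) \<omega>)\<^sup>2))"
            by (simp add: ennreal_mult)
        qed
        also have "\<dots> = ennreal \<bar>\<phi> (fst p)\<bar> * ennreal \<bar>\<phi> (snd p)\<bar> * ((\<integral>\<^sup>+\<omega>. ennreal ((Z t (fst p) \<omega>)\<^sup>2) \<partial>M) + (\<integral>\<^sup>+\<omega>. ennreal ((Z t (snd p) \<omega>)\<^sup>2) \<partial>M))"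
          by (simp add: nn_integral_cmult nn_integral_add)
        also have "\<dots> \<le> ennreal \<bar>\<phi> (fst p)\<bar> * ennreal \<bar>\<phi> (snd p)\<bar> * (ennreal D + ennreal D)"
          using False by (intro mult_left_mono add_mono ZD) auto
        finally show ?thesis .
      qed auto
    qed
    also have "\<dots> = (\<integral>\<^sup>+x. ennreal \<bar>\<phi> x\<bar> \<partial>lborel) * (\<integral>\<^sup>+x. ennreal \<bar>\<phi> x\<bar> \<partial>lborel) * (ennreal D + ennreal D)"
      by (rule nn_integral_lborel_mult) measurable
    also have "\<dots> < \<infinity>"
      using \<phi>fin by (simp add: ennreal_mult_less_top)
    finally show "(\<integral>\<^sup>+q. ennreal (norm (?\<Psi> (fst q) (snd q))) \<partial>?N) < \<infinity>" .
  qed measurable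
  then have int2': "integrable ?N (\<lambda>(p, \<omega>). ?\<Psi> p \<omega>)" by (simp add: split_beta')
  \<comment> \<open>On the paths for which the integral over \<open>x\<close> exists, its square is
    the integral over pairs.\<close>
  have sq: "AE \<omega> in M. (\<integral>x. \<phi> x * Z t x \<omega> \<partial>lborel)\<^sup>2 = (\<integral>p. ?\<Psi> p \<omega> \<partial>lborel)"
    using AE_int by (rule AE_mp) (use integral_lborel_mult[symmetric] in \<open>auto intro!: AE_I2\<close>)
  let ?A = "\<lambda>x q. ennreal (\<bar>\<phi> x\<bar> * kern t x (fst q))" and ?c = "\<lambda>q. ennreal ((coeff q)\<^sup>2)"
  have "(\<integral>\<^sup>+\<omega>. ennreal ((\<integral>x. \<phi> x * Z t x \<omega> \<partial>lborel)\<^sup>2) \<partial>M) = (\<integral>\<^sup>+\<omega>. ennreal (\<integral>p. ?\<Psi> p \<omega> \<partial>lborel) \<partial>M)"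
    by (rule nn_integral_cong_AE) (use sq in auto)
  also have "\<dots> = ennreal (\<integral>\<omega>. \<integral>p. ?\<Psi> p \<omega> \<partial>lborel \<partial>M)"
  proof (rule nn_integral_eq_integral)
    show "integrable M (\<lambda>\<omega>. \<integral>p. ?\<Psi> p \<omega> \<partial>lborel)" by (rule P2.integrable_snd[OF int2'])
    show "AE \<omega> in M. 0 \<le> (\<integral>p. ?\<Psi> p \<omega> \<partial>lborel)"
      using sq
    proof eventually_elim
      case (elim \<omega>)
      show ?case unfolding elim[symmetric] by simp
    qed
  qed
  also have "(\<integral>\<omega>. \<integral>p. ?\<Psi> p \<omega> \<partial>lborel \<partial>M) = (\<integral>p. \<integral>\<omega>. ?\<Psi> p \<omega> \<partial>M \<partial>lborel)"
    by (rule P2.Fubini_integral[OF int2'])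
  also have "ennreal (\<integral>p. \<integral>\<omega>. ?\<Psi> p \<omega> \<partial>M \<partial>lborel) \<le> ennreal (norm (\<integral>p. \<integral>\<omega>. ?\<Psi> p \<omega> \<partial>M \<partial>lborel))"
    by (rule ennreal_leI) simp
  also have "\<dots> \<le> (\<integral>\<^sup>+p. ennreal (norm (\<integral>\<omega>. ?\<Psi> p \<omega> \<partial>M)) \<partial>lborel)"
    by (rule integral_norm_bound_ennreal[OF P2.integrable_fst[OF int2']])
  also have "\<dots> \<le> (\<integral>\<^sup>+p. \<integral>\<^sup>+q. ?A (fst p) q * ?A (snd p) q * ?c q \<partial>?N \<partial>lborel)"
  proof (rule nn_integral_mono)
    fix p :: "real \<times> real"
    let ?h = "\<lambda>q. (kern t (fst p) (fst q) * coeff q) * (kern t (snd p) (fst q) * coeff q)"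
    have "integrable ?N ?h"
      by (intro integrable_mult_square integrand_square_integrable[OF t]) measurable
    then have i: "integrable ?N (\<lambda>q. \<phi> (fst p) * \<phi> (snd p) * ?h q)" by (rule integrable_mult_right)
    have "(\<integral>\<omega>. ?\<Psi> p \<omega> \<partial>M) = \<phi> (fst p) * \<phi> (snd p) * (\<integral>\<omega>. Z t (fst p) \<omega> * Z t (snd p) \<omega> \<partial>M)"
      by (subst integral_mult_right_zero[symmetric]) (simp add: mult_ac)
    also have "\<dots> = (\<integral>q. \<phi> (fst p) * \<phi> (snd p) * ?h q \<partial>?N)"
      unfolding cov by (rule integral_mult_right_zero[symmetric])
    finally have "ennreal (norm (\<integral>\<omega>. ?\<Psi> p \<omega> \<partial>M)) \<le> (\<integral>\<^sup>+q. ennreal (norm (\<phi> (fst p) * \<phi> (snd p) * ?h q)) \<partial>?N)"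
      using integral_norm_bound_ennreal[OF i] by simp
    also have "\<dots> = (\<integral>\<^sup>+q. ?A (fst p) q * ?A (snd p) q * ?c q \<partial>?N)"
    proof (rule nn_integral_cong)
      fix q
      have "norm (\<phi> (fst p) * \<phi> (snd p) * ?h q) = (\<bar>\<phi> (fst p)\<bar> * kern t (fst p) (fst q)) * (\<bar>\<phi> (snd p)\<bar> * kern t (snd p) (fst q)) * (coeff q)\<^sup>2"
        using kern_nonneg[of t] by (simp add: abs_mult power2_eq_square mult_ac)
      then show "ennreal (norm (\<phi> (fst p) * \<phi> (snd p) * ?h q)) = ?A (fst p) q * ?A (snd p) q * ?c q"
        using kern_nonneg[of t] by (simp add: ennreal_mult)
    qed
    finally show "ennreal (norm (\<integral>\<omega>. ?\<Psi> p \<omega> \<partial>M)) \<le> (\<integral>\<^sup>+q. ?A (fst p) q * ?A (snd p) q * ?c q \<partial>?N)" .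
  qed
  \<comment> \<open>After this exchange the point \<open>q\<close> is fixed, and the integral over
    pairs of space points is a perfect square.\<close>
  also have "\<dots> = (\<integral>\<^sup>+q. \<integral>\<^sup>+p. ?A (fst p) q * ?A (snd p) q * ?c q \<partial>lborel \<partial>?N)"
  proof (rule P3.Fubini'[symmetric])
    have f: "(\<lambda>r. fst (fst r)) \<in> measurable (lborel \<Otimes>\<^sub>M ?N) borel" "(\<lambda>r. snd (fst r)) \<in> measurable (lborel \<Otimes>\<^sub>M ?N) borel"
      by (rule measurable_compose[OF measurable_fst], simp add: borel_prod[symmetric])+
    have s: "(\<lambda>r. fst (snd r)) \<in> measurable (lborel \<Otimes>\<^sub>M ?N) borel"
      by (rule measurable_compose[OF measurable_snd]) simp
    note f[THEN measurable_Pair, OF s, THEN measurable_compose, OF kern_measurable[of t]]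
    then have [measurable]: "(\<lambda>r. kern t (fst (fst r)) (fst (snd r))) \<in> borel_measurable (lborel \<Otimes>\<^sub>M ?N)"
      "(\<lambda>r. kern t (snd (fst r)) (fst (snd r))) \<in> borel_measurable (lborel \<Otimes>\<^sub>M ?N)" by simp_all
    have [measurable]: "(\<lambda>r. \<phi> (fst (fst r))) \<in> borel_measurable (lborel \<Otimes>\<^sub>M ?N)" "(\<lambda>r. \<phi> (snd (fst r))) \<in> borel_measurable (lborel \<Otimes>\<^sub>M ?N)"
      by (rule measurable_compose[OF f(1)], fact, rule measurable_compose[OF f(2)], fact)
    show "(\<lambda>(p, q). ?A (fst p) q * ?A (snd p) q * ?c q) \<in> borel_measurable (lborel \<Otimes>\<^sub>M ?N)"
      unfolding split_beta' by measurable
  qed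
  also have "\<dots> = (\<integral>\<^sup>+q. (\<integral>\<^sup>+x. ?A x q \<partial>lborel)\<^sup>2 * ?c q \<partial>?N)"
  proof (rule nn_integral_cong)
    fix q :: "(real \<times> real) \<times> 'w"
    have [measurable]: "(\<lambda>x. kern t x (fst q)) \<in> borel_measurable borel"
      using measurable_compose[OF measurable_Pair2'[of "fst q" borel borel] kern_measurable[of t]] by simp
    have "(\<integral>\<^sup>+p. ?A (fst p) q * ?A (snd p) q * ?c q \<partial>lborel) = (\<integral>\<^sup>+x. ?A x q \<partial>lborel) * (\<integral>\<^sup>+x. ?A x q \<partial>lborel) * ?c q"
      by (rule nn_integral_lborel_mult) measurable
    then show "(\<integral>\<^sup>+p. ?A (fst p) q * ?A (snd p) q * ?c q \<partial>lborel) = (\<integral>\<^sup>+x. ?A x q \<partial>lborel)\<^sup>2 * ?c q"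
      by (simp only: power2_eq_square)
  qed
  finally show "(\<integral>\<^sup>+\<omega>. ennreal ((\<integral>x. \<phi> x * Z t x \<omega> \<partial>lborel)\<^sup>2) \<partial>M)
      \<le> (\<integral>\<^sup>+q. (\<integral>\<^sup>+x. ?A x q \<partial>lborel)\<^sup>2 * ?c q \<partial>?N)" .
qed

lemma smeared_noise_bound:
  fixes \<phi> :: "real \<Rightarrow> real"
  assumes \<phi>: "continuous_on UNIV \<phi>" and supp: "\<And>x. \<bar>x\<bar> > K \<Longrightarrow> \<phi> x = 0" and B: "\<And>x. \<bar>\<phi> x\<bar> \<le> B" and K: "0 < K"
  obtains t0 \<Phi> where "0 < t0" "(\<Phi> \<longlongrightarrow> 0) (at_right 0)"
    "\<And>t. 0 < t \<Longrightarrow> t \<le> t0 \<Longrightarrow> (\<integral>\<^sup>+\<omega>. ennreal ((\<integral>x. \<phi> x * Z t x \<omega> \<partial>lborel)\<^sup>2) \<partial>M) \<le> \<Phi> t"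
proof -
  let ?N = "(lborel :: (real \<times> real) measure) \<Otimes>\<^sub>M M"
  obtain T t0 x0 C where T: "0 < t0" "t0 < T" "0 < C" and comp:
    "\<And>s t x y. 0 \<le> s \<Longrightarrow> s < t \<Longrightarrow> t \<le> t0 \<Longrightarrow> \<bar>x - x0\<bar> \<le> 1 \<Longrightarrow>
      (\<integral>z. indicator {-K..K} z * G (t - s) (z - y) \<partial>lborel) \<le> C * G (T - s) (x - y)"
    by (rule kernel_comparison[OF K], rule that)
  have T0: "0 < T" using T by simp
  have "0 \<le> B" using order_trans[OF abs_ge_zero B] .
  \<comment> \<open>The energy density of the solution at the single point \<open>(T, x0)\<close>.
    Its total is finite, so the share of times before \<open>t\<close> vanishes with
    \<open>t\<close>.\<close>
  let ?w = "\<lambda>q. ennreal ((kern T x0 (fst q) * coeff q)\<^sup>2)"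
  define \<Psi> where "\<Psi> t = (\<integral>\<^sup>+q. indicator {0<..<t} (fst (fst q)) * ?w q \<partial>?N)" for t
  define \<Phi> where "\<Phi> t = ennreal ((B * C)\<^sup>2) * \<Psi> t" for t
  have [measurable]: "(\<lambda>q. fst (fst q)) \<in> borel_measurable ?N"
    by (rule measurable_compose[OF measurable_fst], simp add: borel_prod[symmetric])
  have wfin: "(\<integral>\<^sup>+q. ?w q \<partial>?N) < \<infinity>"
    using integrand_square_integrable[OF T0, of x0] by (simp add: nn_integral_eq_integral)
  have "(\<Psi> \<longlongrightarrow> 0) (at_right 0)"
  proof (rule tendsto_at_right_sequentially[of 0 1])
    fix S :: "nat \<Rightarrow> real" assume S: "\<And>n. 0 < S n" "S \<longlonglongrightarrow> 0"
    have "(\<lambda>n. \<integral>\<^sup>+q. indicator {0<..<S n} (fst (fst q)) * ?w q \<partial>?N) \<longlonglongrightarrow> (\<integral>\<^sup>+q. 0 \<partial>?N)"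
    proof (rule nn_integral_dominated_convergence[OF _ _ _ _ wfin])
      show "(\<lambda>q. indicator {0<..<S n} (fst (fst q)) * ?w q) \<in> borel_measurable ?N" for n by measurable
      show "AE q in ?N. indicator {0<..<S n} (fst (fst q)) * ?w q \<le> ?w q" for n
        by (intro AE_I2) (auto simp: indicator_def)
      show "AE q in ?N. (\<lambda>n. indicator {0<..<S n} (fst (fst q)) * ?w q) \<longlonglongrightarrow> 0"
      proof (intro AE_I2)
        fix q :: "(real \<times> real) \<times> 'w"
        show "(\<lambda>n. indicator {0<..<S n} (fst (fst q)) * ?w q) \<longlonglongrightarrow> 0"
        proof (cases "0 < fst (fst q)")
          case True
          then have "\<forall>\<^sub>F n in sequentially. S n < fst (fst q)" using S(2) by (intro order_tendstoD)
          then have "\<forall>\<^sub>F n in sequentially. indicator {0<..<S n} (fst (fst q)) * ?w q = 0"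
            by eventually_elim (auto simp: indicator_def)
          then show ?thesis by (rule tendsto_eventually)
        qed (auto simp: indicator_def)
      qed
    qed auto
    then show "(\<lambda>n. \<Psi> (S n)) \<longlonglongrightarrow> 0" by (simp add: \<Psi>_def)
  qed simp
  then have "(\<Phi> \<longlongrightarrow> ennreal ((B * C)\<^sup>2) * 0) (at_right 0)"
    unfolding \<Phi>_def by (intro ennreal_tendsto_cmult) auto
  then have lim: "(\<Phi> \<longlongrightarrow> 0) (at_right 0)" by simp
  show thesis
  proof (rule that[OF T(1) lim])
    fix t assume t: "0 < t" "t \<le> t0"
    have "(\<integral>\<^sup>+\<omega>. ennreal ((\<integral>x. \<phi> x * Z t x \<omega> \<partial>lborel)\<^sup>2) \<partial>M)
      \<le> (\<integral>\<^sup>+q. (\<integral>\<^sup>+x. ennreal (\<bar>\<phi> x\<bar> * kern t x (fst q)) \<partial>lborel)\<^sup>2 * ennreal ((coeff q)\<^sup>2) \<partial>?N)"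
      by (rule smeared_second_moment(2)[OF t(1) \<phi> supp])
    also have "\<dots> \<le> (\<integral>\<^sup>+q. ennreal ((B * C)\<^sup>2) * (indicator {0<..<t} (fst (fst q)) * ?w q) \<partial>?N)"
    proof (rule nn_integral_mono)
      fix q :: "(real \<times> real) \<times> 'w"
      obtain s y \<omega> where q: "q = ((s, y), \<omega>)" by (metis prod.collapse)
      show "(\<integral>\<^sup>+x. ennreal (\<bar>\<phi> x\<bar> * kern t x (fst q)) \<partial>lborel)\<^sup>2 * ennreal ((coeff q)\<^sup>2)
          \<le> ennreal ((B * C)\<^sup>2) * (indicator {0<..<t} (fst (fst q)) * ?w q)"
      proof (cases "0 < s \<and> s < t")
        case True
        have st: "0 < t - s" "0 < T - s" using True t T by auto
        have i: "integrable lborel (\<lambda>x. B * (indicator {-K..K} x * G (t - s) (x - y)))"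
          using st by (intro integrable_mult_right integrable_G_bounded_mult[where B=1]) (auto simp: indicator_def)
        have "(\<integral>\<^sup>+x. ennreal (\<bar>\<phi> x\<bar> * kern t x (fst q)) \<partial>lborel)
           \<le> (\<integral>\<^sup>+x. ennreal (B * (indicator {-K..K} x * G (t - s) (x - y))) \<partial>lborel)"
        proof (intro nn_integral_mono ennreal_leI)
          fix x
          have "\<bar>\<phi> x\<bar> \<le> B * indicator {-K..K} x"
            using B[of x] supp[of x] by (cases "\<bar>x\<bar> \<le> K") (auto simp: indicator_def)
          then have "\<bar>\<phi> x\<bar> * G (t - s) (x - y) \<le> B * indicator {-K..K} x * G (t - s) (x - y)"
            using G_nonneg[OF st(1)] by (intro mult_right_mono) auto
          then show "\<bar>\<phi> x\<bar> * kern t x (fst q) \<le> B * (indicator {-K..K} x * G (t - s) (x - y))"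
            using True by (simp add: kern_def q mult.assoc)
        qed
        also have "\<dots> = ennreal (\<integral>x. B * (indicator {-K..K} x * G (t - s) (x - y)) \<partial>lborel)"
          using G_nonneg[OF st(1)] \<open>0 \<le> B\<close> by (intro nn_integral_eq_integral i) auto
        also have "(\<integral>x. B * (indicator {-K..K} x * G (t - s) (x - y)) \<partial>lborel) = B * (\<integral>x. indicator {-K..K} x * G (t - s) (x - y) \<partial>lborel)"
          by simp
        \<comment> \<open>The late kernel enters here, with the comparison point \<open>x0\<close>
          itself.\<close>
        also have "ennreal \<dots> \<le> ennreal (B * (C * G (T - s) (x0 - y)))"
          using comp[of s t x0 y] True t \<open>0 \<le> B\<close> by (intro ennreal_leI mult_left_mono) auto
        finally have "(\<integral>\<^sup>+x. ennreal (\<bar>\<phi> x\<bar> * kern t x (fst q)) \<partial>lborel)\<^sup>2 \<le> (ennreal (B * (C * G (T - s) (x0 - y))))\<^sup>2"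
          by (rule power_mono) simp
        also have "\<dots> = ennreal ((B * C)\<^sup>2 * (G (T - s) (x0 - y))\<^sup>2)"
          using G_nonneg[OF st(2)] \<open>0 \<le> B\<close> T by (subst ennreal_power) (auto simp: power_mult_distrib mult_ac)
        finally have "(\<integral>\<^sup>+x. ennreal (\<bar>\<phi> x\<bar> * kern t x (fst q)) \<partial>lborel)\<^sup>2 * ennreal ((coeff q)\<^sup>2)
            \<le> ennreal ((B * C)\<^sup>2 * (G (T - s) (x0 - y))\<^sup>2) * ennreal ((coeff q)\<^sup>2)"
          by (rule mult_right_mono) simp
        also have "\<dots> = ennreal ((B * C)\<^sup>2) * ennreal ((G (T - s) (x0 - y) * coeff q)\<^sup>2)"
          by (simp add: ennreal_mult[symmetric] power_mult_distrib mult_ac)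
        finally show ?thesis using True t T by (simp add: kern_def q)
      next
        case False
        then show ?thesis by (auto simp: kern_def q)
      qed
    qed
    also have "\<dots> = \<Phi> t" unfolding \<Phi>_def \<Psi>_def by (rule nn_integral_cmult) measurable
    finally show "(\<integral>\<^sup>+\<omega>. ennreal ((\<integral>x. \<phi> x * Z t x \<omega> \<partial>lborel)\<^sup>2) \<partial>M) \<le> \<Phi> t" .
  qed
qed

lemma J0_smeared_tendsto:
  fixes \<phi> :: "real \<Rightarrow> real"
  assumes \<phi>: "continuous_on UNIV \<phi>" and supp: "\<And>x. \<bar>x\<bar> > K \<Longrightarrow> \<phi> x = 0" and K: "0 < K" and B: "\<And>x. \<bar>\<phi> x\<bar> \<le> B"
  shows "((\<lambda>t. \<integral>x. J0 a \<delta> mp mn t x * \<phi> x \<partial>lborel) \<longlongrightarrow> sint mp mn \<phi>) (at_right 0)"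
    and "\<exists>t0>0. \<forall>t. 0 < t \<longrightarrow> t \<le> t0 \<longrightarrow> integrable lborel (\<lambda>x. J0 a \<delta> mp mn t x * \<phi> x)"
proof -
  let ?g = "\<lambda>\<mu> t x. (\<integral>y. G t (x - y) \<partial>\<mu>) * \<phi> x"
  note p = initial_data_convergence[OF tempered(1) \<phi> supp K B] and n = initial_data_convergence[OF tempered(2) \<phi> supp K B]
  obtain t1 t2 where t1: "0 < t1" "\<And>t. 0 < t \<Longrightarrow> t \<le> t1 \<Longrightarrow> integrable lborel (?g mp t)"
    and t2: "0 < t2" "\<And>t. 0 < t \<Longrightarrow> t \<le> t2 \<Longrightarrow> integrable lborel (?g mn t)"
    using p(2) n(2) by blast
  define t0 where "t0 = min t1 t2"
  have t0: "0 < t0" "\<And>t. 0 < t \<Longrightarrow> t \<le> t0 \<Longrightarrow> integrable lborel (?g mp t)"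
    "\<And>t. 0 < t \<Longrightarrow> t \<le> t0 \<Longrightarrow> integrable lborel (?g mn t)"
    using t1 t2 by (auto simp: t0_def)
  have J: "J0 a \<delta> mp mn t x * \<phi> x = ?g mp t x - ?g mn t x" for t x
    by (simp add: J0_def sint_def left_diff_distrib)
  show "\<exists>t0>0. \<forall>t. 0 < t \<longrightarrow> t \<le> t0 \<longrightarrow> integrable lborel (\<lambda>x. J0 a \<delta> mp mn t x * \<phi> x)"
    unfolding J using t0 by (intro exI[of _ t0]) (auto intro!: Bochner_Integration.integrable_diff)
  have "((\<lambda>t. (\<integral>x. ?g mp t x \<partial>lborel) - (\<integral>x. ?g mn t x \<partial>lborel)) \<longlongrightarrow> sint mp mn \<phi>) (at_right 0)"
    unfolding sint_def by (intro tendsto_diff p(1) n(1))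
  moreover have "\<forall>\<^sub>F t in at_right 0. (\<integral>x. ?g mp t x \<partial>lborel) - (\<integral>x. ?g mn t x \<partial>lborel) = (\<integral>x. J0 a \<delta> mp mn t x * \<phi> x \<partial>lborel)"
    unfolding eventually_at_right_field J
    using t0 by (intro exI[of _ t0]) (auto intro!: Bochner_Integration.integral_diff[symmetric])
  ultimately show "((\<lambda>t. \<integral>x. J0 a \<delta> mp mn t x * \<phi> x \<partial>lborel) \<longlongrightarrow> sint mp mn \<phi>) (at_right 0)"
    by (rule Lim_transform_eventually)
qed

lemma smeared_solution_tendsto:
  fixes \<phi> :: "real \<Rightarrow> real"
  assumes \<phi>: "continuous_on UNIV \<phi>" and supp: "\<And>x. \<bar>x\<bar> > K \<Longrightarrow> \<phi> x = 0" and K: "0 < K" and B: "\<And>x. \<bar>\<phi> x\<bar> \<le> B"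
  shows "((\<lambda>t. \<integral>\<^sup>+ \<omega>. ennreal (((\<integral>x. u t x \<omega> * \<phi> x \<partial>lborel) - sint mp mn \<phi>)\<^sup>2) \<partial>M) \<longlongrightarrow> 0) (at_right 0)"
proof -
  obtain t1 \<Phi> where t1: "0 < t1" and \<Phi>: "(\<Phi> \<longlongrightarrow> 0) (at_right 0)"
    and bnd: "\<And>t. 0 < t \<Longrightarrow> t \<le> t1 \<Longrightarrow> (\<integral>\<^sup>+\<omega>. ennreal ((\<integral>x. \<phi> x * Z t x \<omega> \<partial>lborel)\<^sup>2) \<partial>M) \<le> \<Phi> t"
    using smeared_noise_bound[OF \<phi> supp B K] by blast
  note J = J0_smeared_tendsto[OF \<phi> supp K B]
  obtain t2 where t2: "0 < t2" "\<And>t. 0 < t \<Longrightarrow> t \<le> t2 \<Longrightarrow> integrable lborel (\<lambda>x. J0 a \<delta> mp mn t x * \<phi> x)"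
    using J(2) by blast
  let ?j = "\<lambda>t. (\<integral>x. J0 a \<delta> mp mn t x * \<phi> x \<partial>lborel) - sint mp mn \<phi>"
  let ?b = "\<lambda>t. ennreal (2 * (?j t)\<^sup>2) + 2 * \<Phi> t"
  have le: "(\<integral>\<^sup>+ \<omega>. ennreal (((\<integral>x. u t x \<omega> * \<phi> x \<partial>lborel) - sint mp mn \<phi>)\<^sup>2) \<partial>M) \<le> ?b t"
    if t: "0 < t" "t < min t1 t2" for t
  proof -
    have [measurable]: "(\<lambda>(\<omega>, x). \<phi> x * Z t x \<omega>) \<in> borel_measurable (M \<Otimes>\<^sub>M lborel)"
    proof -
      have [measurable]: "\<phi> \<in> borel_measurable borel" by (rule borel_measurable_continuous_onI[OF \<phi>])
      have "(\<lambda>q. (snd q, fst q)) \<in> measurable (M \<Otimes>\<^sub>M lborel) (lborel \<Otimes>\<^sub>M M)" by measurable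
      from measurable_compose[OF this Z_measurable[OF t(1)]]
      have [measurable]: "(\<lambda>q. Z t (snd q) (fst q)) \<in> borel_measurable (M \<Otimes>\<^sub>M lborel)" by simp
      show ?thesis unfolding split_beta' by measurable
    qed
    have [measurable]: "(\<lambda>\<omega>. \<integral>x. \<phi> x * Z t x \<omega> \<partial>lborel) \<in> borel_measurable M"
      by (rule lborel.borel_measurable_lebesgue_integral) fact
    \<comment> \<open>Where \<open>\<phi> x * Z t x\<close> is integrable, the Bochner integral of
      \<open>u t x * \<phi> x\<close> splits; on the remaining null set its value is
      irrelevant.\<close>
    have "AE \<omega> in M. integrable lborel (\<lambda>x. \<phi> x * Z t x \<omega>)"
      by (rule smeared_second_moment(1)[OF t(1) \<phi> supp])
    then have "AE \<omega> in M. ennreal (((\<integral>x. u t x \<omega> * \<phi> x \<partial>lborel) - sint mp mn \<phi>)\<^sup>2)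
        \<le> ennreal (2 * (?j t)\<^sup>2) + 2 * ennreal ((\<integral>x. \<phi> x * Z t x \<omega> \<partial>lborel)\<^sup>2)"
    proof eventually_elim
      case (elim \<omega>)
      have "(\<integral>x. u t x \<omega> * \<phi> x \<partial>lborel) = (\<integral>x. J0 a \<delta> mp mn t x * \<phi> x + \<phi> x * Z t x \<omega> \<partial>lborel)"
        by (intro Bochner_Integration.integral_cong refl) (simp add: Z_def algebra_simps)
      also have "\<dots> = (\<integral>x. J0 a \<delta> mp mn t x * \<phi> x \<partial>lborel) + (\<integral>x. \<phi> x * Z t x \<omega> \<partial>lborel)"
        using t t2(2)[of t] elim by (intro Bochner_Integration.integral_add) auto
      finally have e: "(\<integral>x. u t x \<omega> * \<phi> x \<partial>lborel) - sint mp mn \<phi> = ?j t + (\<integral>x. \<phi> x * Z t x \<omega> \<partial>lborel)" by simp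
      have "(x + y)\<^sup>2 \<le> 2 * x\<^sup>2 + 2 * y\<^sup>2" for x y :: real
        using zero_le_power2[of "x - y"] by (simp add: power2_eq_square algebra_simps)
      then have "ennreal (((\<integral>x. u t x \<omega> * \<phi> x \<partial>lborel) - sint mp mn \<phi>)\<^sup>2) \<le> ennreal (2 * (?j t)\<^sup>2 + 2 * (\<integral>x. \<phi> x * Z t x \<omega> \<partial>lborel)\<^sup>2)"
        unfolding e by (rule ennreal_leI)
      also have "\<dots> = ennreal (2 * (?j t)\<^sup>2) + ennreal (2 * (\<integral>x. \<phi> x * Z t x \<omega> \<partial>lborel)\<^sup>2)"
        by (rule ennreal_plus) auto
      also have "ennreal (2 * (\<integral>x. \<phi> x * Z t x \<omega> \<partial>lborel)\<^sup>2) = 2 * ennreal ((\<integral>x. \<phi> x * Z t x \<omega> \<partial>lborel)\<^sup>2)"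
        by (subst ennreal_mult) auto
      finally show ?case .
    qed
    then have "(\<integral>\<^sup>+ \<omega>. ennreal (((\<integral>x. u t x \<omega> * \<phi> x \<partial>lborel) - sint mp mn \<phi>)\<^sup>2) \<partial>M)
        \<le> (\<integral>\<^sup>+ \<omega>. ennreal (2 * (?j t)\<^sup>2) + 2 * ennreal ((\<integral>x. \<phi> x * Z t x \<omega> \<partial>lborel)\<^sup>2) \<partial>M)"
      by (rule nn_integral_mono_AE)
    also have "\<dots> = ennreal (2 * (?j t)\<^sup>2) + 2 * (\<integral>\<^sup>+ \<omega>. ennreal ((\<integral>x. \<phi> x * Z t x \<omega> \<partial>lborel)\<^sup>2) \<partial>M)"
      by (subst nn_integral_add) (auto simp: nn_integral_cmult emeasure_space_1)
    also have "\<dots> \<le> ?b t"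
      using bnd[of t] t by (intro add_left_mono mult_left_mono) auto
    finally show ?thesis .
  qed
  have "((\<lambda>t. 2 * (?j t)\<^sup>2) \<longlongrightarrow> 2 * (sint mp mn \<phi> - sint mp mn \<phi>)\<^sup>2) (at_right 0)"
    by (intro tendsto_intros J(1))
  then have "((\<lambda>t. ennreal (2 * (?j t)\<^sup>2)) \<longlongrightarrow> ennreal 0) (at_right 0)"
    by (intro tendsto_ennrealI) simp
  moreover have "((\<lambda>t. 2 * \<Phi> t) \<longlongrightarrow> 2 * 0) (at_right 0)"
    by (intro ennreal_tendsto_cmult \<Phi>) auto
  ultimately have "(?b \<longlongrightarrow> ennreal 0 + 2 * 0) (at_right 0)"
    by (rule tendsto_add)
  then have b: "(?b \<longlongrightarrow> 0) (at_right 0)" by simp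
  show ?thesis
    by (rule tendsto_sandwich[OF _ _ tendsto_const b])
      (use le t1 t2(1) in \<open>auto simp: eventually_at_right_field intro!: exI[of _ "min t1 t2"]\<close>)
qed

end

theorem theorem1p7:
  fixes a \<delta> :: real and M :: "'w measure" and W :: "(real \<times> real) set \<Rightarrow> 'w \<Rightarrow> real"
    and \<rho> :: "real \<Rightarrow> real" and mp mn :: "real measure"
    and u :: "real \<Rightarrow> real \<Rightarrow> 'w \<Rightarrow> real" and \<phi> :: "real \<Rightarrow> real"
  assumes "1 < a" "a \<le> 2" "\<bar>\<delta>\<bar> \<le> 2 - a"
    and "complete_prob M" "white_noise M W"
    and "\<exists>L. \<forall>x y. \<bar>\<rho> x - \<rho> y\<bar> \<le> L * \<bar>x - y\<bar>"
    and "M_star a mp mn"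
    and "is_solution a \<delta> M W \<rho> mp mn u"
    and "continuous_on UNIV \<phi>" "\<exists>K. compact K \<and> (\<forall>x. x \<notin> K \<longrightarrow> \<phi> x = 0)"
  shows "((\<lambda>t. \<integral>\<^sup>+ \<omega>. ennreal (((\<integral>x. u t x \<omega> * \<phi> x \<partial>lborel) - sint mp mn \<phi>)\<^sup>2) \<partial>M) \<longlongrightarrow> 0)
           (at_right 0)"
proof -
  interpret stable_params a \<delta> by unfold_locales fact+
  interpret prob_space M using assms(5) by (simp add: white_noise_def)
  interpret noise_space M W by unfold_locales fact
  obtain L where L: "\<And>x y. \<bar>\<rho> x - \<rho> y\<bar> \<le> L * \<bar>x - y\<bar>" using assms(6) by blast
  have rho: "continuous_on UNIV \<rho>"
  proof -
    \<comment> \<open>The constant \<open>L\<close> may be negative as stated, hence the absolute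
      value.\<close>
    have "\<bar>L\<bar>-lipschitz_on UNIV \<rho>"
    proof (rule lipschitz_onI)
      show "dist (\<rho> x) (\<rho> y) \<le> \<bar>L\<bar> * dist x y" for x y
        using order_trans[OF L mult_right_mono[OF abs_ge_self abs_ge_zero]] by (simp add: dist_real_def)
    qed simp
    then show ?thesis by (rule lipschitz_on_continuous_on)
  qed
  obtain I where I: "\<And>t x. 0 < t \<Longrightarrow> walsh_integral M W
             (\<lambda>s y \<omega>. indicator {0<..<t} s * stableG a \<delta> (t - s) (x - y) * \<rho> (u s y \<omega>)) (I t x)"
      "\<And>t x. 0 < t \<Longrightarrow> ((\<lambda>p. \<integral>\<^sup>+ \<omega>. ennreal ((I (fst p) (snd p) \<omega> - I t x \<omega>)\<^sup>2) \<partial>M) \<longlongrightarrow> 0)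
             (at (t, x) within {0<..} \<times> UNIV)"
      "\<And>t x. 0 < t \<Longrightarrow> AE \<omega> in M. u t x \<omega> = J0 a \<delta> mp mn t x + I t x \<omega>"
    using assms(8) unfolding is_solution_def by blast
  interpret mild_solution a \<delta> M W \<rho> mp mn u I
    by unfold_locales
      (use assms(8) I rho M_star_tempered[OF assms(7)] in \<open>auto simp: is_solution_def\<close>)
  obtain K0 where K0: "compact K0" "\<And>x. x \<notin> K0 \<Longrightarrow> \<phi> x = 0" using assms(10) by blast
  obtain K where K: "0 < K" "\<And>x. x \<in> K0 \<Longrightarrow> \<bar>x\<bar> \<le> K"
    using compact_imp_bounded[OF K0(1)] by (auto simp: bounded_pos)
  have supp: "\<phi> x = 0" if "\<bar>x\<bar> > K" for x
    using K(2)[of x] K0(2)[of x] that by fastforce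
  have "bounded (\<phi> ` {- K..K})"
    by (intro compact_imp_bounded compact_continuous_image continuous_on_subset[OF assms(9)]) auto
  then obtain B where B: "0 < B" "\<And>x. x \<in> {- K..K} \<Longrightarrow> \<bar>\<phi> x\<bar> \<le> B" by (auto simp: bounded_pos)
  have bnd: "\<bar>\<phi> x\<bar> \<le> B" for x
    using B(1) B(2)[of x] supp[of x] by (cases "\<bar>x\<bar> \<le> K") (auto simp: abs_le_iff)
  show ?thesis by (rule smeared_solution_tendsto[OF assms(9) supp K(1) bnd])
qed

end
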